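(* Let $\kappa=8$. Let $F$ be the conformal equivalence from the upper half-plane $\mathbb{H}$ onto the half-strip $\{w\in\mathbb{C}: 0<\Re w<1,\ \Im w>0\}$ whose boundary extension satisfies $F(0)=1$, $F(1)=\infty$ (the infinite end of the half-strip) and $F(\infty)=0$. For $z\in\overline{\mathbb{H}}\setminus\{0\}$ let $\tau_z$ be the swallowing time of $z$ for chordal $\mathrm{SLE}_8$ in $\mathbb{H}$ from $0$ to $\infty$. Then for every $z\in\mathbb{H}$, $$\mathbb{P}(\tau_z<\tau_1)=\Re F(z).$$
   Context: Chordal $\mathrm{SLE}_\kappa$ in the upper half-plane $\mathbb{H}$ from $0$ to $\infty$: let $W_t=\sqrt\kappa B_t$ with $B$ a standard real Brownian motion started from $0$; for each $z\in\overline{\mathbb{H}}\setminus\{0\}$ let $g_t(z)$ solve $\partial_t g_t(z)=\frac{2}{g_t(z)-W_t}$, $g_0(z)=z$. The swallowing time $\tau_z\in(0,\infty]$ is the explosion time of this ODE started from $z$; in particular $\tau_1$ is the explosion time started from the boundary point $1$. The map $F$ is a suitably normalized primitive of a constant multiple of $w^{-1/2}(w-1)^{-1}$. *)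

theory Defs
  imports
    "HOL-Probability.Probability"
    "HOL-Complex_Analysis.Complex_Analysis"
begin

text \<open>
  Standard real Brownian motion started from 0, on the time set \<open>[0, \<infinity>)\<close>; the values of
  \<open>B\<close> at negative times are irrelevant. As usual for a continuous process, every sample path is
  continuous. The second argument of \<^const>\<open>normal_density\<close> is the standard deviation.
\<close>

locale standard_brownian_motion = prob_space M for M :: "'a measure" +
  fixes B :: "real \<Rightarrow> 'a \<Rightarrow> real"
  assumes random_variable_B: "0 \<le> t \<Longrightarrow> random_variable borel (B t)"
    and start: "\<omega> \<in> space M \<Longrightarrow> B 0 \<omega> = 0"
    and continuous_paths: "\<omega> \<in> space M \<Longrightarrow> continuous_on {0..} (\<lambda>t. B t \<omega>)"
    and normal_increments: "0 \<le> s \<Longrightarrow> s < t \<Longrightarrow>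
      distributed M lborel (\<lambda>\<omega>. B t \<omega> - B s \<omega>) (normal_density 0 (sqrt (t - s)))"
    and independent_increments: "0 \<le> p (0::nat) \<Longrightarrow> (\<And>i. i < n \<Longrightarrow> p i \<le> p (Suc i)) \<Longrightarrow>
      indep_vars (\<lambda>_. borel) (\<lambda>i \<omega>. B (p (Suc i)) \<omega> - B (p i) \<omega>) {..<n}"

text \<open>
  \<open>g\<close> solves the chordal Loewner equation with driving function \<open>W\<close> and initial value \<open>z\<close> on the
  time interval \<open>[0, T)\<close>. The requirement \<open>g t \<noteq> W t\<close> is needed because \<open>2 / 0 = 0\<close> in HOL.
\<close>

definition loewner_solution :: "(real \<Rightarrow> real) \<Rightarrow> complex \<Rightarrow> real \<Rightarrow> (real \<Rightarrow> complex) \<Rightarrow> bool" where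
  "loewner_solution W z T g \<longleftrightarrow>
     g 0 = z \<and>
     (\<forall>t\<in>{0..<T}. g t \<noteq> of_real (W t) \<and>
        (g has_vector_derivative 2 / (g t - of_real (W t))) (at t within {0..<T}))"

text \<open>The explosion time is the maximal lifetime of the solution, \<open>\<infinity>\<close> if the solution is global.\<close>

definition swallowing_time :: "(real \<Rightarrow> real) \<Rightarrow> complex \<Rightarrow> ereal" where
  "swallowing_time W z = (SUP T\<in>{T. 0 \<le> T \<and> (\<exists>g. loewner_solution W z T g)}. ereal T)"

definition sle_driving :: "real \<Rightarrow> (real \<Rightarrow> 'a \<Rightarrow> real) \<Rightarrow> 'a \<Rightarrow> real \<Rightarrow> real" where
  "sle_driving \<kappa> B \<omega> t = sqrt \<kappa> * B t \<omega>"

definition sle_swallowing_time ::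
    "real \<Rightarrow> (real \<Rightarrow> 'a \<Rightarrow> real) \<Rightarrow> complex \<Rightarrow> 'a \<Rightarrow> ereal" where
  "sle_swallowing_time \<kappa> B z \<omega> = swallowing_time (sle_driving \<kappa> B \<omega>) z"

definition upper_half_plane :: "complex set" where
  "upper_half_plane = {z. 0 < Im z}"

definition half_strip :: "complex set" where
  "half_strip = {w. 0 < Re w \<and> Re w < 1 \<and> 0 < Im w}"

definition conformal_equivalence :: "(complex \<Rightarrow> complex) \<Rightarrow> complex set \<Rightarrow> complex set \<Rightarrow> bool" where
  "conformal_equivalence F U V \<longleftrightarrow> F holomorphic_on U \<and> bij_betw F U V"

end

(* The proof replaces stochastic calculus by an Euler scheme. Write Z = g_t(z) - W_t, X = g_t(1) - W_t.
   With F' = c w^(-1/2) (w-1)^(-1), c = -i/pi, the function F(Z/X) is annihilated by the generator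
   (2/Z) d_Z + (2/X) d_X + 4 (d_Z + d_X)^2, so Re F(Z/X) is a bounded martingale and Im F(Z/X) a
   positive one. Since c^2 = -1/pi^2, so is the holomorphic function F(Z/X)^2 - (4/pi^2) Ln (Z-X); with
   the bound on Im F and the martingales sqrt Z, sqrt X it shows that |Z - X| does not become small, i.e.
   that z and 1 are not swallowed together; X^2 - 12 t bounds the exit time.
   Hence (Z, X) leaves a compact region almost only where |Z| is small (Re F close to 1) or where X is
   small (Re F close to 0), which gives P(tau_z < tau_1) >= Re F(z) and P(tau_1 < tau_z) >= 1 - Re F(z).
   The chain of Euler steps with Gaussian increments satisfies these martingale identities up to
   O(step^(3/2)) per step, and it converges along every continuous driving path. *)

theory Submission
  imports Defs
begin

text \<open>Randomness enters only through an additive driving term, so for each continuous path the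
  Loewner equation is an ODE and Euler steps converge pathwise. Expectations are taken only for
  finite chains, where optional stopping is a telescoping sum. The price: the step size at which the
  chain starts to follow the flow depends on the path, with no uniform rate. Hence exit events are
  kept for infinitely many step sizes. The limsup of events of probability at least p again has
  probability at least p, and on it every path can pick a step size that is fine enough for it. The
  same device lets the distance e tend to 0. Uniform Taylor remainders need a compact region, so Im
  Z must stay away from 0. The available bound, Im z exp(-4 T / e^2), degenerates as e tends to 0.
  This is harmless: the limiting error terms involve only the bounds on Im F, on the logarithmic
  martingale and on time, so e can be sent to 0 last. Lower bounds for the two probabilities
  suffice, because the events are disjoint and the bounds add up to 1.\<close>

section \<open>The regularised Loewner flow\<close>

text \<open>Cutting off \<open>2 / y\<close> at \<open>\<bar>y\<bar> < c\<close> gives a globally Lipschitz field; its flow is the Loewner flow as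
  long as it stays at distance more than \<open>c\<close> from the driving function.\<close>

definition reg_field :: "real \<Rightarrow> complex \<Rightarrow> complex" where
  "reg_field c y = 2 * cnj y / of_real ((max (cmod y) c)\<^sup>2)"

lemma reg_field_eq: "0 < c \<Longrightarrow> c \<le> cmod y \<Longrightarrow> reg_field c y = 2 / y"
  by (simp add: reg_field_def complex_div_cnj[of 2 y] max_absorb1)

lemma norm_reg_field:
  assumes "0 < c" shows "cmod (reg_field c y) \<le> 2 / max (cmod y) c"
proof -
  let ?m = "max (cmod y) c"
  have m: "?m > 0" using assms by auto
  have "cmod (reg_field c y) = 2 * cmod y / ?m\<^sup>2"
    by (simp add: reg_field_def norm_divide norm_mult norm_power)
  also have "\<dots> \<le> 2 * ?m / ?m\<^sup>2" by (intro divide_right_mono mult_left_mono) auto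
  also have "\<dots> = 2 / ?m" using m by (simp add: power2_eq_square)
  finally show ?thesis .
qed

lemma norm_reg_field':
  assumes "0 < c" shows "cmod (reg_field c y) \<le> 2 / c"
proof -
  have "2 / max (cmod y) c \<le> 2 / c" using assms by (intro divide_left_mono) auto
  then show ?thesis using norm_reg_field[OF assms, of y] by linarith
qed

text \<open>With \<open>p\<close> and \<open>q\<close> the truncated moduli, the difference splits
  into a change of the numerator at fixed \<open>p\<close>, costing 2 / c^2, and a change of 1 /
  p^2, costing 4 / c^2. The second uses that truncation is 1-Lipschitz and that
  \<open>cmod b\<close> is absorbed by \<open>q\<close>.\<close>

lemma reg_field_lipschitz:
  assumes c: "0 < c"
  shows "cmod (reg_field c a - reg_field c b) \<le> 6 / c\<^sup>2 * cmod (a - b)"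
proof -
  define p where "p = max (cmod a) c"
  define q where "q = max (cmod b) c"
  have pq: "p > 0" "q > 0" "p \<ge> c" "q \<ge> c" "cmod b \<le> q" using c by (auto simp: p_def q_def)
  have d: "\<bar>q - p\<bar> \<le> cmod (a - b)"
    using norm_triangle_ineq3[of a b] unfolding p_def q_def by linarith
  have e: "reg_field c a - reg_field c b
      = 2 * cnj (a - b) / of_real (p\<^sup>2) + of_real (2 * (q - p) * ((q + p) / (p\<^sup>2 * q\<^sup>2))) * cnj b"
    using pq by (simp add: reg_field_def p_def[symmetric] q_def[symmetric] field_simps power2_eq_square)
  have n1: "cmod (2 * cnj (a - b) / of_real (p\<^sup>2)) \<le> 2 / c\<^sup>2 * cmod (a - b)"
  proof -
    have "cmod (2 * cnj (a - b) / of_real (p\<^sup>2)) = 2 * cmod (a - b) / p\<^sup>2"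
      by (simp only: norm_divide norm_mult complex_mod_cnj) (simp add: norm_power)
    also have "\<dots> \<le> 2 * cmod (a - b) / c\<^sup>2"
      using pq c by (intro divide_left_mono power_mono) auto
    finally show ?thesis by simp
  qed
  have n2: "cmod (of_real (2 * (q - p) * ((q + p) / (p\<^sup>2 * q\<^sup>2))) * cnj b) \<le> 4 / c\<^sup>2 * cmod (a - b)"
  proof -
    have "cmod (of_real (2 * (q - p) * ((q + p) / (p\<^sup>2 * q\<^sup>2))) * cnj b)
        = 2 * \<bar>q - p\<bar> * ((q + p) / (p\<^sup>2 * q\<^sup>2)) * cmod b"
      using pq by (simp only: norm_mult complex_mod_cnj norm_of_real abs_mult abs_divide) simp
    also have "\<dots> \<le> 2 * cmod (a - b) * ((q + p) / (p\<^sup>2 * q\<^sup>2)) * q"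
      using d pq by (intro mult_mono mult_nonneg_nonneg divide_nonneg_nonneg) auto
    also have "\<dots> = 2 * cmod (a - b) * (1 / p\<^sup>2 + 1 / (p * q))"
      using pq by (simp add: field_simps power2_eq_square)
    also have "\<dots> \<le> 2 * cmod (a - b) * (1 / c\<^sup>2 + 1 / (c * c))"
      using pq c by (intro mult_left_mono add_mono divide_left_mono power_mono mult_mono) auto
    finally show ?thesis by (simp add: power2_eq_square)
  qed
  have "cmod (reg_field c a - reg_field c b) \<le> 2 / c\<^sup>2 * cmod (a - b) + 4 / c\<^sup>2 * cmod (a - b)"
    unfolding e using norm_triangle_le[OF add_mono[OF n1 n2]] by simp
  then show ?thesis by (simp add: field_simps)
qed

lemma continuous_on_reg_field:
  assumes "0 < c" "continuous_on S f" shows "continuous_on S (\<lambda>s. reg_field c (f s))"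
  unfolding reg_field_def using assms by (intro continuous_intros) auto

definition reg_solution :: "real \<Rightarrow> (real \<Rightarrow> real) \<Rightarrow> complex \<Rightarrow> (real \<Rightarrow> complex) \<Rightarrow> bool" where
  "reg_solution c W z G \<longleftrightarrow> G 0 = z \<and>
     (\<forall>t\<ge>0. (G has_vector_derivative reg_field c (G t - of_real (W t))) (at t within {0..}))"

lemma integral_deriv_ge:
  fixes f :: "real \<Rightarrow> complex"
  assumes "continuous_on {0..} f" "0 \<le> t"
  shows "((\<lambda>u. integral {0..u} f) has_vector_derivative f t) (at t within {0..})"
proof -
  have "((\<lambda>u. integral {0..u} f) has_vector_derivative f t) (at t within {0..t+1})"
    using assms by (intro integral_has_vector_derivative continuous_on_subset[OF assms(1)]) auto
  moreover have "at t within {0..t+1} = at t within {0..}"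
    using assms(2) by (intro at_within_nhd[where S="{..<t+1}"]) auto
  ultimately show ?thesis by simp
qed

text \<open>Picard iteration in the weighted norm \<open>sup\<^sub>t e\<^sup>-\<^sup>l\<^sup>t \<bar>u t\<bar>\<close>, which makes the integral operator a
  contraction on the whole half-line.\<close>

lemma reg_solution_exists:
  assumes c: "0 < c" and W: "continuous_on {0..} W"
  shows "\<exists>G. reg_solution c W z G"
proof -
  define L where "L = 6 / c\<^sup>2"
  have L: "L > 0" using c by (simp add: L_def)
  \<comment> \<open>A weight of twice the Lipschitz constant gives the contraction factor
    \<open>L / l\<close> = 1/2.\<close>
  define l where "l = 2 * L"
  have l: "l > 0" using L by (simp add: l_def)
  define f where "f u s = reg_field c (z + exp (l * s) *\<^sub>R u s - of_real (W s))" for u :: "real \<Rightarrow> complex" and s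
  have cf: "continuous_on {0..} (f u)" if "continuous_on UNIV u" for u
    unfolding f_def using that
    by (intro continuous_on_reg_field c continuous_intros W continuous_on_subset[OF that]) auto
  \<comment> \<open>The solution is sought as z + exp (l t) u t. Bounded continuous functions live
    on the whole line here, hence the extension by \<open>max t 0\<close>.\<close>
  define P where "P u t = exp (- l * max t 0) *\<^sub>R integral {0..max t 0} (f u)" for u t
  have contI: "continuous_on {0..} (\<lambda>u. integral {0..u} (f v))" if "continuous_on UNIV v" for v
    using integral_deriv_ge[OF cf[OF that]]
    by (auto simp: continuous_on_eq_continuous_within intro!: has_vector_derivative_continuous)
  have bI: "cmod (integral {0..t} (f u)) \<le> 2 / c * t" if "continuous_on UNIV u" "0 \<le> t" for u t
    using integral_bound[of 0 t "f u" "2/c"] continuous_on_subset[OF cf[OF that(1)], of "{0..t}"] that(2)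
      norm_reg_field'[OF c] by (auto simp: f_def)
  have expb: "exp (- l * t) * t \<le> 1 / l" for t
  proof -
    have "l * t \<le> exp (l * t)" using exp_ge_add_one_self[of "l*t"] by linarith
    then show ?thesis using l by (simp add: exp_minus field_simps)
  qed
  have PB: "P (apply_bcontfun u) \<in> bcontfun" for u
  proof -
    have cu: "continuous_on UNIV (apply_bcontfun u)" by (simp add: continuous_on_apply_bcontfun)
    have "continuous_on UNIV (P (apply_bcontfun u))"
      unfolding P_def
      by (intro continuous_intros continuous_on_compose2[OF contI[OF cu]]) auto
    moreover have "cmod (P (apply_bcontfun u) t) \<le> 2 / c * (1 / l)" for t
    proof -
      have "cmod (P (apply_bcontfun u) t) \<le> exp (- l * max t 0) * (2 / c * max t 0)"
        unfolding P_def norm_scaleR using bI[OF cu, of "max t 0"] by (intro mult_mono) auto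
      also have "\<dots> = 2 / c * (exp (- l * max t 0) * max t 0)" by simp
      also have "\<dots> \<le> 2 / c * (1 / l)" using expb[of "max t 0"] c by (intro mult_left_mono) auto
      finally show ?thesis .
    qed
    ultimately show ?thesis unfolding bcontfun_def by (auto intro!: boundedI)
  qed
  define Q where "Q u = Bcontfun (P (apply_bcontfun u))" for u
  have Qapp: "apply_bcontfun (Q u) = P (apply_bcontfun u)" for u
    unfolding Q_def using PB by (simp add: Bcontfun_inverse)
  have contr: "dist (Q u) (Q v) \<le> 1/2 * dist u v" for u v
  proof (rule dist_bound)
    fix t :: real
    define s where "s = max t 0"
    have s: "s \<ge> 0" by (simp add: s_def)
    have cu: "continuous_on UNIV (apply_bcontfun u)" for u :: "real \<Rightarrow>\<^sub>C complex"
      by (simp add: continuous_on_apply_bcontfun)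
    have int: "f (apply_bcontfun u) integrable_on {0..s}" for u
      by (intro integrable_continuous_interval continuous_on_subset[OF cf[OF cu]]) auto
    have hasI: "((\<lambda>r. L * exp (l * r) * dist u v) has_integral (exp (l * s) / 2 - exp (l * 0) / 2) * dist u v) {0..s}"
    proof (rule has_integral_mult_left)
      show "((\<lambda>r. L * exp (l * r)) has_integral (exp (l * s) / 2 - exp (l * 0) / 2)) {0..s}"
        using s L by (intro fundamental_theorem_of_calculus)
          (auto intro!: derivative_eq_intros simp: l_def has_real_derivative_iff_has_vector_derivative[symmetric])
    qed
    have "cmod (integral {0..s} (f (apply_bcontfun u)) - integral {0..s} (f (apply_bcontfun v)))
        = cmod (integral {0..s} (\<lambda>r. f (apply_bcontfun u) r - f (apply_bcontfun v) r))"
      using int by (simp add: integral_diff)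
    also have "\<dots> \<le> integral {0..s} (\<lambda>r. L * exp (l * r) * dist u v)"
    proof (rule integral_norm_bound_integral)
      fix r assume "r \<in> {0..s}"
      have "cmod (f (apply_bcontfun u) r - f (apply_bcontfun v) r)
          \<le> L * cmod (exp (l * r) *\<^sub>R u r - exp (l * r) *\<^sub>R v r)"
        unfolding f_def L_def using reg_field_lipschitz[OF c, of "z + exp (l * r) *\<^sub>R u r - W r" "z + exp (l * r) *\<^sub>R v r - W r"]
        by simp
      also have "\<dots> = L * (exp (l * r) * dist (u r) (v r))"
        by (simp add: dist_norm flip: scaleR_diff_right)
      also have "\<dots> \<le> L * (exp (l * r) * dist u v)"
        using L by (intro mult_left_mono dist_bounded) auto
      finally show "cmod (f (apply_bcontfun u) r - f (apply_bcontfun v) r) \<le> L * exp (l * r) * dist u v" by simp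
    qed (use int hasI in \<open>auto intro: integrable_diff has_integral_integrable\<close>)
    also have "\<dots> = (exp (l * s) / 2 - 1 / 2) * dist u v" using integral_unique[OF hasI] by (simp del: integral_mult_left integral_mult_right)
    also have "\<dots> \<le> exp (l * s) / 2 * dist u v" by (intro mult_right_mono) auto
    finally have *: "cmod (integral {0..s} (f (apply_bcontfun u)) - integral {0..s} (f (apply_bcontfun v))) \<le> exp (l * s) / 2 * dist u v" .
    have "dist (P (apply_bcontfun u) t) (P (apply_bcontfun v) t) =
      exp (- l * s) * cmod (integral {0..s} (f (apply_bcontfun u)) - integral {0..s} (f (apply_bcontfun v)))"
      unfolding P_def s_def by (simp add: dist_norm flip: scaleR_diff_right)
    also have "\<dots> \<le> exp (- l * s) * (exp (l * s) / 2 * dist u v)"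
      using * by (intro mult_left_mono) auto
    also have "\<dots> = 1/2 * dist u v" by (simp add: exp_minus)
    finally show "dist (apply_bcontfun (Q u) t) (apply_bcontfun (Q v) t) \<le> 1/2 * dist u v" by (simp add: Qapp)
  qed
  have "\<exists>!u. Q u = u"
    by (rule banach_fix_type[of "1/2"]) (use contr in auto)
  then obtain u where u: "Q u = u" by auto
  define v where "v = apply_bcontfun u"
  have vP: "v = P v" using Qapp[of u] u by (simp add: v_def)
  have cv: "continuous_on UNIV v" by (simp add: v_def continuous_on_apply_bcontfun)
  define G where "G t = z + integral {0..t} (f v)" for t
  have eG: "exp (l * t) *\<^sub>R v t = integral {0..t} (f v)" if "t \<ge> 0" for t
    using that by (subst vP) (simp add: P_def max_absorb1 flip: exp_add)
  have "(G has_vector_derivative reg_field c (G t - of_real (W t))) (at t within {0..})" if t: "t \<ge> 0" for t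
  proof -
    have "(G has_vector_derivative 0 + f v t) (at t within {0..})"
      unfolding G_def by (intro has_vector_derivative_add has_vector_derivative_const integral_deriv_ge cf cv t)
    moreover have "f v t = reg_field c (G t - of_real (W t))"
      unfolding f_def G_def eG[OF t] ..
    ultimately show ?thesis by simp
  qed
  then show ?thesis unfolding reg_solution_def by (intro exI[of _ G]) (auto simp: G_def)
qed

section \<open>Euler approximation and uniqueness of the regularised flow\<close>

definition reg_solution_on :: "real \<Rightarrow> (real \<Rightarrow> real) \<Rightarrow> complex \<Rightarrow> real \<Rightarrow> (real \<Rightarrow> complex) \<Rightarrow> bool" where
  "reg_solution_on c W z T G \<longleftrightarrow> G 0 = z \<and>
     (\<forall>t\<in>{0..T}. (G has_vector_derivative reg_field c (G t - of_real (W t))) (at t within {0..T}))"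

lemma reg_solution_onI: "reg_solution c W z G \<Longrightarrow> reg_solution_on c W z T G"
  unfolding reg_solution_def reg_solution_on_def
  by (auto intro: has_vector_derivative_within_subset[of _ _ _ "{0..}"])

lemma reg_solution_on_subset: "reg_solution_on c W z T G \<Longrightarrow> S \<le> T \<Longrightarrow> reg_solution_on c W z S G"
  unfolding reg_solution_on_def
  by (auto intro: has_vector_derivative_within_subset[of _ _ _ "{0..T}"])

lemma vector_derivative_bound:
  fixes f :: "real \<Rightarrow> complex"
  assumes "\<And>x. x \<in> {a..b} \<Longrightarrow> (f has_vector_derivative f' x) (at x within {a..b})"
    and "\<And>x. x \<in> {a..b} \<Longrightarrow> cmod (f' x) \<le> B" and "a \<le> b"
  shows "cmod (f b - f a) \<le> B * (b - a)"
proof -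
  have "cmod (f b - f a) \<le> B * norm (b - a)"
  proof (rule differentiable_bound[of "{a..b}" f "\<lambda>x h. h *\<^sub>R f' x"])
    show "(f has_derivative (\<lambda>h. h *\<^sub>R f' x)) (at x within {a..b})" if "x \<in> {a..b}" for x
      using assms(1)[OF that] by (simp add: has_vector_derivative_def)
    show "onorm (\<lambda>h. h *\<^sub>R f' x) \<le> B" if "x \<in> {a..b}" for x
      using mult_left_mono[OF assms(2)[OF that] abs_ge_zero] by (intro onorm_le) (simp add: mult.commute)
  qed (use assms(3) in auto)
  then show ?thesis using assms(3) by simp
qed

text \<open>The \<open>i\<close>-th iterate reads the driving path only at the times j * d with j <
  i, which makes it a measurable function of the path.\<close>

primrec euler :: "real \<Rightarrow> (real \<Rightarrow> real) \<Rightarrow> complex \<Rightarrow> real \<Rightarrow> nat \<Rightarrow> complex" where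
  "euler c W z d 0 = z"
| "euler c W z d (Suc i) = euler c W z d i + d *\<^sub>R reg_field c (euler c W z d i - of_real (W (real i * d)))"

lemma reg_solution_on_lipschitz:
  assumes "reg_solution_on c W z T G" "0 < c" "0 \<le> s" "s \<le> t" "t \<le> T"
  shows "cmod (G t - G s) \<le> 2 / c * (t - s)"
  using assms norm_reg_field'[OF assms(2)] unfolding reg_solution_on_def
  by (intro vector_derivative_bound[where f'="\<lambda>t. reg_field c (G t - of_real (W t))"])
     (auto intro: has_vector_derivative_within_subset[of _ _ _ "{0..T}"])

text \<open>\<open>w\<close> bounds how far G - W moves during one step, so the local error is
  \<open>L * w * d\<close>. The recursion e -> (1 + d L) e + L w d has the closed form w ((1 + d
  L)^i - 1). Of the driving path only the oscillation \<open>h\<close> enters, no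
  smoothness.\<close>

lemma euler_error:
  assumes G: "reg_solution_on c W z T G" and c: "0 < c" and d: "0 < d" "0 \<le> h"
    and W: "\<And>s t. 0 \<le> s \<Longrightarrow> s \<le> t \<Longrightarrow> t \<le> s + d \<Longrightarrow> t \<le> T \<Longrightarrow> \<bar>W t - W s\<bar> \<le> h"
    and i: "real i * d \<le> T"
  shows "cmod (G (real i * d) - euler c W z d i) \<le> (2 / c * d + h) * exp (6 / c\<^sup>2 * T)"
proof -
  define L where "L = 6 / c\<^sup>2"
  have L: "L > 0" using c by (simp add: L_def)
  define w where "w = 2 / c * d + h"
  have w: "w \<ge> 0" using c d by (simp add: w_def)
  let ?v = "\<lambda>t. reg_field c (G t - of_real (W t))"
  let ?e = "euler c W z d"
  have step: "cmod (G (t + d) - G t - d *\<^sub>R ?v t) \<le> L * w * d" if t: "0 \<le> t" "t + d \<le> T" for t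
  proof -
    have "cmod ((\<lambda>s. G s - s *\<^sub>R ?v t) (t + d) - (\<lambda>s. G s - s *\<^sub>R ?v t) t) \<le> (L * w) * ((t + d) - t)"
    proof (rule vector_derivative_bound[where f'="\<lambda>s. ?v s - ?v t"])
      fix s assume s: "s \<in> {t..t+d}"
      have "(G has_vector_derivative ?v s) (at s within {t..t+d})"
        using G t s d unfolding reg_solution_on_def
        by (auto intro: has_vector_derivative_within_subset[of _ _ _ "{0..T}"])
      then show "((\<lambda>s. G s - s *\<^sub>R ?v t) has_vector_derivative ?v s - ?v t) (at s within {t..t+d})"
        by (auto intro!: derivative_eq_intros)
      have "cmod (?v s - ?v t) \<le> L * cmod ((G s - G t) - of_real (W s - W t))"
        using reg_field_lipschitz[OF c, of "G s - of_real (W s)" "G t - of_real (W t)"]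
        by (simp add: L_def algebra_simps)
      also have "\<dots> \<le> L * (cmod (G s - G t) + \<bar>W s - W t\<bar>)"
        using L norm_triangle_ineq4[of "G s - G t" "of_real (W s - W t)"]
        unfolding norm_of_real by (intro mult_left_mono) auto
      also have "\<dots> \<le> L * (2 / c * d + h)"
      proof (intro mult_left_mono add_mono)
        have "cmod (G s - G t) \<le> 2 / c * (s - t)"
          using reg_solution_on_lipschitz[OF G c, of t s] t s by auto
        also have "\<dots> \<le> 2 / c * d" using s c by (intro mult_left_mono) auto
        finally show "cmod (G s - G t) \<le> 2 / c * d" .
        show "\<bar>W s - W t\<bar> \<le> h" using W[of t s] s t by auto
      qed (use L in auto)
      finally show "cmod (?v s - ?v t) \<le> L * w" by (simp add: w_def)
    qed (use d in auto)
    then show ?thesis by (simp add: algebra_simps)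
  qed
  have ind: "real i * d \<le> T \<Longrightarrow> cmod (G (real i * d) - ?e i) \<le> w * ((1 + d * L) ^ i - 1)" for i
  proof (induction i)
    case 0
    then show ?case using G by (simp add: reg_solution_on_def)
  next
    case (Suc i)
    have iT: "real i * d \<le> T" "real i * d + d \<le> T" using Suc.prems d by (auto simp: algebra_simps)
    define t where "t = real i * d"
    have t: "real (Suc i) * d = t + d" by (simp add: t_def algebra_simps)
    have lip: "cmod (?v t - reg_field c (?e i - of_real (W t))) \<le> L * cmod (G t - ?e i)"
      using reg_field_lipschitz[OF c, of "G t - of_real (W t)" "?e i - of_real (W t)"] by (simp add: L_def)
    have "G (t + d) - ?e (Suc i) = (G (t + d) - G t - d *\<^sub>R ?v t) + ((G t - ?e i) + d *\<^sub>R (?v t - reg_field c (?e i - of_real (W t))))"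
      by (simp add: t_def scaleR_diff_right)
    also have "cmod \<dots> \<le> L * w * d + (cmod (G t - ?e i) + d * (L * cmod (G t - ?e i)))"
      using step[of t] iT d lip
      by (intro order_trans[OF norm_triangle_ineq] add_mono) (auto simp: t_def)
    also have "\<dots> = L * w * d + (1 + d * L) * cmod (G t - ?e i)" by (simp add: algebra_simps)
    also have "\<dots> \<le> L * w * d + (1 + d * L) * (w * ((1 + d * L) ^ i - 1))"
      using Suc.IH[OF iT(1)] d L by (intro add_left_mono mult_left_mono) (auto simp: t_def)
    also have "\<dots> = w * ((1 + d * L) ^ Suc i - 1)" by (simp add: algebra_simps)
    finally show ?case by (simp only: t)
  qed
  have "(1 + d * L) ^ i \<le> exp (d * L) ^ i" using d L exp_ge_add_one_self[of "d * L"] by (intro power_mono) auto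
  also have "\<dots> = exp (real i * d * L)" by (simp add: exp_of_nat_mult[symmetric] mult.assoc)
  also have "\<dots> \<le> exp (L * T)" using i L by (simp add: mult.commute)
  finally have "w * ((1 + d * L) ^ i - 1) \<le> w * exp (L * T)" using w by (intro mult_left_mono) auto
  then show ?thesis using ind[OF i] by (simp add: w_def L_def)
qed

lemma mesh_ex:
  fixes W :: "real \<Rightarrow> real"
  assumes W: "continuous_on {0..} W" and "0 < h"
  obtains d where "0 < d" "\<And>s t. 0 \<le> s \<Longrightarrow> s \<le> t \<Longrightarrow> t \<le> s + d \<Longrightarrow> t \<le> T \<Longrightarrow> \<bar>W t - W s\<bar> \<le> (h :: real)"
proof -
  have "uniformly_continuous_on {0..T} W"
    by (intro compact_uniformly_continuous continuous_on_subset[OF W]) auto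
  then obtain e where e: "e > 0" "\<And>s t. s \<in> {0..T} \<Longrightarrow> t \<in> {0..T} \<Longrightarrow> dist t s < e \<Longrightarrow> dist (W t) (W s) < h"
    using \<open>0 < h\<close> unfolding uniformly_continuous_on_def by blast
  show ?thesis
  proof (rule that[of "e/2"])
    fix s t assume "0 \<le> s" "s \<le> t" "t \<le> s + e/2" "t \<le> T"
    then show "\<bar>W t - W s\<bar> \<le> h" using e(2)[of s t] e(1) by (auto simp: dist_real_def)
  qed (use e in auto)
qed

text \<open>The threshold \<open>d0\<close> is chosen before \<open>z\<close> and the solution, so
  that one step size serves both marked points.\<close>

lemma euler_error_small:
  assumes W: "continuous_on {0..} W" and c: "0 < c" and h: "0 < h"
  obtains d0 where "0 < d0" "\<And>z G d i. reg_solution_on c W z T G \<Longrightarrow> 0 < d \<Longrightarrow> d \<le> d0 \<Longrightarrow> real i * d \<le> T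
     \<Longrightarrow> cmod (G (real i * d) - euler c W z d i) \<le> h"
proof -
  define E where "E = exp (6 / c\<^sup>2 * T)"
  have E: "E > 0" by (simp add: E_def)
  obtain d1 where d1: "0 < d1" "\<And>s t. 0 \<le> s \<Longrightarrow> s \<le> t \<Longrightarrow> t \<le> s + d1 \<Longrightarrow> t \<le> T \<Longrightarrow> \<bar>W t - W s\<bar> \<le> h / (2 * E)"
    using mesh_ex[OF W, of "h / (2 * E)" T] h E by auto
  define d0 where "d0 = min d1 (h * c / (4 * E))"
  show ?thesis
  proof (rule that[of d0])
    show "0 < d0" using d1 h c E by (simp add: d0_def)
    fix z G d i
    assume G: "reg_solution_on c W z T G" and d: "0 < d" "d \<le> d0" and i: "real i * d \<le> T"
    have "cmod (G (real i * d) - euler c W z d i) \<le> (2 / c * d + h / (2 * E)) * E"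
      unfolding E_def
    proof (rule euler_error[OF G c d(1) _ _ i])
      fix s t assume "0 \<le> s" "s \<le> t" "t \<le> s + d" "t \<le> T"
      then show "\<bar>W t - W s\<bar> \<le> h / (2 * exp (6 / c\<^sup>2 * T))" using d1(2)[of s t] d by (auto simp: d0_def E_def)
    qed (use h in auto)
    also have "\<dots> = 2 / c * d * E + h / 2" using E by (simp add: field_simps)
    also have "2 / c * d * E \<le> 2 / c * (h * c / (4 * E)) * E"
      using d c E by (intro mult_right_mono mult_left_mono) (auto simp: d0_def)
    also have "\<dots> = h / 2" using c E by simp
    finally show "cmod (G (real i * d) - euler c W z d i) \<le> h" by simp
  qed
qed

text \<open>Serves twice: two solutions are limits of the same Euler points, hence equal; and the
  flow is a pointwise limit of measurable functions of the path.\<close>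

lemma euler_tendsto:
  assumes W: "continuous_on {0..} W" and c: "0 < c" and G: "reg_solution_on c W z t G" and t: "0 \<le> t"
  shows "(\<lambda>n. euler c W z (t / real (Suc n)) (Suc n)) \<longlonglongrightarrow> G t"
proof (cases "t = 0")
  case True
  have "euler c W z 0 n = z" for n by (induction n) auto
  then show ?thesis using True G by (simp add: reg_solution_on_def)
next
  case False
  show ?thesis
  proof (rule tendstoI)
    fix e :: real assume e: "e > 0"
    obtain d0 where d0: "0 < d0" "\<And>z G d i. reg_solution_on c W z t G \<Longrightarrow> 0 < d \<Longrightarrow> d \<le> d0 \<Longrightarrow> real i * d \<le> t
     \<Longrightarrow> cmod (G (real i * d) - euler c W z d i) \<le> e / 2"
      using euler_error_small[OF W c, of "e/2" t] e by auto
    have "eventually (\<lambda>n. t / real (Suc n) < d0) sequentially"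
      using order_tendstoD(2)[OF LIMSEQ_Suc[OF lim_const_over_n[of t]] d0(1)] by simp
    then show "eventually (\<lambda>n. dist (euler c W z (t / real (Suc n)) (Suc n)) (G t) < e) sequentially"
    proof eventually_elim
      case (elim n)
      have "cmod (G (real (Suc n) * (t / real (Suc n))) - euler c W z (t / real (Suc n)) (Suc n)) \<le> e / 2"
        using elim False t by (intro d0(2)[OF G]) auto
      then show ?case using e by (simp add: dist_norm norm_minus_commute)
    qed
  qed
qed

lemma reg_solution_unique:
  assumes "continuous_on {0..} W" "0 < c" "reg_solution_on c W z T G" "reg_solution_on c W z T H" "0 \<le> t" "t \<le> T"
  shows "G t = H t"
proof (rule LIMSEQ_unique)
  show "(\<lambda>n. euler c W z (t / real (Suc n)) (Suc n)) \<longlonglongrightarrow> G t"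
    using assms by (intro euler_tendsto reg_solution_on_subset[of c W z T G t]) auto
  show "(\<lambda>n. euler c W z (t / real (Suc n)) (Suc n)) \<longlonglongrightarrow> H t"
    using assms by (intro euler_tendsto reg_solution_on_subset[of c W z T H t]) auto
qed

section \<open>Lifetime of the flow and the swallowing time\<close>

definition reg_flow :: "real \<Rightarrow> (real \<Rightarrow> real) \<Rightarrow> complex \<Rightarrow> real \<Rightarrow> complex" where
  "reg_flow c W z = (SOME G. reg_solution c W z G)"

lemma reg_flow: "0 < c \<Longrightarrow> continuous_on {0..} W \<Longrightarrow> reg_solution c W z (reg_flow c W z)"
  unfolding reg_flow_def using someI_ex[where P="reg_solution c W z", OF reg_solution_exists] by blast

text \<open>Staying strictly beyond the cutoff on a closed time interval is an open condition, so it
  extends past \<open>t\<close>. As long as it holds, the regularised flow is the true Loewner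
  flow.\<close>

definition alive :: "real \<Rightarrow> (real \<Rightarrow> real) \<Rightarrow> complex \<Rightarrow> real \<Rightarrow> bool" where
  "alive c W z t \<longleftrightarrow> (\<forall>s\<in>{0..t}. c < cmod (reg_flow c W z s - of_real (W s)))"

lemma continuous_on_reg_flow:
  assumes "0 < c" "continuous_on {0..} W"
  shows "continuous_on {0..} (reg_flow c W z)"
  using reg_flow[OF assms] unfolding reg_solution_def continuous_on_eq_continuous_within
  by (auto intro: has_vector_derivative_continuous)

text \<open>While the \<open>c\<close>-flow stays beyond \<open>c\<close>, both truncated fields
  equal 2 / y along it, so it also solves the \<open>c'\<close>-equation, and uniqueness applies.
  This makes all cutoffs compatible.\<close>

lemma alive_reg_flow_eq:
  assumes W: "continuous_on {0..} W" and c: "0 < c'" "c' \<le> c" and a: "alive c W z t" and s: "0 \<le> s" "s \<le> t"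
  shows "reg_flow c' W z s = reg_flow c W z s"
proof (rule reg_solution_unique[OF W c(1) _ _ s])
  show "reg_solution_on c' W z t (reg_flow c' W z)" by (intro reg_solution_onI reg_flow c W)
  show "reg_solution_on c' W z t (reg_flow c W z)"
    unfolding reg_solution_on_def
  proof (intro conjI ballI)
    have c0: "0 < c" using c by simp
    note r = reg_flow[OF c0 W, of z]
    show "reg_flow c W z 0 = z" using r by (simp add: reg_solution_def)
    fix u assume u: "u \<in> {0..t}"
    have "reg_field c (reg_flow c W z u - of_real (W u)) = reg_field c' (reg_flow c W z u - of_real (W u))"
      using bspec[OF a[unfolded alive_def] u] c by (simp add: reg_field_eq)
    moreover have "(reg_flow c W z has_vector_derivative reg_field c (reg_flow c W z u - of_real (W u))) (at u within {0..t})"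
      using r u by (auto simp: reg_solution_def intro: has_vector_derivative_within_subset[of _ _ _ "{0..}"])
    ultimately show "(reg_flow c W z has_vector_derivative reg_field c' (reg_flow c W z u - of_real (W u))) (at u within {0..t})"
      by (simp only:)
  qed
qed

lemma alive_mono:
  assumes W: "continuous_on {0..} W" and c: "0 < c'" "c' \<le> c" and a: "alive c W z t"
  shows "alive c' W z t"
  unfolding alive_def
proof
  fix s assume "s \<in> {0..t}"
  then show "c' < cmod (reg_flow c' W z s - of_real (W s))"
    using alive_reg_flow_eq[OF W c a, of s] c bspec[OF a[unfolded alive_def], of s] by auto
qed

lemma alive_extend:
  assumes W: "continuous_on {0..} W" and c: "0 < c" and a: "alive c W z t" and t: "0 \<le> t"
  shows "\<exists>u>t. alive c W z u"
proof -
  let ?f = "\<lambda>s. cmod (reg_flow c W z s - of_real (W s))"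
  have cont: "continuous_on {0..} ?f" by (intro continuous_intros continuous_on_reg_flow c W)
  have "(?f \<longlongrightarrow> ?f t) (at t within {0..})"
    using cont t by (auto simp: continuous_on_def)
  then have "eventually (\<lambda>s. c < ?f s) (at t within {0..})"
    using a t by (intro order_tendstoD) (auto simp: alive_def)
  then obtain d where d: "d > 0" "\<And>s. s \<in> {0..} \<Longrightarrow> s \<noteq> t \<Longrightarrow> dist s t < d \<Longrightarrow> c < ?f s"
    unfolding eventually_at by auto
  have "alive c W z (t + d/2)"
    unfolding alive_def
  proof
    fix s assume s: "s \<in> {0..t + d/2}"
    show "c < ?f s"
      using a d(2)[of s] s d(1) by (cases "s \<le> t") (auto simp: alive_def dist_real_def)
  qed
  then show ?thesis using d(1) by (intro exI[of _ "t + d/2"]) auto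
qed

lemma alive_loewner_solution:
  assumes W: "continuous_on {0..} W" and c: "0 < c" and a: "alive c W z t"
  shows "loewner_solution W z t (reg_flow c W z)"
  unfolding loewner_solution_def
proof (intro conjI ballI)
  note r = reg_flow[OF c W, of z]
  show "reg_flow c W z 0 = z" using r by (simp add: reg_solution_def)
  fix s assume s: "s \<in> {0..<t}"
  have cs: "c < cmod (reg_flow c W z s - of_real (W s))" using a s by (auto simp: alive_def)
  then show "reg_flow c W z s \<noteq> of_real (W s)" using c by auto
  have "reg_field c (reg_flow c W z s - of_real (W s)) = 2 / (reg_flow c W z s - of_real (W s))"
    using cs c by (simp add: reg_field_eq)
  moreover have "(reg_flow c W z has_vector_derivative reg_field c (reg_flow c W z s - of_real (W s))) (at s within {0..<t})"
    using r s by (auto simp: reg_solution_def intro: has_vector_derivative_within_subset[of _ _ _ "{0..}"])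
  ultimately show "(reg_flow c W z has_vector_derivative 2 / (reg_flow c W z s - of_real (W s))) (at s within {0..<t})"
    by (simp only:)
qed

text \<open>Replaces a supremum over arbitrary solutions by one canonical flow. A solution living
  past \<open>t\<close> has a positive minimal distance to the driving path on the compact [0, t],
  and half of it is a valid cutoff. Conversely \<open>alive\<close> extends beyond \<open>t\<close>,
  which gives the strict inequality.\<close>

lemma swallowing_time_greater_iff:
  assumes W: "continuous_on {0..} W" and t: "0 \<le> t"
  shows "ereal t < swallowing_time W z \<longleftrightarrow> (\<exists>c>0. alive c W z t)"
proof
  assume "\<exists>c>0. alive c W z t"
  then obtain c where c: "c > 0" "alive c W z t" by auto
  obtain u where u: "u > t" "alive c W z u" using alive_extend[OF W c t] by auto
  have "ereal u \<le> swallowing_time W z"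
    unfolding swallowing_time_def
  proof (rule SUP_upper)
    have "0 \<le> u" using u(1) t by simp
    then show "u \<in> {T. 0 \<le> T \<and> (\<exists>g. loewner_solution W z T g)}"
      using alive_loewner_solution[OF W c(1) u(2)] by blast
  qed
  moreover have "ereal t < ereal u" using u(1) by simp
  ultimately show "ereal t < swallowing_time W z" by (rule order.strict_trans2[rotated])
next
  assume "ereal t < swallowing_time W z"
  then obtain T g where T: "t < T" and g: "loewner_solution W z T g"
    unfolding swallowing_time_def less_SUP_iff by auto
  let ?f = "\<lambda>s. cmod (g s - of_real (W s))"
  have cg: "continuous_on {0..<T} g"
    using g unfolding loewner_solution_def continuous_on_eq_continuous_within
    by (auto intro: has_vector_derivative_continuous)
  have "continuous_on {0..t} ?f"
    using T by (intro continuous_intros continuous_on_subset[OF cg] continuous_on_subset[OF W]) auto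
  then obtain m where m: "m \<in> {0..t}" "\<And>s. s \<in> {0..t} \<Longrightarrow> ?f m \<le> ?f s"
    using continuous_attains_inf[of "{0..t}" ?f] t by auto
  have fm: "?f m > 0" using g m T unfolding loewner_solution_def by auto
  define c where "c = ?f m / 2"
  have c: "c > 0" using fm by (simp add: c_def)
  have cf: "c < ?f s" if "s \<in> {0..t}" for s using m(2)[OF that] fm unfolding c_def by linarith
  have "reg_solution_on c W z t g"
    unfolding reg_solution_on_def
  proof (intro conjI ballI)
    show "g 0 = z" using g by (simp add: loewner_solution_def)
    fix s assume s: "s \<in> {0..t}"
    have "(g has_vector_derivative 2 / (g s - of_real (W s))) (at s within {0..<T})"
      using g s T by (auto simp: loewner_solution_def)
    then show "(g has_vector_derivative reg_field c (g s - of_real (W s))) (at s within {0..t})"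
      using cf[OF s] c T
      by (subst reg_field_eq) (auto intro: has_vector_derivative_within_subset[of _ _ _ "{0..<T}"])
  qed
  then have "reg_flow c W z s = g s" if "s \<in> {0..t}" for s
    using that reg_solution_unique[OF W c reg_solution_onI[OF reg_flow[OF c W]], of z t g s] by auto
  then have "alive c W z t" using cf by (auto simp: alive_def)
  then show "\<exists>c>0. alive c W z t" using c by auto
qed

section \<open>Swallowing times\<close>

lemma swallowing_time_nonneg: "0 \<le> swallowing_time W z"
proof -
  have "loewner_solution W z 0 (\<lambda>_. z)" by (simp add: loewner_solution_def)
  then have "ereal 0 \<le> swallowing_time W z"
    unfolding swallowing_time_def by (intro SUP_upper2[of 0]) auto
  then show ?thesis by (simp add: zero_ereal_def)
qed

text \<open>A point at distance \<open>e\<close> from the driving path needs a time of order e^2 to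
  come close. Until the distance first equals e / 2 the speed is at most 4 / e, so the drift over
  time \<open>d\<close> is at most e / 8; together with the oscillation e / 4 of the path the loss
  is below e / 2.\<close>

lemma alive_persist:
  assumes W: "continuous_on {0..} W" and c: "0 < c" and a: "alive c W z t" and t: "0 \<le> t"
    and e: "0 < e" "e \<le> cmod (reg_flow c W z t - of_real (W t))"
    and d: "0 < d" "32 * d \<le> e\<^sup>2" "\<And>s. t \<le> s \<Longrightarrow> s \<le> t + d \<Longrightarrow> \<bar>W s - W t\<bar> \<le> e / 4"
  shows "\<exists>c>0. alive c W z (t + d)"
proof -
  \<comment> \<open>At most \<open>c\<close>, to inherit the lifetime up to \<open>t\<close>, and
    below e / 2, so that distances beyond e / 2 count as alive.\<close>
  define b where "b = min c (e/4)"
  have b: "0 < b" "b \<le> c" "b < e / 2" using c e by (auto simp: b_def)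
  let ?G = "reg_flow b W z"
  let ?f = "\<lambda>s. cmod (?G s - of_real (W s))"
  have ab: "alive b W z t" by (rule alive_mono[OF W b(1,2) a])
  have Gt: "?G t = reg_flow c W z t" by (rule alive_reg_flow_eq[OF W b(1,2) a t]) simp
  have contf: "continuous_on {t..t+d} ?f"
    using t by (intro continuous_intros continuous_on_subset[OF continuous_on_reg_flow[OF b(1) W]] continuous_on_subset[OF W]) auto
  have big: "e / 2 < ?f s" if s: "s \<in> {t..t+d}" for s
  proof (rule ccontr)
    assume neg: "\<not> e / 2 < ?f s"
    let ?S = "{x \<in> {t..t+d}. ?f x \<in> {..e/2}}"
    have "?S = {t..t+d} \<inter> ?f -` {..e/2}" by auto
    then have "closed ?S" using continuous_closed_preimage[OF contf, of "{..e/2}"] by simp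
    moreover have "bounded ?S" by (rule bounded_subset[of "{t..t+d}"]) auto
    ultimately have "compact ?S" by (simp add: compact_eq_bounded_closed)
    moreover have "?S \<noteq> {}" using neg s by (auto simp: not_less)
    ultimately obtain u where u: "u \<in> ?S" "\<And>x. x \<in> ?S \<Longrightarrow> u \<le> x"
      using compact_attains_inf[of ?S] by blast
    have ft: "e \<le> ?f t" using e by (simp add: Gt)
    obtain x where x: "t \<le> x" "x \<le> u" "?f x = e / 2"
      using IVT2'[of ?f u "e/2" t] u(1) ft e contf[THEN continuous_on_subset, of "{t..u}"] by auto
    then have xu: "x = u" using u(2)[of x] u(1) by auto
    have "cmod (?G u - ?G t) \<le> 4 / e * (u - t)"
    proof (rule vector_derivative_bound[where f'="\<lambda>s. reg_field b (?G s - of_real (W s))"])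
      fix s assume s: "s \<in> {t..u}"
      show "(?G has_vector_derivative reg_field b (?G s - of_real (W s))) (at s within {t..u})"
        using reg_flow[OF b(1) W, of z] s t unfolding reg_solution_def
        by (auto intro: has_vector_derivative_within_subset[of _ _ _ "{0..}"])
      have fs: "e / 2 \<le> ?f s"
      proof (cases "s = u")
        case False
        then have "s \<notin> ?S" using u(2)[of s] s by auto
        then show ?thesis using s u(1) by auto
      qed (use x xu in auto)
      have "cmod (reg_field b (?G s - of_real (W s))) \<le> 2 / max (?f s) b" by (rule norm_reg_field[OF b(1)])
      also have "\<dots> \<le> 2 / (e / 2)" using fs e(1) b(1) by (intro divide_left_mono mult_pos_pos) (auto simp: max_def)
      finally show "cmod (reg_field b (?G s - of_real (W s))) \<le> 4 / e" by simp
    qed (use x xu in auto)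
    also have "\<dots> \<le> 4 / e * d" using u(1) e by (intro mult_left_mono) auto
    also have "\<dots> \<le> 4 / e * (e\<^sup>2 / 32)" using d(2) e by (intro mult_left_mono) auto
    also have "\<dots> = e / 8" using e by (simp add: power2_eq_square)
    finally have 1: "cmod (?G u - ?G t) \<le> e / 8" .
    have 2: "cmod (of_real (W u) - of_real (W t)) \<le> e / 4"
      using d(3)[of u] u(1) unfolding of_real_diff[symmetric] norm_of_real by auto
    have "?G t - of_real (W t) = (?G u - of_real (W u)) - (?G u - ?G t) + (of_real (W u) - of_real (W t))" by simp
    also have "cmod \<dots> \<le> ?f u + cmod (?G u - ?G t) + cmod (of_real (W u) - of_real (W t) :: complex)"
      by (intro order_trans[OF norm_triangle_ineq] add_right_mono norm_triangle_ineq4)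
    finally show False using 1 2 ft x(3) e(1) unfolding xu by linarith
  qed
  have "alive b W z (t + d)"
    unfolding alive_def
  proof
    fix s assume s: "s \<in> {0..t+d}"
    show "b < ?f s"
    proof (cases "s \<le> t")
      case True then show ?thesis using ab s by (auto simp: alive_def)
    next
      case False then show ?thesis using big[of s] s b by auto
    qed
  qed
  then show ?thesis using b by auto
qed

text \<open>If \<open>b\<close> did not outlive \<open>a\<close>, take a time \<open>s\<close> just
  before \<open>b\<close> dies. Since \<open>a\<close> is still alive at \<open>s\<close>, its
  closest visits to the driving point happen after \<open>s\<close>, and at such a visit
  \<open>b\<close> is at distance at least r / 4 from that point. By \<open>alive_persist\<close> it
  then lives on for a time depending only on \<open>r\<close>, \<open>T\<close> and the path, that
  is, past its own death.\<close>

lemma swallowed_before: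
  assumes W: "continuous_on {0..} W" and r: "0 < r"
    and H: "\<And>e. 0 < e \<Longrightarrow> \<exists>t\<in>{0..T}. \<exists>c>0. alive c W a t \<and> alive c W b t \<and>
      cmod (reg_flow c W a t - of_real (W t)) \<le> e \<and> r \<le> cmod (reg_flow c W a t - reg_flow c W b t)"
  shows "swallowing_time W a < swallowing_time W b"
proof (rule ccontr)
  assume "\<not> swallowing_time W a < swallowing_time W b"
  then have ba: "swallowing_time W b \<le> swallowing_time W a" by simp
  have key: "\<exists>c'>0. \<exists>t. alive c' W b t \<and> s < t \<and> t \<le> T \<and> 0 \<le> t \<and> r / 4 \<le> cmod (reg_flow c' W b t - of_real (W t))"
    if s: "0 < c" "alive c W a s" for s c
  proof -
    obtain t c1 where t: "t \<in> {0..T}" "c1 > 0" "alive c1 W a t" "alive c1 W b t"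
      "cmod (reg_flow c1 W a t - of_real (W t)) \<le> min (c/2) (r/2)" "r \<le> cmod (reg_flow c1 W a t - reg_flow c1 W b t)"
      using H[of "min (c/2) (r/2)"] s r by auto
    have "s < t"
    proof (rule ccontr)
      assume st: "\<not> s < t"
      define c2 where "c2 = min c c1"
      have c2: "0 < c2" "c2 \<le> c" "c2 \<le> c1" using s t by (auto simp: c2_def)
      have "reg_flow c1 W a t = reg_flow c2 W a t"
        using alive_reg_flow_eq[OF W c2(1,3) t(3), of t] t(1) by auto
      also have "\<dots> = reg_flow c W a t"
        using alive_reg_flow_eq[OF W c2(1,2) s(2), of t] t(1) st by auto
      finally have "cmod (reg_flow c W a t - of_real (W t)) \<le> c / 2" using t(5) by simp
      moreover have "c < cmod (reg_flow c W a t - of_real (W t))" using s(2) t(1) st by (auto simp: alive_def)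
      ultimately show False using s(1) by linarith
    qed
    moreover have "r / 4 \<le> cmod (reg_flow c1 W b t - of_real (W t))"
    proof -
      have "reg_flow c1 W a t - reg_flow c1 W b t = (reg_flow c1 W a t - of_real (W t)) - (reg_flow c1 W b t - of_real (W t))"
        by simp
      then have "cmod (reg_flow c1 W a t - reg_flow c1 W b t) \<le> cmod (reg_flow c1 W a t - of_real (W t)) + cmod (reg_flow c1 W b t - of_real (W t))"
        using norm_triangle_ineq4 by metis
      then show ?thesis using t(5,6) r by linarith
    qed
    ultimately show ?thesis using t by (intro exI[of _ c1] exI[of _ t] conjI) auto
  qed
  obtain t0 c0 where t0: "t0 \<in> {0..T}" "c0 > 0" "alive c0 W a t0" "alive c0 W b t0"
    using H[of 1] by auto
  have T0: "0 \<le> T" using t0 by auto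
  have aT: "swallowing_time W a \<le> ereal T"
  proof (rule ccontr)
    assume "\<not> swallowing_time W a \<le> ereal T"
    then obtain c where "c > 0" "alive c W a T"
      using swallowing_time_greater_iff[OF W T0, of a] by auto
    then show False using key[of c T] by auto
  qed
  have b0: "ereal 0 < swallowing_time W b"
    using t0 unfolding swallowing_time_greater_iff[OF W order_refl] by (auto simp: alive_def intro!: exI[of _ c0])
  obtain q where q: "swallowing_time W b = ereal q" "0 < q" "q \<le> T"
    using b0 order_trans[OF ba aT] by (cases "swallowing_time W b") auto
  define e where "e = r / 4"
  have e: "e > 0" using r by (simp add: e_def)
  obtain d1 where d1: "0 < d1" "\<And>s t. 0 \<le> s \<Longrightarrow> s \<le> t \<Longrightarrow> t \<le> s + d1 \<Longrightarrow> t \<le> T + 1 \<Longrightarrow> \<bar>W t - W s\<bar> \<le> e / 4"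
    using mesh_ex[OF W, of "e/4" "T + 1"] e by auto
  \<comment> \<open>The lifetime gained from distance r / 4, uniformly over times up to
    \<open>T\<close>. Below, \<open>s\<close> is chosen within d / 2 of the death time
    \<open>q\<close>.\<close>
  define d where "d = min 1 (min d1 (e\<^sup>2 / 32))"
  have d: "0 < d" "d \<le> 1" "d \<le> d1" "32 * d \<le> e\<^sup>2" using d1 e by (auto simp: d_def min_def)
  define s where "s = max 0 (q - d / 2)"
  have s: "0 \<le> s" "s < q" "q - d / 2 \<le> s" using q d by (auto simp: s_def)
  have "ereal s < swallowing_time W a" using order.strict_trans2[OF _ ba, of "ereal s"] q s by simp
  then obtain c where c: "c > 0" "alive c W a s" using swallowing_time_greater_iff[OF W s(1), of a] by auto
  obtain c' t where t: "c' > 0" "alive c' W b t" "s < t" "t \<le> T" "0 \<le> t" "e \<le> cmod (reg_flow c' W b t - of_real (W t))"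
    using key[OF c] by (auto simp: e_def)
  have "\<exists>c>0. alive c W b (t + d)"
    using d d1(2) t by (intro alive_persist[OF W t(1,2,5) e t(6)]) auto
  then have "ereal (t + d) < ereal q"
    using swallowing_time_greater_iff[OF W, of "t + d" b] t(5) d(1) unfolding q by auto
  then show False using t(3) s d by simp
qed

text \<open>Between grid points the distance drops by at most e / 8 each from the Euler error, the
  drift and the driving path, so it stays above e / 4. Nothing is assumed at index \<open>i\<close>
  itself, the node where the chain may already have left its region.\<close>

lemma euler_alive:
  assumes W: "continuous_on {0..} W" and e: "0 < e"
  obtains d0 where "0 < d0" "\<And>z d i. 0 < d \<Longrightarrow> d \<le> d0 \<Longrightarrow> real i * d \<le> T \<Longrightarrow> 0 < i \<Longrightarrow>
      (\<And>j. j < i \<Longrightarrow> e \<le> cmod (euler (e/4) W z d j - of_real (W (real j * d)))) \<Longrightarrow>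
      alive (e/4) W z (real i * d) \<and> cmod (reg_flow (e/4) W z (real i * d) - euler (e/4) W z d i) \<le> e / 8"
proof -
  have e4: "0 < e/4" using e by simp
  obtain d1 where d1: "0 < d1" "\<And>z G d i. reg_solution_on (e/4) W z T G \<Longrightarrow> 0 < d \<Longrightarrow> d \<le> d1 \<Longrightarrow> real i * d \<le> T
     \<Longrightarrow> cmod (G (real i * d) - euler (e/4) W z d i) \<le> e / 8"
    using euler_error_small[OF W e4, of "e/8" T] e by auto
  obtain d2 where d2: "0 < d2" "\<And>s t. 0 \<le> s \<Longrightarrow> s \<le> t \<Longrightarrow> t \<le> s + d2 \<Longrightarrow> t \<le> T \<Longrightarrow> \<bar>W t - W s\<bar> \<le> e / 8"
    using mesh_ex[OF W, of "e/8" T] e by auto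
  show ?thesis
  proof (rule that[of "min (min d1 d2) (e\<^sup>2 / 64)"])
    show "0 < min (min d1 d2) (e\<^sup>2 / 64)" using d1 d2 e by auto
    fix z d i
    assume d: "0 < d" "d \<le> min (min d1 d2) (e\<^sup>2 / 64)" and i: "real i * d \<le> T" "0 < i"
      and E: "\<And>j. j < i \<Longrightarrow> e \<le> cmod (euler (e/4) W z d j - of_real (W (real j * d)))"
    let ?G = "reg_flow (e/4) W z"
    have Gs: "reg_solution_on (e/4) W z T ?G" by (intro reg_solution_onI reg_flow e4 W)
    have close: "cmod (?G (real j * d) - euler (e/4) W z d j) \<le> e / 8" if "j \<le> i" for j
    proof (rule d1(2)[OF Gs])
      show "real j * d \<le> T" using that d i by (intro order_trans[OF mult_right_mono i(1)]) auto
    qed (use d in auto)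
    have "alive (e/4) W z (real i * d)"
      unfolding alive_def
    proof
      fix s assume s: "s \<in> {0..real i * d}"
      \<comment> \<open>The cap \<open>i - 1\<close> treats the endpoint s = i * d: the lower bound
        is assumed only for nodes below \<open>i\<close>.\<close>
      define j where "j = min (nat \<lfloor>s / d\<rfloor>) (i - 1)"
      have ji: "j < i" using i by (auto simp: j_def)
      have fl: "real (nat \<lfloor>s / d\<rfloor>) \<le> s / d" "s / d < real (nat \<lfloor>s / d\<rfloor>) + 1" using s d(1) by (auto simp: of_nat_nat)
      have jd: "real j * d \<le> s" "s \<le> real j * d + d"
      proof -
        have "real j \<le> s / d" using fl by (auto simp: j_def)
        then show "real j * d \<le> s" using d(1) by (simp add: field_simps)
        have "s / d \<le> real j + 1"
        proof (cases "nat \<lfloor>s / d\<rfloor> \<le> i - 1")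
          case True then show ?thesis using fl by (simp add: j_def)
        next
          case False
          then have "real j + 1 = real i" using i by (auto simp: j_def)
          moreover have "s / d \<le> real i" using s d(1) by (simp add: field_simps)
          ultimately show ?thesis by simp
        qed
        then show "s \<le> real j * d + d" using d(1) by (simp add: field_simps)
      qed
      have sT: "s \<le> T" using s i by auto
      have 1: "cmod (?G s - ?G (real j * d)) \<le> e / 8"
      proof -
        have "cmod (?G s - ?G (real j * d)) \<le> 2 / (e/4) * (s - real j * d)"
          using jd d sT by (intro reg_solution_on_lipschitz[OF Gs e4]) auto
        also have "\<dots> \<le> 2 / (e/4) * (e\<^sup>2 / 64)" using jd d e by (intro mult_left_mono) auto
        also have "\<dots> = e / 8" using e by (simp add: power2_eq_square)
        finally show ?thesis .
      qed
      have 2: "cmod (of_real (W s) - of_real (W (real j * d)) :: complex) \<le> e / 8"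
        using d2(2)[of "real j * d" s] jd d sT unfolding of_real_diff[symmetric] norm_of_real by auto
      have "euler (e/4) W z d j - of_real (W (real j * d)) = (?G s - of_real (W s)) - (?G s - ?G (real j * d))
          - (?G (real j * d) - euler (e/4) W z d j) + (of_real (W s) - of_real (W (real j * d)))" by simp
      also have "cmod \<dots> \<le> cmod (?G s - of_real (W s)) + cmod (?G s - ?G (real j * d))
          + cmod (?G (real j * d) - euler (e/4) W z d j) + cmod (of_real (W s) - of_real (W (real j * d)) :: complex)"
        by (intro order_trans[OF norm_triangle_ineq] add_right_mono order_trans[OF norm_triangle_ineq4] order_refl)
      finally show "e / 4 < cmod (?G s - of_real (W s))"
        using 1 2 close[of j] ji E[OF ji] e by linarith
    qed
    then show "alive (e/4) W z (real i * d) \<and> cmod (?G (real i * d) - euler (e/4) W z d i) \<le> e / 8"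
      using close[of i] by auto
  qed
qed

section \<open>Measurability of comparing swallowing times\<close>

lemma borel_measurable_euler:
  assumes W: "\<And>t. 0 \<le> t \<Longrightarrow> W t \<in> borel_measurable M" and d: "0 \<le> d" and c: "0 < c"
  shows "(\<lambda>\<omega>. euler c (\<lambda>t. W t \<omega>) z d i) \<in> borel_measurable M"
proof (induction i)
  case (Suc i)
  have v: "reg_field c \<in> borel_measurable borel"
    using continuous_on_reg_field[OF c continuous_on_id, of UNIV]
    by (intro borel_measurable_continuous_onI) simp
  have "W (real i * d) \<in> borel_measurable M" using d by (intro W) auto
  then have "(\<lambda>\<omega>. euler c (\<lambda>t. W t \<omega>) z d i - of_real (W (real i * d) \<omega>)) \<in> borel_measurable M"
    using Suc by measurable
  then show ?case using Suc v by (auto intro!: borel_measurable_add borel_measurable_scaleR measurable_compose[OF _ v])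
qed simp

lemma borel_measurable_reg_flow:
  assumes W: "\<And>t. 0 \<le> t \<Longrightarrow> W t \<in> borel_measurable M"
    and C: "\<And>\<omega>. \<omega> \<in> space M \<Longrightarrow> continuous_on {0..} (\<lambda>t. W t \<omega>)" and c: "0 < c" and t: "0 \<le> t"
  shows "(\<lambda>\<omega>. reg_flow c (\<lambda>t. W t \<omega>) z t) \<in> borel_measurable M"
proof (rule borel_measurable_LIMSEQ_metric)
  show "(\<lambda>\<omega>. euler c (\<lambda>t. W t \<omega>) z (t / real (Suc n)) (Suc n)) \<in> borel_measurable M" for n
    using t by (intro borel_measurable_euler W c) auto
  show "(\<lambda>n. euler c (\<lambda>t. W t \<omega>) z (t / real (Suc n)) (Suc n)) \<longlonglongrightarrow> reg_flow c (\<lambda>t. W t \<omega>) z t"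
    if "\<omega> \<in> space M" for \<omega>
    by (rule euler_tendsto[OF C[OF that] c _ t]) (rule reg_solution_onI[OF reg_flow[OF c C[OF that]]])
qed

text \<open>Makes the quantifier over times countable. The bound is closed and twice the cutoff, so
  it passes to the closure of the rationals and still yields the strict inequality. Clamping to
  [0, t] makes every rational an admissible time and reaches an irrational endpoint
  \<open>t\<close>.\<close>

lemma alive_iff_rational:
  assumes W: "continuous_on {0..} W" and t: "0 \<le> t"
  shows "(\<exists>c>0. alive c W z t) \<longleftrightarrow> (\<exists>k::nat. \<forall>s\<in>\<rat>.
    2 / real (Suc k) \<le> cmod (reg_flow (1 / real (Suc k)) W z (min t (max 0 s)) - of_real (W (min t (max 0 s)))))"
proof
  assume "\<exists>c>0. alive c W z t"
  then obtain c where c: "c > 0" "alive c W z t" by auto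
  obtain k :: nat where k: "1 / real (Suc k) < c / 2" using nat_approx_posE[of "c/2"] c by auto
  show "\<exists>k::nat. \<forall>s\<in>\<rat>. 2 / real (Suc k) \<le> cmod (reg_flow (1 / real (Suc k)) W z (min t (max 0 s)) - of_real (W (min t (max 0 s))))"
  proof (intro exI ballI)
    fix s :: real
    have m: "0 \<le> min t (max 0 s)" "min t (max 0 s) \<le> t" using t by auto
    have "reg_flow (1 / real (Suc k)) W z (min t (max 0 s)) = reg_flow c W z (min t (max 0 s))"
      using k c by (intro alive_reg_flow_eq[OF W _ _ c(2) m]) auto
    moreover have "c < cmod (reg_flow c W z (min t (max 0 s)) - of_real (W (min t (max 0 s))))"
      using c(2) m by (simp only: alive_def atLeastAtMost_iff)
    ultimately show "2 / real (Suc k) \<le> cmod (reg_flow (1 / real (Suc k)) W z (min t (max 0 s)) - of_real (W (min t (max 0 s))))"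
      using k by simp
  qed
next
  assume "\<exists>k::nat. \<forall>s\<in>\<rat>. 2 / real (Suc k) \<le> cmod (reg_flow (1 / real (Suc k)) W z (min t (max 0 s)) - of_real (W (min t (max 0 s))))"
  then obtain k :: nat where k: "\<And>s. s \<in> \<rat> \<Longrightarrow> 2 / real (Suc k) \<le> cmod (reg_flow (1 / real (Suc k)) W z (min t (max 0 s)) - of_real (W (min t (max 0 s))))"
    by auto
  define c where "c = 1 / real (Suc k)"
  have c: "c > 0" by (simp add: c_def)
  let ?f = "\<lambda>s. cmod (reg_flow c W z (min t (max 0 s)) - of_real (W (min t (max 0 s))))"
  have cf: "continuous_on (closure \<rat>) ?f"
    using t by (intro continuous_intros continuous_on_compose2[OF continuous_on_reg_flow[OF c W]] continuous_on_compose2[OF W]) auto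
  have f2: "2 * c \<le> ?f s" for s
  proof (rule continuous_ge_on_closure[OF cf])
    show "s \<in> closure \<rat>" by (simp add: Rats_closure_real)
    show "2 * c \<le> ?f x" if "x \<in> \<rat>" for x using k[OF that] by (simp add: c_def)
  qed
  have "alive c W z t"
    unfolding alive_def
  proof (intro ballI)
    fix s assume s: "s \<in> {0..t}"
    then have "min t (max 0 s) = s" by auto
    then show "c < cmod (reg_flow c W z s - of_real (W s))" using f2[of s] c by simp
  qed
  then show "\<exists>c>0. alive c W z t" using c by auto
qed

lemma sets_swallowing_time_greater:
  assumes W: "\<And>t. 0 \<le> t \<Longrightarrow> W t \<in> borel_measurable M"
    and C: "\<And>\<omega>. \<omega> \<in> space M \<Longrightarrow> continuous_on {0..} (\<lambda>t. W t \<omega>)" and t: "0 \<le> t"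
  shows "{\<omega>\<in>space M. ereal t < swallowing_time (\<lambda>t. W t \<omega>) z} \<in> sets M"
proof -
  have "{\<omega>\<in>space M. ereal t < swallowing_time (\<lambda>t. W t \<omega>) z} = {\<omega>\<in>space M. \<exists>k::nat. \<forall>s\<in>\<rat>.
    2 / real (Suc k) \<le> cmod (reg_flow (1 / real (Suc k)) (\<lambda>t. W t \<omega>) z (min t (max 0 s)) - of_real (W (min t (max 0 s)) \<omega>))}"
    using swallowing_time_greater_iff[OF C t] alive_iff_rational[OF C t] by auto
  also have "\<dots> \<in> sets M"
  proof (intro sets.sets_Collect_countable_Ex sets.sets_Collect_countable_All' countable_rat)
    fix k :: nat and s :: real
    have m: "0 \<le> min t (max 0 s)" using t by auto
    have [measurable]: "W (min t (max 0 s)) \<in> borel_measurable M" by (rule W[OF m])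
    have [measurable]: "(\<lambda>\<omega>. reg_flow (1 / real (Suc k)) (\<lambda>t. W t \<omega>) z (min t (max 0 s))) \<in> borel_measurable M"
      by (rule borel_measurable_reg_flow[OF W C _ m]) auto
    show "{\<omega>\<in>space M. 2 / real (Suc k) \<le> cmod (reg_flow (1 / real (Suc k)) (\<lambda>t. W t \<omega>) z (min t (max 0 s)) - of_real (W (min t (max 0 s)) \<omega>))} \<in> sets M"
      by measurable
  qed
  finally show ?thesis .
qed

text \<open>A rational time separates the two swallowing times; it is nonnegative because swallowing
  times are.\<close>

lemma sets_swallowing_time_less:
  assumes W: "\<And>t. 0 \<le> t \<Longrightarrow> W t \<in> borel_measurable M"
    and C: "\<And>\<omega>. \<omega> \<in> space M \<Longrightarrow> continuous_on {0..} (\<lambda>t. W t \<omega>)"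
  shows "{\<omega>\<in>space M. swallowing_time (\<lambda>t. W t \<omega>) a < swallowing_time (\<lambda>t. W t \<omega>) b} \<in> sets M"
proof -
  let ?A = "\<lambda>z q. {\<omega>\<in>space M. ereal q < swallowing_time (\<lambda>t. W t \<omega>) z}"
  have "{\<omega>\<in>space M. swallowing_time (\<lambda>t. W t \<omega>) a < swallowing_time (\<lambda>t. W t \<omega>) b}
      = (\<Union>q\<in>\<rat> \<inter> {0..}. ?A b q - ?A a q)"
  proof (intro equalityI subsetI)
    fix \<omega> assume w: "\<omega> \<in> {\<omega>\<in>space M. swallowing_time (\<lambda>t. W t \<omega>) a < swallowing_time (\<lambda>t. W t \<omega>) b}"
    then obtain q where q: "swallowing_time (\<lambda>t. W t \<omega>) a < ereal (real_of_rat q)" "ereal (real_of_rat q) < swallowing_time (\<lambda>t. W t \<omega>) b"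
      using ereal_dense3 by blast
    have "0 < ereal (real_of_rat q)" using swallowing_time_nonneg q(1) by (rule order.strict_trans1)
    then show "\<omega> \<in> (\<Union>q\<in>\<rat> \<inter> {0..}. ?A b q - ?A a q)"
      using q w by (intro UN_I[of "real_of_rat q"]) (auto simp: zero_ereal_def)
  next
    fix \<omega> assume "\<omega> \<in> (\<Union>q\<in>\<rat> \<inter> {0..}. ?A b q - ?A a q)"
    then show "\<omega> \<in> {\<omega>\<in>space M. swallowing_time (\<lambda>t. W t \<omega>) a < swallowing_time (\<lambda>t. W t \<omega>) b}"
      by (auto simp: not_less intro: order.strict_trans1)
  qed
  also have "\<dots> \<in> sets M"
  proof (intro sets.countable_UN' countable_Int1 countable_rat image_subsetI sets.Diff)
    fix q :: real assume "q \<in> \<rat> \<inter> {0..}"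
    then have "0 \<le> q" by simp
    note [intro!] = this
    show "?A b q \<in> sets M" "?A a q \<in> sets M" by (auto intro!: sets_swallowing_time_greater W C)
  qed
  finally show ?thesis .
qed

section \<open>The conformal map onto the half-strip\<close>

text \<open>The square root takes the half-plane to the open first quadrant. The Moebius map takes
  the quadrant to the upper half-disc and 0, 1, infinity to -1, 0, 1. The logarithm, rotated and
  scaled, opens this up to the half-strip, with the values 1, infinity, 0 there.\<close>

definition strip_map :: "complex \<Rightarrow> complex" where
  "strip_map w = - (\<i> / of_real pi) * Ln ((csqrt w - 1) / (csqrt w + 1))"

definition strip_inverse :: "complex \<Rightarrow> complex" where
  "strip_inverse v = ((1 + exp (\<i> * of_real pi * v)) / (1 - exp (\<i> * of_real pi * v)))\<^sup>2"

lemma Im_pos_not_nonpos_Reals: "0 < Im w \<Longrightarrow> w \<notin> \<real>\<^sub>\<le>\<^sub>0"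
  by (auto simp: complex_nonpos_Reals_iff)

lemma csqrt_upper_half_plane:
  assumes "0 < Im w" shows "0 < Re (csqrt w)" "0 < Im (csqrt w)"
proof -
  have *: "0 < Re s \<and> 0 < Im s" if "0 < Im (s\<^sup>2)" "0 \<le> Re s" for s
    using that by (auto simp: power2_eq_square zero_less_mult_iff)
  show "0 < Re (csqrt w)" "0 < Im (csqrt w)"
    using *[of "csqrt w"] assms Re_csqrt[of w] unfolding power2_csqrt by blast+
qed

lemma norm_diff_one_less: 
  assumes "0 < Re s" shows "cmod (s - 1) < cmod (s + 1)"
proof (rule power2_less_imp_less)
  show "(cmod (s - 1))\<^sup>2 < (cmod (s + 1))\<^sup>2"
    unfolding cmod_power2 using assms by (simp add: power2_eq_square algebra_simps)
qed simp

lemma half_disc: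
  assumes "0 < Re s" "0 < Im s"
  shows "0 < Im ((s - 1) / (s + 1))" "cmod ((s - 1) / (s + 1)) < 1"
proof -
  have s: "s + 1 \<noteq> 0" using assms by (auto simp: complex_eq_iff)
  have n: "0 < (Re (s + 1))\<^sup>2 + (Im (s + 1))\<^sup>2" using assms by (simp add: add_nonneg_pos)
  have "Im ((s - 1) / (s + 1)) = 2 * Im s / ((Re (s + 1))\<^sup>2 + (Im (s + 1))\<^sup>2)"
    by (simp add: Im_divide algebra_simps)
  then show "0 < Im ((s - 1) / (s + 1))" using assms n by simp
  show "cmod ((s - 1) / (s + 1)) < 1"
    using norm_diff_one_less[OF assms(1)] s by (simp add: norm_divide)
qed

lemma quadrant:
  assumes "cmod e < 1" "0 < Im e"
  shows "0 < Re ((1 + e) / (1 - e))" "0 < Im ((1 + e) / (1 - e))" "1 - e \<noteq> 0"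
proof -
  show ne: "1 - e \<noteq> 0" using assms by auto
  have n: "0 < (Re (1 - e))\<^sup>2 + (Im (1 - e))\<^sup>2" using assms by (simp add: add_nonneg_pos)
  have "(cmod e)\<^sup>2 < 1" using assms by (simp add: abs_square_less_1)
  then have r: "(Re e)\<^sup>2 + (Im e)\<^sup>2 < 1" by (simp add: cmod_power2)
  have "Im ((1 + e) / (1 - e)) = 2 * Im e / ((Re (1 - e))\<^sup>2 + (Im (1 - e))\<^sup>2)"
    by (simp add: Im_divide algebra_simps)
  then show "0 < Im ((1 + e) / (1 - e))" using assms n by simp
  have "Re ((1 + e) / (1 - e)) = (1 - ((Re e)\<^sup>2 + (Im e)\<^sup>2)) / ((Re (1 - e))\<^sup>2 + (Im (1 - e))\<^sup>2)"
    by (simp add: Re_divide algebra_simps power2_eq_square)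
  then show "0 < Re ((1 + e) / (1 - e))" using r n by simp
qed

lemma strip_map_half_plane:
  assumes "0 < Im w"
  shows "strip_map w \<in> half_strip" "strip_inverse (strip_map w) = w"
proof -
  define s where "s = csqrt w"
  define u where "u = (s - 1) / (s + 1)"
  have s: "0 < Re s" "0 < Im s" using csqrt_upper_half_plane[OF assms] by (auto simp: s_def)
  have u: "0 < Im u" "cmod u < 1" using half_disc[OF s] by (auto simp: u_def)
  have u0: "u \<noteq> 0" using u by auto
  have F: "strip_map w = - (\<i> / of_real pi) * Ln u" by (simp add: strip_map_def u_def s_def)
  have re: "Re (strip_map w) = Im (Ln u) / pi" "Im (strip_map w) = - ln (cmod u) / pi"
    using u0 by (simp_all add: F Re_divide Im_divide power2_eq_square)
  have "ln (cmod u) < 0" using u u0 by simp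
  then show "strip_map w \<in> half_strip"
    using Im_Ln_pos_lt_imp[OF u(1)] unfolding half_strip_def by (simp add: re divide_neg_pos)
  have "\<i> * of_real pi * strip_map w = Ln u" by (simp add: F field_simps)
  then have "strip_inverse (strip_map w) = ((1 + u) / (1 - u))\<^sup>2" using u0 by (simp add: strip_inverse_def)
  also have "(1 + u) / (1 - u) = s"
  proof -
    have "s + 1 \<noteq> 0" using s by (auto simp: complex_eq_iff)
    then have "1 + u = 2 * s / (s + 1)" "1 - u = 2 / (s + 1)" by (auto simp: u_def field_simps)
    then show ?thesis using \<open>s + 1 \<noteq> 0\<close> by simp
  qed
  finally show "strip_inverse (strip_map w) = w" by (simp add: s_def)
qed

lemma exp_half_strip:
  assumes "v \<in> half_strip"
  shows "cmod (exp (\<i> * of_real pi * v)) < 1" "0 < Im (exp (\<i> * of_real pi * v))"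
  using assms by (auto simp: half_strip_def Im_exp intro!: mult_pos_pos sin_gt_zero)

lemma strip_inverse_half_strip:
  assumes "v \<in> half_strip"
  shows "0 < Im (strip_inverse v)" "strip_map (strip_inverse v) = v"
proof -
  define e where "e = exp (\<i> * of_real pi * v)"
  have e: "cmod e < 1" "0 < Im e" using exp_half_strip[OF assms] by (auto simp: e_def)
  define s where "s = (1 + e) / (1 - e)"
  have s: "0 < Re s" "0 < Im s" using quadrant[OF e] by (auto simp: s_def)
  have G: "strip_inverse v = s\<^sup>2" by (simp add: strip_inverse_def s_def e_def)
  show "0 < Im (strip_inverse v)" using s by (simp add: G power2_eq_square)
  have "csqrt (s\<^sup>2) = s" using s by (intro csqrt_square) auto
  moreover have "(s - 1) / (s + 1) = e"
  proof -
    have "s - 1 = 2 * e / (1 - e)" "s + 1 = 2 / (1 - e)" using quadrant(3)[OF e] by (auto simp: s_def field_simps)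
    then show ?thesis using quadrant(3)[OF e] by simp
  qed
  ultimately have "strip_map (strip_inverse v) = - (\<i> / of_real pi) * Ln e" by (simp add: strip_map_def G)
  also have "Ln e = \<i> * of_real pi * v"
    unfolding e_def using assms by (intro Ln_exp) (auto simp: half_strip_def intro: less_trans[of _ 0])
  finally show "strip_map (strip_inverse v) = v" by simp
qed

text \<open>With s = csqrt w, the Moebius map contributes 2 / (s + 1)^2 and the root 1 / (2 s);
  dividing by the Moebius map leaves (s - 1) (s + 1) = w - 1 in the denominator.\<close>

lemma strip_map_deriv:
  assumes "0 < Im w"
  shows "(strip_map has_field_derivative - (\<i> / of_real pi) / (csqrt w * (w - 1))) (at w)"
proof -
  define s where "s = csqrt w"
  have s: "0 < Re s" "0 < Im s" using csqrt_upper_half_plane[OF assms] by (auto simp: s_def)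
  have ne: "s + 1 \<noteq> 0" "s - 1 \<noteq> 0" "s \<noteq> 0" using s by (auto simp: complex_eq_iff)
  have wn: "w \<notin> \<real>\<^sub>\<le>\<^sub>0" "(s - 1) / (s + 1) \<notin> \<real>\<^sub>\<le>\<^sub>0"
    using Im_pos_not_nonpos_Reals assms half_disc(1)[OF s] by auto
  have w: "w = s\<^sup>2" by (simp add: s_def)
  have "((\<lambda>w. (csqrt w - 1) / (csqrt w + 1)) has_field_derivative 1 / (s * (s + 1)\<^sup>2)) (at w)"
    using wn ne by (auto intro!: derivative_eq_intros simp: s_def[symmetric])
      (simp add: field_simps power2_eq_square)
  then have "((\<lambda>w. Ln ((csqrt w - 1) / (csqrt w + 1))) has_field_derivative
      inverse ((s - 1) / (s + 1)) * (1 / (s * (s + 1)\<^sup>2))) (at w)"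
    using has_field_derivative_Ln[OF wn(2)] by (intro DERIV_chain2[where f=Ln]) (auto simp: s_def)
  also have "inverse ((s - 1) / (s + 1)) * (1 / (s * (s + 1)\<^sup>2)) = 1 / (s * (s\<^sup>2 - 1))"
  proof -
    have *: "inverse (b / a) * (1 / (c * a\<^sup>2)) = 1 / (c * (b * a))" if "a \<noteq> 0" "b \<noteq> 0" "c \<noteq> 0" for a b c :: complex
      using that by (simp add: power2_eq_square field_simps)
    have "s\<^sup>2 - 1 = (s - 1) * (s + 1)" by (simp add: power2_eq_square algebra_simps)
    then show ?thesis using *[OF ne] by simp
  qed
  finally have "(strip_map has_field_derivative - (\<i> / of_real pi) * (1 / (s * (s\<^sup>2 - 1)))) (at w)"
    unfolding strip_map_def[abs_def] by (rule DERIV_cmult)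
  then show ?thesis by (simp add: s_def)
qed

section \<open>Uniqueness of the normalised conformal map\<close>

text \<open>An automorphism of the disc fixing the centre is a rotation (Schwarz, applied to the map and
  its inverse); after normalisation at \<open>\<i>\<close> the behaviour at \<open>\<infinity>\<close> excludes all rotations but the identity.\<close>

lemma half_plane_automorphism_eq_id:
  assumes hol: "f holomorphic_on upper_half_plane" and bij: "bij_betw f upper_half_plane upper_half_plane"
    and l0: "(f \<longlongrightarrow> 0) (at 0 within upper_half_plane)"
    and l1: "(f \<longlongrightarrow> 1) (at 1 within upper_half_plane)"
    and linf: "filterlim f at_infinity (inf at_infinity (principal upper_half_plane))"
    and w: "w \<in> upper_half_plane"
  shows "f w = w"
proof -
  let ?H = upper_half_plane
  define p where "p = f \<i>"
  have p: "0 < Im p" using bij unfolding p_def bij_betw_def upper_half_plane_def by auto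
  \<comment> \<open>\<open>A\<close> moves \<open>f \<i>\<close> to \<open>\<i>\<close>, so that the
    disc map \<open>h\<close> below fixes the centre.\<close>
  define A where "A w = (w - of_real (Re p)) / of_real (Im p)" for w :: complex
  define Ai where "Ai w = w * of_real (Im p) + of_real (Re p)" for w :: complex
  have AAi [simp]: "A (Ai w) = w" "Ai (A w) = w" for w using p by (simp_all add: A_def Ai_def)
  have AH: "A w \<in> ?H \<longleftrightarrow> w \<in> ?H" for w using p by (simp add: A_def upper_half_plane_def Im_divide power2_eq_square zero_less_mult_iff zero_less_divide_iff)
  define C where "C w = (w - \<i>) / (w + \<i>)" for w
  define Ci where "Ci u = \<i> * (1 + u) / (1 - u)" for u
  have ni: "w + \<i> \<noteq> 0" if "w \<in> ?H" for w using that by (auto simp: upper_half_plane_def complex_eq_iff)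
  have CiC: "Ci (C w) = w" if "w \<in> ?H" for w
  proof -
    have "1 + C w = 2 * w / (w + \<i>)" "1 - C w = 2 * \<i> / (w + \<i>)" using ni[OF that] by (auto simp: C_def field_simps)
    then show ?thesis using ni[OF that] by (simp add: Ci_def)
  qed
  have CCi: "C (Ci u) = u" if "cmod u < 1" for u
  proof -
    have n: "1 - u \<noteq> 0" using that by auto
    have "Ci u - \<i> = 2 * \<i> * u / (1 - u)" "Ci u + \<i> = 2 * \<i> / (1 - u)" using n by (auto simp: Ci_def field_simps)
    then show ?thesis using n by (simp add: C_def)
  qed
  have CH: "cmod (C w) < 1" if "w \<in> ?H" for w
  proof -
    have "cmod (w - \<i>) < cmod (w + \<i>)"
    proof (rule power2_less_imp_less)
      show "(cmod (w - \<i>))\<^sup>2 < (cmod (w + \<i>))\<^sup>2"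
        unfolding cmod_power2 using that by (simp add: upper_half_plane_def power2_eq_square algebra_simps)
    qed simp
    then show ?thesis using ni[OF that] by (simp add: C_def norm_divide)
  qed
  have CiH: "Ci u \<in> ?H" if "cmod u < 1" for u
  proof -
    have n: "0 < (Re (1 - u))\<^sup>2 + (Im (1 - u))\<^sup>2"
      using that by (metis cmod_power2 norm_one order.irrefl right_minus_eq zero_less_norm_iff zero_less_power)
    have r: "(Re u)\<^sup>2 + (Im u)\<^sup>2 < 1" using that by (simp add: cmod_power2[symmetric] abs_square_less_1)
    have "Im (Ci u) = (1 - ((Re u)\<^sup>2 + (Im u)\<^sup>2)) / ((Re (1 - u))\<^sup>2 + (Im (1 - u))\<^sup>2)"
      by (simp add: Ci_def Im_divide algebra_simps power2_eq_square)
    then show ?thesis using r n by (simp add: upper_half_plane_def)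
  qed
  have fH: "f w \<in> ?H" if "w \<in> ?H" for w using bij that by (auto simp: bij_betw_def)
  have opH: "open ?H" by (simp add: upper_half_plane_def open_halfspace_Im_gt)
  define h where "h u = C (A (f (Ci u)))" for u
  have hol_h: "h holomorphic_on ball 0 1"
  proof -
    have "Ci holomorphic_on ball 0 1" unfolding Ci_def by (intro holomorphic_intros) auto
    then have "(f \<circ> Ci) holomorphic_on ball 0 1"
      by (rule holomorphic_on_compose_gen[OF _ hol]) (auto intro: CiH)
    moreover have "(\<lambda>x. C (A x)) holomorphic_on ?H"
      unfolding C_def A_def using p AH ni by (intro holomorphic_intros) (auto simp: A_def)
    ultimately have "((\<lambda>x. C (A x)) \<circ> (f \<circ> Ci)) holomorphic_on ball 0 1"
      by (rule holomorphic_on_compose_gen) (auto simp: CiH fH)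
    then show ?thesis by (simp add: h_def[abs_def] o_def)
  qed
  have h1: "cmod (h u) < 1" if "cmod u < 1" for u
    unfolding h_def by (intro CH) (simp add: AH fH CiH that)
  have h0: "h 0 = 0"
    using p by (simp add: h_def Ci_def p_def[symmetric] A_def C_def complex_eq_iff Re_divide Im_divide power2_eq_square)
  have inj_h: "inj_on h (ball 0 1)"
  proof (rule inj_onI)
    fix u v assume uv: "u \<in> ball 0 1" "v \<in> ball 0 1" "h u = h v"
    have "Ci (h u) = A (f (Ci u))" "Ci (h v) = A (f (Ci v))"
      unfolding h_def using uv by (auto intro!: CiC simp: AH fH CiH)
    then have "A (f (Ci u)) = A (f (Ci v))" using uv by simp
    then have "f (Ci u) = f (Ci v)" by (metis AAi(2))
    then have "Ci u = Ci v" using bij uv CiH by (auto simp: bij_betw_def inj_on_def)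
    then show "u = v" using uv CCi by (metis mem_ball_0)
  qed
  have surj_h: "h ` ball 0 1 = ball 0 1"
  proof (intro equalityI subsetI)
    fix v :: complex assume v: "v \<in> ball 0 1"
    then have "Ai (Ci v) \<in> ?H" using AH[of "Ai (Ci v)"] CiH[of v] by simp
    then obtain y where y: "y \<in> ?H" "f y = Ai (Ci v)" using bij by (metis bij_betw_imp_surj_on imageE)
    have "h (C y) = v" using y v by (simp add: h_def CiC CCi)
    then show "v \<in> h ` ball 0 1" using CH[OF y(1)] by (intro image_eqI[of _ _ "C y"]) auto
  qed (use h1 in auto)
  obtain g where g: "g holomorphic_on ball 0 1" "\<And>u. u \<in> ball 0 1 \<Longrightarrow> g (h u) = u"
    using holomorphic_has_inverse[OF hol_h open_ball inj_h] unfolding surj_h by metis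
  have g1: "cmod (g v) < 1" if v: "cmod v < 1" for v
  proof -
    have "v \<in> h ` ball 0 1" using v surj_h by simp
    then show ?thesis using g(2) by auto
  qed
  have g0: "g 0 = 0" using g(2)[of 0] h0 by simp
  have "cmod (h u) = cmod u" if u: "cmod u < 1" for u
  proof (rule antisym)
    show "cmod (h u) \<le> cmod u" by (rule Schwarz_Lemma(1)[OF hol_h h0 h1 u])
    show "cmod u \<le> cmod (h u)" using Schwarz_Lemma(1)[OF g(1) g0 g1 h1[OF u]] g(2)[of u] u by simp
  qed
  then have "\<exists>z. cmod z < 1 \<and> z \<noteq> 0 \<and> cmod (h z) = cmod z" by (intro exI[of _ "1/2"]) simp
  then obtain a where a: "\<And>z. cmod z < 1 \<Longrightarrow> h z = a * z" "cmod a = 1"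
    using Schwarz_Lemma(3)[OF hol_h h0 h1, of 0] by auto
  have rot: "C (A (f w)) = a * C w" if "w \<in> ?H" for w
    using a(1)[OF CH[OF that]] CiC[OF that] by (simp add: h_def)
  have C_inf: "((\<lambda>n. C (q n)) \<longlongrightarrow> 1) G" if "filterlim q at_infinity G" for q :: "nat \<Rightarrow> complex" and G
  proof -
    have "filterlim (\<lambda>n. q n + \<i>) at_infinity G"
      using that by (intro tendsto_add_filterlim_at_infinity'[OF that tendsto_const])
    then have "((\<lambda>n. 1 - 2 * \<i> * inverse (q n + \<i>)) \<longlongrightarrow> 1 - 2 * \<i> * 0) G"
      by (intro tendsto_intros filterlim_compose[OF tendsto_inverse_0])
    moreover have "eventually (\<lambda>n. 1 - 2 * \<i> * inverse (q n + \<i>) = C (q n)) G"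
      using filterlim_at_infinity_imp_eventually_ne[OF that, of "- \<i>"]
    proof eventually_elim
      case (elim n)
      then have "q n + \<i> \<noteq> 0" by (simp add: eq_neg_iff_add_eq_0)
      then show ?case by (simp add: C_def field_simps)
    qed
    ultimately show ?thesis by (simp add: filterlim_cong)
  qed
  \<comment> \<open>Along the imaginary axis both \<open>C w\<close> and \<open>C (A (f w))\<close>
    tend to 1, the image of infinity; since the latter is \<open>a * C w\<close>, this forces
    \<open>a = 1\<close>.\<close>
  define y where "y n = of_real (real (Suc n)) * \<i>" for n
  have yH: "y n \<in> ?H" for n by (simp add: y_def upper_half_plane_def)
  have y_inf: "filterlim y at_infinity sequentially"
    unfolding y_def filterlim_at_infinity_conv_norm_at_top
    by (simp add: norm_mult del: of_nat_Suc) (intro filterlim_compose[OF filterlim_real_sequentially] filterlim_Suc)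
  have fy_inf: "filterlim (\<lambda>n. f (y n)) at_infinity sequentially"
    by (rule filterlim_compose[OF linf]) (auto simp: filterlim_inf filterlim_principal y_inf yH)
  have "filterlim (\<lambda>n. A (f (y n))) at_infinity sequentially"
  proof -
    have "filterlim (\<lambda>n. (f (y n) + (- of_real (Re p)))) at_infinity sequentially"
      by (intro tendsto_add_filterlim_at_infinity'[OF fy_inf tendsto_const])
    then show ?thesis unfolding A_def filterlim_at_infinity_conv_norm_at_top
      using p by (simp add: norm_divide filterlim_tendsto_pos_mult_at_top[OF tendsto_const, of "1 / Im p", simplified])
  qed
  then have "(\<lambda>n. C (A (f (y n)))) \<longlonglongrightarrow> 1" by (rule C_inf)
  moreover have "(\<lambda>n. C (A (f (y n)))) \<longlonglongrightarrow> a * 1"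
    unfolding rot[OF yH] by (intro tendsto_intros C_inf y_inf)
  ultimately have "a = 1" using LIMSEQ_unique by force
  have f_eq: "f w = Ai w" if "w \<in> ?H" for w
  proof -
    have "C (A (f w)) = C w" using rot[OF that] \<open>a = 1\<close> by simp
    then have "A (f w) = w" using CiC[of "A (f w)"] CiC[OF that] AH fH that by metis
    then show ?thesis by (metis AAi(2))
  qed
  have lim: "Ai x0 = L" if "(f \<longlongrightarrow> L) (at x0 within ?H)" "Im x0 = 0" for x0 L
  proof -
    define q where "q n = x0 + of_real (1 / real (Suc n)) * \<i>" for n
    have Imq: "Im (q n) > 0" for n using that(2) by (simp add: q_def)
    have qH: "q n \<in> ?H" "q n \<noteq> x0" for n using Imq[of n] that(2) by (auto simp: upper_half_plane_def)
    have "q \<longlonglongrightarrow> x0 + of_real 0 * \<i>"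
      unfolding q_def by (intro tendsto_intros LIMSEQ_Suc[OF lim_const_over_n])
    then have q: "q \<longlonglongrightarrow> x0" by simp
    have "filterlim q (at x0 within ?H) sequentially"
      unfolding filterlim_at using q qH by auto
    then have "(\<lambda>n. f (q n)) \<longlonglongrightarrow> L" by (rule filterlim_compose[OF that(1)])
    moreover have "(\<lambda>n. f (q n)) \<longlonglongrightarrow> Ai x0"
      unfolding f_eq[OF qH(1)] Ai_def by (intro tendsto_intros q)
    ultimately show ?thesis using LIMSEQ_unique by auto
  qed
  \<comment> \<open>Only translations and dilations are left; the limit at 0 gives
    \<open>Re p\<close>, the limit at 1 then gives \<open>Im p\<close>.\<close>
  have "Ai 0 = 0" "Ai 1 = 1" using lim[OF l0] lim[OF l1] by auto
  then have "Re p = 0" "Im p = 1" by (auto simp: Ai_def complex_eq_iff)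
  then show ?thesis using f_eq[OF w] by (simp add: Ai_def)
qed

text \<open>\<open>strip_inverse\<close> after \<open>F\<close> is an automorphism of the
  half-plane. With e = exp (i pi F), the prescribed values 1, infinity, 0 of F make e tend to -1, 0,
  1, so the square of (1 + e) / (1 - e) tends to 0, 1, infinity, as the previous lemma
  requires.\<close>

lemma conformal_equivalence_eq_strip_map:
  assumes conf: "conformal_equivalence F upper_half_plane half_strip"
    and l0: "(F \<longlongrightarrow> 1) (at 0 within upper_half_plane)"
    and l1: "filterlim F at_infinity (at 1 within upper_half_plane)"
    and linf: "(F \<longlongrightarrow> 0) (inf at_infinity (principal upper_half_plane))"
    and w: "w \<in> upper_half_plane"
  shows "F w = strip_map w"
proof -
  let ?H = upper_half_plane
  have holF: "F holomorphic_on ?H" and bijF: "bij_betw F ?H half_strip"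
    using conf by (auto simp: conformal_equivalence_def)
  have FS: "F w \<in> half_strip" if "w \<in> ?H" for w using bijF that by (auto simp: bij_betw_def)
  have S1: "1 - exp (\<i> * of_real pi * v) \<noteq> 0" if "v \<in> half_strip" for v
    using quadrant(3)[OF exp_half_strip[OF that]] .
  have holG: "strip_inverse holomorphic_on half_strip"
    unfolding strip_inverse_def by (intro holomorphic_intros) (use S1 in auto)
  have bijG: "bij_betw strip_inverse half_strip ?H"
    by (rule bij_betwI[where g=strip_map])
       (auto simp: upper_half_plane_def strip_inverse_half_strip strip_map_half_plane)
  define f where "f w = strip_inverse (F w)" for w
  have "f w = w"
  proof (rule half_plane_automorphism_eq_id[OF _ _ _ _ _ w])
    have "(strip_inverse \<circ> F) holomorphic_on ?H"
      by (rule holomorphic_on_compose_gen[OF holF holG]) (use FS in auto)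
    then show "f holomorphic_on ?H" by (simp add: f_def[abs_def] o_def)
    show "bij_betw f ?H ?H" using bij_betw_trans[OF bijF bijG] by (simp add: f_def[abs_def] o_def)
    have "((\<lambda>w. ((1 + exp (\<i> * of_real pi * F w)) / (1 - exp (\<i> * of_real pi * F w)))\<^sup>2) \<longlongrightarrow>
      ((1 + exp (\<i> * of_real pi * 1)) / (1 - exp (\<i> * of_real pi * 1)))\<^sup>2) (at 0 within ?H)"
      by (intro tendsto_intros l0) (simp add: exp_pi_i')
    then show "(f \<longlongrightarrow> 0) (at 0 within ?H)" by (simp add: f_def[abs_def] strip_inverse_def exp_pi_i')
    have "filterlim (\<lambda>w. cmod (F w)) at_top (at 1 within ?H)" by (rule filterlim_at_infinity_imp_norm_at_top[OF l1])
    then have "filterlim (\<lambda>w. cmod (F w) + (- 1)) at_top (at 1 within ?H)"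
      by (subst add.commute) (intro filterlim_tendsto_add_at_top[OF tendsto_const])
    \<comment> \<open>In the strip the real part is below 1, so |F| <= |Re F| + |Im F| forces Im F
      to +infinity.\<close>
    moreover have "eventually (\<lambda>w. cmod (F w) + (- 1) \<le> Im (F w)) (at 1 within ?H)"
      unfolding eventually_at_filter
    proof (intro always_eventually allI impI)
      fix w assume "w \<in> ?H"
      then show "cmod (F w) + (- 1) \<le> Im (F w)" using FS[of w] cmod_le[of "F w"] by (auto simp: half_strip_def)
    qed
    ultimately have ImF: "filterlim (\<lambda>w. Im (F w)) at_top (at 1 within ?H)" by (rule filterlim_at_top_mono)
    have "((\<lambda>w. exp (- (pi * Im (F w)))) \<longlongrightarrow> 0) (at 1 within ?H)"
    proof (rule filterlim_compose[OF exp_at_bot])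
      have "filterlim (\<lambda>w. pi * Im (F w)) at_top (at 1 within ?H)"
        by (rule filterlim_tendsto_pos_mult_at_top[OF tendsto_const pi_gt_zero ImF])
      then show "filterlim (\<lambda>w. - (pi * Im (F w))) at_bot (at 1 within ?H)"
        by (simp add: filterlim_uminus_at_bot)
    qed
    then have "((\<lambda>w. exp (\<i> * of_real pi * F w)) \<longlongrightarrow> 0) (at 1 within ?H)"
      by - (rule tendsto_norm_zero_cancel, simp add: norm_exp_eq_Re mult.assoc)
    then have "((\<lambda>w. ((1 + exp (\<i> * of_real pi * F w)) / (1 - exp (\<i> * of_real pi * F w)))\<^sup>2) \<longlongrightarrow> ((1 + 0) / (1 - 0))\<^sup>2) (at 1 within ?H)"
      by (intro tendsto_intros) auto
    then show "(f \<longlongrightarrow> 1) (at 1 within ?H)" by (simp add: f_def[abs_def] strip_inverse_def)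
    let ?I = "inf at_infinity (principal ?H)"
    have "((\<lambda>w. ((1 - exp (\<i> * of_real pi * F w)) / (1 + exp (\<i> * of_real pi * F w)))\<^sup>2) \<longlongrightarrow>
      ((1 - exp (\<i> * of_real pi * 0)) / (1 + exp (\<i> * of_real pi * 0)))\<^sup>2) ?I"
      by (intro tendsto_intros linf) simp
    then have "((\<lambda>w. inverse (f w)) \<longlongrightarrow> 0) ?I"
      by (simp add: f_def[abs_def] strip_inverse_def power_inverse[symmetric])
    moreover have "eventually (\<lambda>w. inverse (f w) \<noteq> 0) ?I"
      unfolding eventually_inf_principal
    proof (intro always_eventually allI impI)
      fix w assume "w \<in> ?H"
      then show "inverse (f w) \<noteq> 0" using strip_inverse_half_strip(1)[OF FS, of w] by (auto simp: f_def)
    qed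
    ultimately have "filterlim (\<lambda>w. inverse (f w)) (at 0) ?I" by (simp add: filterlim_at)
    then have "filterlim (\<lambda>w. inverse (inverse (f w))) at_infinity ?I"
      by (rule filterlim_compose[OF filterlim_inverse_at_infinity])
    then show "filterlim f at_infinity ?I" by simp
  qed
  then show ?thesis using strip_inverse_half_strip(2)[OF FS[OF w]] by (simp add: f_def)
qed

section \<open>Functions annihilated by the generator\<close>

text \<open>At \<open>s = 1\<close> this is the Euler step of length \<open>d\<close> with driving increment \<open>x\<close>. Scaling time by \<open>s\<^sup>2\<close> and
  the increment by \<open>s\<close> turns the Ito expansion into a Taylor expansion in one complex variable, whose
  remainder is controlled by Cauchy's estimates.\<close>

definition curve :: "complex \<Rightarrow> real \<Rightarrow> real \<Rightarrow> complex \<Rightarrow> complex" where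
  "curve z d x s = z + 2 * of_real d * s\<^sup>2 / z - s * of_real x"

text \<open>\<open>k\<close> is the first derivative along the curve. With D = d_Z + d_X the chain
  rule gives k 0 = - x D f and k' 0 = x^2 D^2 f + 4 d ((1/Z) d_Z + (1/X) d_X) f. If the generator
  maps f to \<open>l\<close>, the latter is (x^2 - 8 d) D^2 f + 2 d l. So \<open>A\<close> stands
  for - D f and \<open>B\<close> for D^2 f, without mentioning partial derivatives.\<close>

definition derivs_along :: "(complex \<times> complex) set \<Rightarrow> (complex \<times> complex \<Rightarrow> complex) \<Rightarrow> complex \<Rightarrow>
    complex \<Rightarrow> complex \<Rightarrow> complex \<Rightarrow> complex \<Rightarrow> real \<Rightarrow> real \<Rightarrow> (complex \<Rightarrow> complex) \<Rightarrow> bool" where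
  "derivs_along U f l z1 z2 A B x d k \<longleftrightarrow>
     (\<forall>s. (curve z1 d x s, curve z2 d x s) \<in> U \<longrightarrow>
        ((\<lambda>s. f (curve z1 d x s, curve z2 d x s)) has_field_derivative k s) (at s)) \<and>
     k 0 = of_real x * A \<and>
     (k has_field_derivative of_real (x\<^sup>2 - 8 * d) * B + 2 * of_real d * l) (at 0)"

text \<open>For a centred increment \<open>x\<close> of variance \<open>8 d\<close> the second-order Taylor polynomial along the curve
  has mean \<open>f + d l\<close>: this encodes that the generator maps \<open>f\<close> to the constant \<open>l\<close>.\<close>

definition test_function :: "(complex \<times> complex) set \<Rightarrow> (complex \<times> complex \<Rightarrow> complex) \<Rightarrow> complex \<Rightarrow> bool" where
  "test_function U f l \<longleftrightarrow> continuous_on U f \<and>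
     (\<forall>z1 z2. (z1, z2) \<in> U \<longrightarrow> (\<exists>A B. \<forall>x d. \<exists>k. derivs_along U f l z1 z2 A B x d k))"

lemma curve_0 [simp]: "curve z d x 0 = z" by (simp add: curve_def)

lemma curve_deriv: "(curve z d x has_field_derivative 4 * of_real d * s / z - of_real x) (at s)"
proof (cases "z = 0")
  case True then show ?thesis unfolding curve_def[abs_def] by (auto intro!: derivative_eq_intros)
next
  case False then show ?thesis unfolding curve_def[abs_def]
    by (auto intro!: derivative_eq_intros simp: field_simps)
qed

lemma curve_deriv' [derivative_intros]: "((\<lambda>s. curve z d x s) has_field_derivative 4 * of_real d * s / z - of_real x) (at s)"
  by (rule curve_deriv)

lemma test_function_subset:
  assumes "test_function U f l" "V \<subseteq> U" shows "test_function V f l"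
proof -
  have "derivs_along V f l z1 z2 A B x d k" if "derivs_along U f l z1 z2 A B x d k" for z1 z2 A B x d k
    using that assms(2) unfolding derivs_along_def by blast
  then show ?thesis
    using assms continuous_on_subset[of U f V] unfolding test_function_def by (meson subsetD)
qed

lemma test_functionI:
  assumes "continuous_on U f"
    and "\<And>z1 z2 x d s. (z1, z2) \<in> U \<Longrightarrow> (curve z1 d x s, curve z2 d x s) \<in> U \<Longrightarrow>
      ((\<lambda>s. f (curve z1 d x s, curve z2 d x s)) has_field_derivative k z1 z2 x d s) (at s)"
    and "\<And>z1 z2 x d. (z1, z2) \<in> U \<Longrightarrow> k z1 z2 x d 0 = of_real x * A z1 z2"
    and "\<And>z1 z2 x d. (z1, z2) \<in> U \<Longrightarrow> (k z1 z2 x d has_field_derivative of_real (x\<^sup>2 - 8 * d) * B z1 z2 + 2 * of_real d * l) (at 0)"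
  shows "test_function U f l"
proof -
  have "derivs_along U f l z1 z2 (A z1 z2) (B z1 z2) x d (k z1 z2 x d)" if "(z1, z2) \<in> U" for z1 z2 x d
    unfolding derivs_along_def using assms(2-4) that by blast
  then show ?thesis using assms(1) unfolding test_function_def by blast
qed

lemma test_function_add:
  assumes "test_function U f l" "test_function U g m"
  shows "test_function U (\<lambda>y. f y + g y) (l + m)"
proof -
  have *: "derivs_along U (\<lambda>y. f y + g y) (l + m) z1 z2 (A + C) (B + D) x d (\<lambda>s. k s + j s)"
    if k: "derivs_along U f l z1 z2 A B x d k" and j: "derivs_along U g m z1 z2 C D x d j" for z1 z2 A B C D x d k j
  proof -
    have "((\<lambda>s. k s + j s) has_field_derivative of_real (x\<^sup>2 - 8 * d) * (B + D) + 2 * of_real d * (l + m)) (at 0)"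
      using DERIV_add k j unfolding derivs_along_def by (fastforce simp: algebra_simps)
    then show ?thesis
      using k j unfolding derivs_along_def by (auto intro!: DERIV_add simp only: distrib_left)
  qed
  have "\<exists>A B. \<forall>x d. \<exists>k. derivs_along U (\<lambda>y. f y + g y) (l + m) z1 z2 A B x d k" if z: "(z1, z2) \<in> U" for z1 z2
  proof -
    obtain A B C D where "\<forall>x d. \<exists>k. derivs_along U f l z1 z2 A B x d k" "\<forall>x d. \<exists>k. derivs_along U g m z1 z2 C D x d k"
      using assms z unfolding test_function_def by blast
    then have "\<forall>x d. \<exists>k. derivs_along U (\<lambda>y. f y + g y) (l + m) z1 z2 (A + C) (B + D) x d k" using * by blast
    then show ?thesis by blast
  qed
  then show ?thesis
    using assms continuous_on_add[of U f g] unfolding test_function_def by blast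
qed

lemma test_function_const: "test_function U (\<lambda>y. a) 0"
  by (rule test_functionI[where k="\<lambda>_ _ _ _ _. 0" and A="\<lambda>_ _. 0" and B="\<lambda>_ _. 0"]) auto

lemma test_function_cmult:
  assumes "test_function U f l"
  shows "test_function U (\<lambda>y. a * f y) (a * l)"
proof -
  have *: "derivs_along U (\<lambda>y. a * f y) (a * l) z1 z2 (a * A) (a * B) x d (\<lambda>s. a * k s)"
    if k: "derivs_along U f l z1 z2 A B x d k" for z1 z2 A B x d k
  proof -
    have "((\<lambda>s. a * k s) has_field_derivative a * (of_real (x\<^sup>2 - 8 * d) * B + 2 * of_real d * l)) (at 0)"
      using k unfolding derivs_along_def by (intro DERIV_cmult) blast
    then have "((\<lambda>s. a * k s) has_field_derivative of_real (x\<^sup>2 - 8 * d) * (a * B) + 2 * of_real d * (a * l)) (at 0)"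
      by (rule DERIV_cong) (simp add: algebra_simps)
    then show ?thesis
      using k DERIV_cmult unfolding derivs_along_def by (simp only: mult.left_commute) blast
  qed
  have "\<exists>A B. \<forall>x d. \<exists>k. derivs_along U (\<lambda>y. a * f y) (a * l) z1 z2 A B x d k" if z: "(z1, z2) \<in> U" for z1 z2
  proof -
    obtain A B where "\<forall>x d. \<exists>k. derivs_along U f l z1 z2 A B x d k"
      using assms z unfolding test_function_def by blast
    then have "\<forall>x d. \<exists>k. derivs_along U (\<lambda>y. a * f y) (a * l) z1 z2 (a * A) (a * B) x d k" using * by blast
    then show ?thesis by blast
  qed
  then show ?thesis
    using assms continuous_on_mult_left[of U f a] unfolding test_function_def by blast
qed

text \<open>The second coordinate is complex because the Taylor argument needs complex parameters
  \<open>s\<close> of \<open>curve\<close>. The four conditions keep \<open>csqrt (fst y)\<close>,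
  \<open>csqrt (snd y)\<close>, \<open>strip_map (fst y / snd y)\<close> and
  \<open>Ln (fst y - snd y)\<close>, in this order, off their branch cuts. For real x > 0 they all
  follow from Im z > 0.\<close>

definition pair_domain :: "(complex \<times> complex) set" where
  "pair_domain = {(z, x). 0 < Im z \<and> 0 < Re x \<and> 0 < Im (z / x) \<and> 0 < Im (z - x)}"

lemma open_pair_domain: "open pair_domain"
proof -
  have eq: "pair_domain = {y. 0 < Im (fst y)} \<inter> {y. 0 < Im (fst y - snd y)} \<inter> ({y. 0 < Re (snd y)} \<inter> {y. 0 < Im (fst y / snd y)})"
    by (auto simp: pair_domain_def)
  have o3: "open ({y :: complex \<times> complex. 0 < Re (snd y)} \<inter> {y. 0 < Im (fst y / snd y)})" (is "open (?V \<inter> ?W)")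
  proof -
    have V: "open ?V" by (intro open_Collect_less continuous_intros)
    have "continuous_on ?V (\<lambda>y. Im (fst y / snd y))" by (intro continuous_intros) auto
    from continuous_open_preimage[OF this V open_greaterThan[of 0]]
    have "open (?V \<inter> (\<lambda>y. Im (fst y / snd y)) -` {0<..})" .
    moreover have "?V \<inter> ?W = ?V \<inter> (\<lambda>y. Im (fst y / snd y)) -` {0<..}" by auto
    ultimately show ?thesis by simp
  qed
  have o1: "open {y :: complex \<times> complex. 0 < Im (fst y)}" and o2: "open {y :: complex \<times> complex. 0 < Im (fst y - snd y)}"
    by (intro open_Collect_less continuous_intros)+
  show ?thesis unfolding eq by (rule open_Int[OF open_Int[OF o1 o2] o3])
qed

text \<open>The exponent 1/2 solves 2 a + 4 a (a - 1) = 0: on Z^a the drift 2 / Z and the diffusion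
  of variance 8 cancel.\<close>

lemma test_function_csqrt_fst: "test_function pair_domain (\<lambda>y. csqrt (fst y)) 0"
proof (rule test_functionI[where k="\<lambda>z1 z2 x d s. (4 * of_real d * s / z1 - of_real x) / (2 * csqrt (curve z1 d x s))"
      and A="\<lambda>z1 z2. - 1 / (2 * csqrt z1)" and B="\<lambda>z1 z2. - 1 / (4 * csqrt z1 * z1)"])
  show "continuous_on pair_domain (\<lambda>y. csqrt (fst y))"
    by (rule continuous_on_compose2[OF holomorphic_on_imp_continuous_on[OF holomorphic_on_csqrt]])
      (auto simp: pair_domain_def complex_nonpos_Reals_iff intro: continuous_intros)
  fix z1 z2 :: complex and x d :: real
  assume "(z1, z2) \<in> pair_domain"
  then have z: "z1 \<notin> \<real>\<^sub>\<le>\<^sub>0" by (auto simp: pair_domain_def complex_nonpos_Reals_iff)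
  define r where "r = csqrt z1"
  have r: "r \<noteq> 0" "z1 = r * r" using z by (auto simp: r_def simp flip: power2_eq_square)
  have rr: "csqrt (r * r) = r" unfolding r(2)[symmetric] by (simp add: r_def)
  show "((\<lambda>s. (4 * of_real d * s / z1 - of_real x) / (2 * csqrt (curve z1 d x s))) has_field_derivative
       of_real (x\<^sup>2 - 8 * d) * (- 1 / (4 * csqrt z1 * z1)) + 2 * of_real d * 0) (at 0)"
    using z r by (auto intro!: derivative_eq_intros simp: r_def[symmetric] rr)
      (simp add: rr field_simps power2_eq_square)
  show "((\<lambda>s. csqrt (fst (curve z1 d x s, curve z2 d x s))) has_field_derivative
     (4 * of_real d * s / z1 - of_real x) / (2 * csqrt (curve z1 d x s))) (at s)"
    if "(curve z1 d x s, curve z2 d x s) \<in> pair_domain" for s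
    using that unfolding fst_conv by (intro has_field_derivative_csqrt' curve_deriv) (auto simp: pair_domain_def complex_nonpos_Reals_iff)
qed simp

lemma test_function_csqrt_snd: "test_function pair_domain (\<lambda>y. csqrt (snd y)) 0"
proof (rule test_functionI[where k="\<lambda>z2 z1 x d s. (4 * of_real d * s / z1 - of_real x) / (2 * csqrt (curve z1 d x s))"
      and A="\<lambda>z2 z1. - 1 / (2 * csqrt z1)" and B="\<lambda>z2 z1. - 1 / (4 * csqrt z1 * z1)"])
  show "continuous_on pair_domain (\<lambda>y. csqrt (snd y))"
    by (rule continuous_on_compose2[OF holomorphic_on_imp_continuous_on[OF holomorphic_on_csqrt]])
      (auto simp: pair_domain_def complex_nonpos_Reals_iff intro: continuous_intros)
  fix z1 z2 :: complex and x d :: real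
  assume "(z2, z1) \<in> pair_domain"
  then have z: "z1 \<notin> \<real>\<^sub>\<le>\<^sub>0" by (auto simp: pair_domain_def complex_nonpos_Reals_iff)
  define r where "r = csqrt z1"
  have r: "r \<noteq> 0" "z1 = r * r" using z by (auto simp: r_def simp flip: power2_eq_square)
  have rr: "csqrt (r * r) = r" unfolding r(2)[symmetric] by (simp add: r_def)
  show "((\<lambda>s. (4 * of_real d * s / z1 - of_real x) / (2 * csqrt (curve z1 d x s))) has_field_derivative
       of_real (x\<^sup>2 - 8 * d) * (- 1 / (4 * csqrt z1 * z1)) + 2 * of_real d * 0) (at 0)"
    using z r by (auto intro!: derivative_eq_intros simp: r_def[symmetric] rr)
      (simp add: rr field_simps power2_eq_square)
  show "((\<lambda>s. csqrt (snd (curve z2 d x s, curve z1 d x s))) has_field_derivative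
     (4 * of_real d * s / z1 - of_real x) / (2 * csqrt (curve z1 d x s))) (at s)"
    if "(curve z2 d x s, curve z1 d x s) \<in> pair_domain" for s
    using that unfolding snd_conv by (intro has_field_derivative_csqrt' curve_deriv) (auto simp: pair_domain_def complex_nonpos_Reals_iff)
qed simp

text \<open>12 = (2 / X) 2 X + 4 * 2. The nonzero constant is what makes this function measure
  time.\<close>

lemma test_function_square_snd: "test_function pair_domain (\<lambda>y. (snd y)\<^sup>2) 12"
proof (rule test_functionI[where k="\<lambda>z2 z1 x d s. 2 * curve z1 d x s * (4 * of_real d * s / z1 - of_real x)"
      and A="\<lambda>z2 z1. - 2 * z1" and B="\<lambda>z2 z1. 2"])
  fix z1 z2 :: complex and x d :: real
  assume "(z2, z1) \<in> pair_domain"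
  then have z: "z1 \<noteq> 0" by (auto simp: pair_domain_def)
  show "((\<lambda>s. 2 * curve z1 d x s * (4 * of_real d * s / z1 - of_real x)) has_field_derivative
       of_real (x\<^sup>2 - 8 * d) * 2 + 2 * of_real d * 12) (at 0)"
    using z by (auto intro!: derivative_eq_intros simp: field_simps power2_eq_square)
  show "((\<lambda>s. (snd (curve z2 d x s, curve z1 d x s))\<^sup>2) has_field_derivative
     2 * curve z1 d x s * (4 * of_real d * s / z1 - of_real x)) (at s)" for s
    unfolding snd_conv by (auto intro!: derivative_eq_intros curve_deriv)
qed (auto intro!: continuous_intros)

definition strip_rate :: "complex \<Rightarrow> complex \<Rightarrow> real \<Rightarrow> real \<Rightarrow> complex \<Rightarrow> complex" where
  "strip_rate z1 z2 x d s =
     (let Z = curve z1 d x s; X = curve z2 d x s in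
      - (\<i> / of_real pi) / (csqrt (Z / X) * (Z / X - 1)) *
      (((4 * of_real d * s / z1 - of_real x) * X - Z * (4 * of_real d * s / z2 - of_real x)) / (X * X)))"

lemma strip_map_curve_deriv:
  assumes "(curve z1 d x s, curve z2 d x s) \<in> pair_domain"
  shows "((\<lambda>s. strip_map (curve z1 d x s / curve z2 d x s)) has_field_derivative strip_rate z1 z2 x d s) (at s)"
proof -
  have X: "curve z2 d x s \<noteq> 0" and I: "0 < Im (curve z1 d x s / curve z2 d x s)" using assms by (auto simp: pair_domain_def)
  show ?thesis
    unfolding strip_rate_def Let_def
    by (rule DERIV_chain2[OF strip_map_deriv[OF I] DERIV_divide[OF curve_deriv curve_deriv X]])
qed

text \<open>For w = Z / X the increment changes w at rate x (w - 1) / X, and the factor w - 1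
  cancels the pole of F'. What remains, c / (sqrt w X), has square c^2 / (Z X), on which
  \<open>log_part\<close> is built.\<close>

lemma strip_rate_0:
  assumes "(z1, z2) \<in> pair_domain"
  shows "strip_rate z1 z2 x d 0 = of_real x * (- (\<i> / of_real pi) / (csqrt (z1 / z2) * z2))"
proof -
  define r where "r = csqrt (z1 / z2)"
  have z: "z2 \<noteq> 0" "0 < Im (z1 / z2)" using assms by (auto simp: pair_domain_def)
  have z1: "z1 = r * r * z2" using z by (simp add: r_def flip: power2_eq_square)
  have q: "z1 / z2 = r * r" using z by (simp add: z1)
  have rr: "csqrt (r * r) = r" unfolding q[symmetric] by (simp add: r_def)
  have ne: "r \<noteq> 0" "r * r - 1 \<noteq> 0"
    using z(2) unfolding q by (auto simp only: right_minus_eq one_complex.simps zero_complex.simps mult_zero_left)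
  have "strip_rate z1 z2 x d 0 = - (\<i> / of_real pi) / (r * (r * r - 1)) * ((of_real x * ((r * r - 1) * z2)) / (z2 * z2))"
  proof -
    have *: "(4 * of_real d * 0 / z1 - of_real x) * z2 - z1 * (4 * of_real d * 0 / z2 - of_real x) = of_real x * ((r * r - 1) * z2)"
      by (simp add: z1 algebra_simps)
    show ?thesis unfolding strip_rate_def Let_def curve_0 q rr * ..
  qed
  also have "\<dots> = of_real x * (- (\<i> / of_real pi) / (r * z2))"
  proof -
    have "- c / (r * m) * ((of_real x * (m * z2)) / (z2 * z2)) = of_real x * (- c / (r * z2))" if "m \<noteq> 0" for m c
      using that ne(1) z(1) by (simp add: field_simps)
    from this[OF ne(2)] show ?thesis .
  qed
  finally show ?thesis by (simp add: q rr)
qed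

text \<open>Substituting Z = r^2 X makes everything rational in \<open>r\<close> and X. The content
  is that the second derivative is a pure multiple of x^2 - 8 d, that is, the generator annihilates
  F(Z / X).\<close>

lemma strip_rate_deriv:
  assumes "(z1, z2) \<in> pair_domain"
  shows "(strip_rate z1 z2 x d has_field_derivative of_real (x\<^sup>2 - 8 * d) *
     (- (\<i> / of_real pi) * (1 + z1 / z2) / (2 * csqrt (z1 / z2) * (z1 / z2) * z2\<^sup>2)) + 2 * of_real d * 0) (at 0)"
proof -
  define r where "r = csqrt (z1 / z2)"
  have z: "z2 \<noteq> 0" "0 < Im (z1 / z2)" using assms by (auto simp: pair_domain_def)
  have z1: "z1 = r * r * z2" using z by (simp add: r_def flip: power2_eq_square)
  have q: "z1 / z2 = r * r" using z by (simp add: z1)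
  have rr: "csqrt (r * r) = r" unfolding q[symmetric] by (simp add: r_def)
  have ne: "r \<noteq> 0" "r * r - 1 \<noteq> 0" "r * r \<notin> \<real>\<^sub>\<le>\<^sub>0"
    using z(2) unfolding q
    by (auto simp only: right_minus_eq one_complex.simps zero_complex.simps mult_zero_left Im_pos_not_nonpos_Reals)
  let ?w = "\<lambda>s. curve z1 d x s / curve z2 d x s"
  define w1 where "w1 s = ((4 * of_real d * s / z1 - of_real x) * curve z2 d x s -
       curve z1 d x s * (4 * of_real d * s / z2 - of_real x)) / (curve z2 d x s * curve z2 d x s)" for s
  have w1_0: "w1 0 = of_real x * (r * r - 1) / z2"
    using z by (simp add: w1_def z1 field_simps)
  have w: "(?w has_field_derivative w1 0) (at 0)"
    unfolding w1_def by (rule DERIV_divide[OF curve_deriv curve_deriv]) (use z in simp)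
  \<comment> \<open>The second derivative of Z / X along the curve at 0.\<close>
  define w2 where "w2 = (1 - r * r) / z2\<^sup>2 * (4 * of_real d * (1 + r * r) / (r * r) - 2 * (of_real x)\<^sup>2)"
  have dw1: "(w1 has_field_derivative w2) (at 0)"
    unfolding w1_def[abs_def] using z(1) ne(1)
    by (auto intro!: derivative_eq_intros simp: w2_def z1) (simp add: field_simps power2_eq_square)
  have cs: "((\<lambda>s. csqrt (?w s)) has_field_derivative w1 0 / (2 * r)) (at 0)"
    using has_field_derivative_csqrt'[OF w] ne(3) by (simp add: q rr)
  have den: "((\<lambda>s. csqrt (?w s) * (?w s - 1)) has_field_derivative w1 0 / (2 * r) * (r * r - 1) + w1 0 * r) (at 0)"
    using DERIV_mult[OF cs DERIV_diff[OF w DERIV_const[of 1]]] by (simp add: q rr mult.commute)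
  have "((\<lambda>s. w1 s / (csqrt (?w s) * (?w s - 1))) has_field_derivative
      (w2 * (r * (r * r - 1)) - w1 0 * (w1 0 / (2 * r) * (r * r - 1) + w1 0 * r)) / ((r * (r * r - 1)) * (r * (r * r - 1)))) (at 0)"
    using DERIV_divide[OF dw1 den] ne by (simp add: q rr)
  also have "(w2 * (r * (r * r - 1)) - w1 0 * (w1 0 / (2 * r) * (r * r - 1) + w1 0 * r)) / ((r * (r * r - 1)) * (r * (r * r - 1)))
      = of_real (x\<^sup>2 - 8 * d) * ((1 + r * r) / (2 * r * (r * r) * z2\<^sup>2))" (is "?l = _")
  proof -
    define m where "m = r * r - 1"
    have m: "m \<noteq> 0" using ne by (simp add: m_def)
    have rr: "1 - r * r = - m" by (simp add: m_def)
    have "w2 * (r * m) - (of_real x * m / z2) * ((of_real x * m / z2) / (2 * r) * m + (of_real x * m / z2) * r)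
      = (r * m) * (r * m) * (of_real (x\<^sup>2 - 8 * d) * ((1 + r * r) / (2 * r * (r * r) * z2\<^sup>2)))"
      unfolding w2_def rr using ne(1) z(1)
      by (simp add: field_simps power2_eq_square) (simp add: m_def algebra_simps)
    then show ?thesis unfolding w1_0 m_def[symmetric] using m ne(1) by simp
  qed
  finally have "((\<lambda>s. - (\<i> / of_real pi) * (w1 s / (csqrt (?w s) * (?w s - 1)))) has_field_derivative
    - (\<i> / of_real pi) * (of_real (x\<^sup>2 - 8 * d) * ((1 + r * r) / (2 * r * (r * r) * z2\<^sup>2)))) (at 0)"
    by (rule DERIV_cmult)
  also have "(\<lambda>s. - (\<i> / of_real pi) * (w1 s / (csqrt (?w s) * (?w s - 1)))) = strip_rate z1 z2 x d"
    by (simp add: fun_eq_iff strip_rate_def w1_def Let_def)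
  finally show ?thesis by (simp add: q rr mult_ac)
qed

lemma continuous_on_strip_map: "continuous_on pair_domain (\<lambda>y. strip_map (fst y / snd y))"
proof (rule continuous_on_compose2[of "{w. 0 < Im w}" strip_map])
  show "continuous_on {w. 0 < Im w} strip_map"
    using strip_map_deriv by (auto intro!: continuous_at_imp_continuous_on DERIV_isCont)
  show "continuous_on pair_domain (\<lambda>y. fst y / snd y)" by (intro continuous_intros) (auto simp: pair_domain_def)
qed (auto simp: pair_domain_def)

lemma test_function_strip_map: "test_function pair_domain (\<lambda>y. strip_map (fst y / snd y)) 0"
  by (rule test_functionI[where k=strip_rate, OF continuous_on_strip_map _ strip_rate_0 strip_rate_deriv])
     (auto intro: strip_map_curve_deriv)

text \<open>With \<open>F' = c w\<^sup>-\<^sup>1\<^sup>/\<^sup>2 / (w - 1)\<close> the generator maps \<open>F\<^sup>2\<close> to \<open>8 c\<^sup>2 / (Z X)\<close> and \<open>Ln (Z - X)\<close> to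
  \<open>- 2 / (Z X)\<close>; here \<open>c\<^sup>2 = - 1 / \<pi>\<^sup>2\<close>.\<close>

definition log_part :: "complex \<times> complex \<Rightarrow> complex" where
  "log_part y = (strip_map (fst y / snd y))\<^sup>2 - of_real (4 / pi\<^sup>2) * Ln (fst y - snd y)"

text \<open>Both points move by the same driving increment, so Z - X does not see it and the
  logarithm contributes a second derivative proportional to d alone. Squaring F contributes, besides
  the multiple inherited from \<open>strip_rate_deriv\<close>, a term proportional to x^2 alone. The
  factor 4 / pi^2 merges the two into a multiple of x^2 - 8 d.\<close>

lemma test_function_log_part: "test_function pair_domain log_part 0"
proof (rule test_functionI[where
   k="\<lambda>z1 z2 x d s. 2 * strip_map (curve z1 d x s / curve z2 d x s) * strip_rate z1 z2 x d s
      - of_real (4 / pi\<^sup>2) * (4 * of_real d * s * (1 / z1 - 1 / z2) / (curve z1 d x s - curve z2 d x s))"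
   and A="\<lambda>z1 z2. 2 * strip_map (z1 / z2) * (- (\<i> / of_real pi) / (csqrt (z1 / z2) * z2))"
   and B="\<lambda>z1 z2. 2 * strip_map (z1 / z2) * (- (\<i> / of_real pi) * (1 + z1 / z2) / (2 * csqrt (z1 / z2) * (z1 / z2) * z2\<^sup>2))
      - of_real (2 / pi\<^sup>2) / (z1 * z2)"])
  show "continuous_on pair_domain log_part"
    unfolding log_part_def[abs_def]
    by (intro continuous_intros continuous_on_strip_map) (auto simp: pair_domain_def complex_nonpos_Reals_iff)
  fix z1 z2 :: complex and x d :: real
  assume U: "(z1, z2) \<in> pair_domain"
  show "2 * strip_map (curve z1 d x 0 / curve z2 d x 0) * strip_rate z1 z2 x d 0
      - of_real (4 / pi\<^sup>2) * (4 * of_real d * 0 * (1 / z1 - 1 / z2) / (curve z1 d x 0 - curve z2 d x 0))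
      = of_real x * (2 * strip_map (z1 / z2) * (- (\<i> / of_real pi) / (csqrt (z1 / z2) * z2)))"
    by (simp add: strip_rate_0[OF U])
  show "((\<lambda>s. log_part (curve z1 d x s, curve z2 d x s)) has_field_derivative
     2 * strip_map (curve z1 d x s / curve z2 d x s) * strip_rate z1 z2 x d s
      - of_real (4 / pi\<^sup>2) * (4 * of_real d * s * (1 / z1 - 1 / z2) / (curve z1 d x s - curve z2 d x s))) (at s)"
    if s: "(curve z1 d x s, curve z2 d x s) \<in> pair_domain" for s
  proof -
    have n: "curve z1 d x s - curve z2 d x s \<notin> \<real>\<^sub>\<le>\<^sub>0" using s by (auto simp: pair_domain_def complex_nonpos_Reals_iff)
    have 1: "((\<lambda>s. Ln (curve z1 d x s - curve z2 d x s)) has_field_derivative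
      inverse (curve z1 d x s - curve z2 d x s) * ((4 * of_real d * s / z1 - of_real x) - (4 * of_real d * s / z2 - of_real x))) (at s)"
      by (rule DERIV_chain2[OF has_field_derivative_Ln[OF n] DERIV_diff[OF curve_deriv curve_deriv]])
    show ?thesis
      unfolding log_part_def fst_conv snd_conv
      using DERIV_diff[OF DERIV_power[OF strip_map_curve_deriv[OF s], of 2] DERIV_cmult[OF 1, of "of_real (4 / pi\<^sup>2)"]]
      by (rule DERIV_cong) (simp add: field_simps)
  qed
  have z: "z1 \<noteq> 0" "z2 \<noteq> 0" "z1 - z2 \<noteq> 0" using U by (auto simp: pair_domain_def)
  have "((\<lambda>s. 4 * of_real d * s * (1 / z1 - 1 / z2) / (curve z1 d x s - curve z2 d x s)) has_field_derivative
      - (4 * of_real d / (z1 * z2))) (at 0)"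
  proof -
    have "4 * of_real d * (1 / z1 - 1 / z2) / (z1 - z2) = - (4 * of_real d / (z1 * z2))"
      using z by (simp add: field_simps)
    then show ?thesis using z by (auto intro!: derivative_eq_intros)
  qed
  from DERIV_cmult[OF this, of "of_real (4 / pi\<^sup>2)"]
  have 2: "((\<lambda>s. of_real (4 / pi\<^sup>2) * (4 * of_real d * s * (1 / z1 - 1 / z2) / (curve z1 d x s - curve z2 d x s)))
      has_field_derivative of_real (4 / pi\<^sup>2) * (- (4 * of_real d / (z1 * z2)))) (at 0)" .
  define a where "a = - (\<i> / of_real pi) / (csqrt (z1 / z2) * z2)"
  have sq: "a * a = - (of_real (1 / pi\<^sup>2) / (z1 * z2))"
  proof -
    have "csqrt (z1 / z2) * csqrt (z1 / z2) = z1 / z2" by (simp flip: power2_eq_square)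
    then have "(csqrt (z1 / z2) * z2) * (csqrt (z1 / z2) * z2) = z1 * z2" using z by (simp add: field_simps)
    then show ?thesis unfolding a_def by (simp add: power2_eq_square)
  qed
  have U0: "(curve z1 d x 0, curve z2 d x 0) \<in> pair_domain" using U by simp
  define b where "b = - (\<i> / of_real pi) * (1 + z1 / z2) / (2 * csqrt (z1 / z2) * (z1 / z2) * z2\<^sup>2)"
  have 3: "((\<lambda>s. 2 * strip_map (curve z1 d x s / curve z2 d x s) * strip_rate z1 z2 x d s) has_field_derivative
     2 * (of_real x * a) * (of_real x * a) + (of_real (x\<^sup>2 - 8 * d) * b) * (2 * strip_map (z1 / z2))) (at 0)"
    using DERIV_mult[OF DERIV_cmult[OF strip_map_curve_deriv[OF U0], of 2] strip_rate_deriv[OF U, of x d]]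
    unfolding b_def a_def by (simp add: strip_rate_0[OF U])
  show "((\<lambda>s. 2 * strip_map (curve z1 d x s / curve z2 d x s) * strip_rate z1 z2 x d s
      - of_real (4 / pi\<^sup>2) * (4 * of_real d * s * (1 / z1 - 1 / z2) / (curve z1 d x s - curve z2 d x s)))
      has_field_derivative of_real (x\<^sup>2 - 8 * d) * (2 * strip_map (z1 / z2) * (- (\<i> / of_real pi) * (1 + z1 / z2) / (2 * csqrt (z1 / z2) * (z1 / z2) * z2\<^sup>2))
      - of_real (2 / pi\<^sup>2) / (z1 * z2)) + 2 * of_real d * 0) (at 0)"
  proof (rule DERIV_cong[OF DERIV_diff[OF 3 2]])
    have 4: "2 * (of_real x * a) * (of_real x * a) = - (of_real (2 * x\<^sup>2 / pi\<^sup>2) / (z1 * z2))"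
      using arg_cong[OF sq, of "\<lambda>y. 2 * of_real (x\<^sup>2) * y"] by (simp add: power2_eq_square mult_ac)
    show "2 * (of_real x * a) * (of_real x * a) + of_real (x\<^sup>2 - 8 * d) * b * (2 * strip_map (z1 / z2))
       - of_real (4 / pi\<^sup>2) * - (4 * of_real d / (z1 * z2)) =
      of_real (x\<^sup>2 - 8 * d) * (2 * strip_map (z1 / z2) * (- (\<i> / of_real pi) * (1 + z1 / z2) / (2 * csqrt (z1 / z2) * (z1 / z2) * z2\<^sup>2))
      - of_real (2 / pi\<^sup>2) / (z1 * z2)) + 2 * of_real d * 0"
      unfolding b_def[symmetric] 4 using z by (simp add: field_simps)
  qed
qed

section \<open>One Gaussian step\<close>

text \<open>For r > 4, Cauchy's estimate at radius r / 2 gives a geometric tail. For r <= 4 the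
  value \<open>v\<close> need not be \<open>g 1\<close>, and the four terms are at most 1, 1, 1/2
  and 1/4 times M (4 / r)^3. These add up to 11/4, and 11/4 * 64 = 176.\<close>

lemma taylor2_remainder:
  assumes hol: "g holomorphic_on ball 0 r" and r: "0 < r"
    and bd: "\<And>s. s \<in> ball 0 r \<Longrightarrow> cmod (g s) \<le> M"
    and v: "cmod v \<le> M" "4 < r \<Longrightarrow> v = g 1"
  shows "cmod (v - (g 0 + deriv g 0 + deriv (deriv g) 0 / 2)) \<le> 176 * M / r ^ 3"
proof -
  define a where "a n = (deriv ^^ n) g 0 / fact n" for n
  have M: "0 \<le> M" using v(1) norm_ge_zero order_trans by blast
  have a: "cmod (a n) \<le> M * (2 / r) ^ n" for n
  proof -
    have "cmod ((deriv ^^ n) g 0) \<le> fact n * M / (r / 2) ^ n"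
    proof (rule Cauchy_inequality)
      show "g holomorphic_on ball 0 (r/2)" using r by (intro holomorphic_on_subset[OF hol]) auto
      show "continuous_on (cball 0 (r/2)) g"
        using r by (intro holomorphic_on_imp_continuous_on holomorphic_on_subset[OF hol]) auto
      show "cmod (g x) \<le> M" if "cmod (0 - x) = r / 2" for x
        using that r by (intro bd) auto
    qed (use r in auto)
    then have "cmod ((deriv ^^ n) g 0) / fact n \<le> (fact n * M / (r / 2) ^ n) / fact n"
      by (intro divide_right_mono) auto
    also have "\<dots> = M * (2 / r) ^ n" using r by (simp add: field_simps power_divide)
    finally show ?thesis by (simp add: a_def norm_divide)
  qed
  have s3: "(\<Sum>i<3. a i) = g 0 + deriv g 0 + deriv (deriv g) 0 / 2"
    by (simp add: a_def eval_nat_numeral)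
  show ?thesis
  proof (cases "4 < r")
    case True
    have "(\<lambda>n. a n * (1 - 0) ^ n) sums g 1"
      unfolding a_def using True by (intro holomorphic_power_series[OF hol]) auto
    then have "(\<lambda>n. a (n + 3)) sums (g 1 - (\<Sum>i<3. a i))"
      by (intro sums_split_initial_segment) simp
    then have e: "v - (g 0 + deriv g 0 + deriv (deriv g) 0 / 2) = (\<Sum>n. a (n + 3))"
      using v(2)[OF True] by (simp add: s3 sums_iff)
    have q: "0 \<le> 2 / r" "2 / r \<le> 1 / 2" "2 / r < 1" using True by (auto simp: field_simps)
    have sg: "(\<lambda>n. M * (2 / r) ^ 3 * (2 / r) ^ n) sums (M * (2 / r) ^ 3 * (1 / (1 - 2 / r)))"
      using q by (intro sums_mult geometric_sums) auto
    have "cmod (\<Sum>n. a (n + 3)) \<le> (\<Sum>n. M * (2 / r) ^ 3 * (2 / r) ^ n)"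
    proof (rule norm_suminf_le)
      show "cmod (a (n + 3)) \<le> M * (2 / r) ^ 3 * (2 / r) ^ n" for n
        using a[of "n + 3"] by (simp add: power_add mult_ac)
    qed (use sg in \<open>auto simp: sums_iff\<close>)
    also have "\<dots> = M * (2 / r) ^ 3 * (1 / (1 - 2 / r))" using sg by (simp add: sums_iff)
    also have "\<dots> \<le> M * (2 / r) ^ 3 * 2"
    proof (intro mult_left_mono)
      have "1 / (1 - 2 / r) \<le> 1 / (1 / 2)" using q by (intro divide_left_mono) auto
      then show "1 / (1 - 2 / r) \<le> 2" by simp
    qed (use M q in auto)
    also have "\<dots> = 16 * M / r ^ 3" by (simp add: power_divide)
    also have "\<dots> \<le> 176 * M / r ^ 3" using M r by (intro divide_right_mono) auto
    finally show ?thesis unfolding e .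
  next
    case False
    define q where "q = 4 / r"
    have q: "1 \<le> q" using False r by (simp add: q_def field_simps)
    have qq: "q \<le> q ^ 3" "q ^ 2 \<le> q ^ 3" "1 \<le> q ^ 3"
      using q power_increasing[of 1 3 q] power_increasing[of 2 3 q] one_le_power[of q 3] by auto
    have "cmod (a 0) \<le> M * q ^ 3" using a[of 0] mult_left_mono[OF qq(3) M] by simp
    moreover have "cmod (a 1) \<le> M * q ^ 3 / 2"
    proof -
      have "cmod (a 1) \<le> M * q / 2" using a[of 1] by (simp add: q_def mult.commute)
      then show ?thesis using mult_left_mono[OF qq(1) M] by simp
    qed
    moreover have "cmod (a 2) \<le> M * q ^ 3 / 4"
    proof -
      have "cmod (a 2) \<le> M * q ^ 2 / 4" using a[of 2] by (simp add: q_def power_divide mult.commute)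
      then show ?thesis using mult_left_mono[OF qq(2) M] by simp
    qed
    moreover have "cmod v \<le> M * q ^ 3" using v(1) mult_left_mono[OF qq(3) M] by simp
    moreover have "cmod (v - (\<Sum>i<3. a i)) \<le> cmod v + (cmod (a 0) + cmod (a 1) + cmod (a 2))"
      by (simp add: eval_nat_numeral)
        (intro order_trans[OF norm_triangle_ineq4] add_left_mono order_trans[OF norm_triangle_ineq] add_right_mono order_refl)
    ultimately have "cmod (v - (\<Sum>i<3. a i)) \<le> 11 / 4 * (M * q ^ 3)" by linarith
    also have "\<dots> = 176 * M / r ^ 3" by (simp add: q_def power_divide)
    finally show ?thesis unfolding s3 .
  qed
qed

text \<open>One bound for all increments, large ones included: the radius of holomorphy is taken
  inversely proportional to |x| + sqrt d, so that the curves stay within \<open>h\<close>. The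
  indicator keeps the value bounded by \<open>M\<close> when the step leaves \<open>N\<close>, which
  happens only for a radius of at most 1.\<close>

lemma test_function_taylor:
  assumes f: "test_function U f l" and U: "open U" and N: "cball (z1, z2) h \<subseteq> N" "N \<subseteq> U" and h: "0 < h"
    and M: "\<And>y. y \<in> N \<Longrightarrow> cmod (f y) \<le> M" and e: "0 < e" "e \<le> cmod z1" "e \<le> cmod z2"
  obtains A B where "\<And>x d. 0 < d \<Longrightarrow>
    cmod (indicator N (curve z1 d x 1, curve z2 d x 1) *\<^sub>R f (curve z1 d x 1, curve z2 d x 1)
      - (f (z1, z2) + of_real x * A + (of_real (x\<^sup>2 - 8 * d) * B + 2 * of_real d * l) / 2))
    \<le> 176 * M / (min (e/2) (h/4)) ^ 3 * (\<bar>x\<bar> + sqrt d) ^ 3"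
proof -
  have zN: "(z1, z2) \<in> N" using N h by auto
  then obtain A B where AB: "\<And>x d. \<exists>k. derivs_along U f l z1 z2 A B x d k" using f N(2) unfolding test_function_def by blast
  \<comment> \<open>On the disc |s| |x| <= q and d |s|^2 <= q^2, so each coordinate moves by at most
    q + 2 q^2 / e <= 2 q <= h / 2.\<close>
  define q where "q = min (e/2) (h/4)"
  have q: "0 < q" "q \<le> e/2" "q \<le> h/4" using e h by (auto simp: q_def)
  have M0: "0 \<le> M" using M[OF zN] norm_ge_zero order_trans by blast
  show ?thesis
  proof (rule that[of A B], fold q_def)
    fix x d :: real assume d: "0 < d"
    obtain k where k: "\<And>s. (curve z1 d x s, curve z2 d x s) \<in> U \<Longrightarrow>
        ((\<lambda>s. f (curve z1 d x s, curve z2 d x s)) has_field_derivative k s) (at s)"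
     "k 0 = of_real x * A" "(k has_field_derivative of_real (x\<^sup>2 - 8 * d) * B + 2 * of_real d * l) (at 0)"
      using AB[of x d] unfolding derivs_along_def by blast
    define r where "r = q / (\<bar>x\<bar> + sqrt d)"
    have p: "0 < \<bar>x\<bar> + sqrt d" using d by (simp add: add_nonneg_pos)
    have r: "0 < r" using q p by (simp add: r_def)
    let ?c = "\<lambda>s. (curve z1 d x s, curve z2 d x s)"
    have near: "cmod (curve z d x s - z) \<le> h / 2" if s: "s \<in> ball 0 r" and z: "e \<le> cmod z" for s z
    proof -
      have sr: "cmod s \<le> r" using s by auto
      have rp: "r * (\<bar>x\<bar> + sqrt d) = q" using p by (simp add: r_def)
      have "cmod s * \<bar>x\<bar> \<le> r * (\<bar>x\<bar> + sqrt d)" using sr r d by (intro mult_mono) auto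
      then have 1: "cmod s * \<bar>x\<bar> \<le> q" using rp by simp
      have "cmod s * sqrt d \<le> r * (\<bar>x\<bar> + sqrt d)" using sr r d by (intro mult_mono) auto
      then have 2: "cmod s * sqrt d \<le> q" using rp by simp
      have "d * (cmod s)\<^sup>2 = (cmod s * sqrt d)\<^sup>2" using d by (simp add: power_mult_distrib)
      also have "\<dots> \<le> q\<^sup>2" using 2 d by (intro power_mono) auto
      finally have 3: "2 * d * (cmod s)\<^sup>2 / cmod z \<le> 2 * q\<^sup>2 / e"
        using z e q by (intro frac_le) auto
      have "2 * q\<^sup>2 / e \<le> q" using q e by (simp add: power2_eq_square field_simps mult_left_mono)
      have "curve z d x s - z = 2 * of_real d * s\<^sup>2 / z - s * of_real x" by (simp add: curve_def)
      also have "cmod \<dots> \<le> cmod (2 * of_real d * s\<^sup>2 / z) + cmod (s * of_real x)" by (rule norm_triangle_ineq4)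
      also have "\<dots> = 2 * d * (cmod s)\<^sup>2 / cmod z + cmod s * \<bar>x\<bar>" using d by (simp add: norm_divide norm_mult norm_power)
      also have "\<dots> \<le> q + q" using 1 3 \<open>2 * q\<^sup>2 / e \<le> q\<close> by linarith
      finally show ?thesis using q by linarith
    qed
    have inN: "?c s \<in> N" if "s \<in> ball 0 r" for s
    proof -
      have "dist (z1, z2) (?c s) \<le> dist z1 (curve z1 d x s) + dist z2 (curve z2 d x s)"
        by (simp add: dist_Pair_Pair sqrt_sum_squares_le_sum)
      also have "\<dots> \<le> h / 2 + h / 2"
        using near[OF that e(2)] near[OF that e(3)] by (intro add_mono) (auto simp: dist_norm norm_minus_commute)
      finally show ?thesis using N(1) by auto
    qed
    define g where "g s = f (?c s)" for s
    have dg: "(g has_field_derivative k s) (at s)" if "s \<in> ball 0 r" for s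
      unfolding g_def[abs_def] using inN[OF that] N(2) by (intro k(1)) auto
    have hol: "g holomorphic_on ball 0 r"
      unfolding holomorphic_on_open[OF open_ball] using dg by blast
    have "deriv g 0 = k 0" using dg[of 0] r by (intro DERIV_imp_deriv) auto
    moreover have "deriv (deriv g) 0 = of_real (x\<^sup>2 - 8 * d) * B + 2 * of_real d * l"
    proof (intro DERIV_imp_deriv)
      show "(deriv g has_field_derivative of_real (x\<^sup>2 - 8 * d) * B + 2 * of_real d * l) (at 0)"
      proof (rule has_field_derivative_transform_within_open[OF k(3) open_ball])
        show "k s = deriv g s" if "s \<in> ball 0 r" for s using DERIV_imp_deriv[OF dg[OF that]] by simp
      qed (use r in auto)
    qed
    moreover have "cmod (indicator N (?c 1) *\<^sub>R f (?c 1) - (g 0 + deriv g 0 + deriv (deriv g) 0 / 2)) \<le> 176 * M / r ^ 3"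
    proof (rule taylor2_remainder[OF hol r])
      show "cmod (g s) \<le> M" if "s \<in> ball 0 r" for s unfolding g_def by (intro M inN that)
      show "cmod (indicator N (?c 1) *\<^sub>R f (?c 1)) \<le> M" using M M0 by (auto simp: indicator_def)
      show "indicator N (?c 1) *\<^sub>R f (?c 1) = g 1" if "4 < r" using inN[of 1] that by (simp add: g_def)
    qed
    moreover have "176 * M / r ^ 3 = 176 * M / q ^ 3 * (\<bar>x\<bar> + sqrt d) ^ 3"
      using q p by (simp add: r_def power_divide)
    ultimately show "cmod (indicator N (?c 1) *\<^sub>R f (?c 1)
      - (f (z1, z2) + of_real x * A + (of_real (x\<^sup>2 - 8 * d) * B + 2 * of_real d * l) / 2)) \<le> 176 * M / q ^ 3 * (\<bar>x\<bar> + sqrt d) ^ 3"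
      using k(2) by (simp add: g_def)
  qed
qed

section \<open>Gaussian averages of one step\<close>

definition std_gauss :: "real measure" where
  "std_gauss = density lborel (\<lambda>x. ennreal (std_normal_density x))"

lemma sets_std_gauss [simp, measurable_cong]: "sets std_gauss = sets borel" by (simp add: std_gauss_def)
lemma space_std_gauss [simp]: "space std_gauss = UNIV" by (simp add: std_gauss_def)

lemma prob_space_std_gauss: "prob_space std_gauss"
  unfolding std_gauss_def by (intro prob_space_normal_density) simp

interpretation std_gauss: prob_space std_gauss by (rule prob_space_std_gauss)

lemma std_gauss_moments:
  "integrable std_gauss (\<lambda>x. x)" "integral\<^sup>L std_gauss (\<lambda>x. x) = 0"
  "integrable std_gauss (\<lambda>x. x\<^sup>2)" "integral\<^sup>L std_gauss (\<lambda>x. x\<^sup>2) = 1"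
  "integrable std_gauss (\<lambda>x. \<bar>x\<bar> ^ 3)"
proof -
  have 1: "has_bochner_integral lborel (\<lambda>x. std_normal_density x * x) 0"
    using normal_moment_nz_1[of 1 0] by simp
  have 2: "has_bochner_integral lborel (\<lambda>x. std_normal_density x * x\<^sup>2) 1"
    using normal_moment_even[of 1 0 1] by (simp add: fact_numeral)
  have 3: "integrable lborel (\<lambda>x. std_normal_density x * \<bar>x\<bar> ^ 3)"
    using normal_moment_abs_odd[of 1 0 1] by (auto simp: has_bochner_integral_iff eval_nat_numeral)
  show "integrable std_gauss (\<lambda>x. x)" "integral\<^sup>L std_gauss (\<lambda>x. x) = 0"
    using 1 unfolding std_gauss_def has_bochner_integral_iff
    by (simp_all add: integrable_density integral_density)
  show "integrable std_gauss (\<lambda>x. x\<^sup>2)" "integral\<^sup>L std_gauss (\<lambda>x. x\<^sup>2) = 1"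
    using 2 unfolding std_gauss_def has_bochner_integral_iff
    by (simp_all add: integrable_density integral_density)
  show "integrable std_gauss (\<lambda>x. \<bar>x\<bar> ^ 3)"
    using 3 unfolding std_gauss_def by (simp add: integrable_density)
qed

text \<open>The argument \<open>x\<close> is standardised: \<open>sqrt (8 * d) * x\<close> then has
  the law of a driving increment over time \<open>d\<close>.\<close>

definition step :: "real \<Rightarrow> complex \<times> complex \<Rightarrow> real \<Rightarrow> complex \<times> complex" where
  "step d y x = (curve (fst y) d (sqrt (8 * d) * x) 1, curve (snd y) d (sqrt (8 * d) * x) 1)"

lemma borel_measurable_step [measurable]:
  assumes [measurable]: "f \<in> borel_measurable M" "g \<in> borel_measurable M"
  shows "(\<lambda>\<omega>. step d (f \<omega>) (g \<omega>)) \<in> borel_measurable M"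
proof -
  have "fst \<in> borel_measurable (borel :: (complex \<times> complex) measure)"
    "snd \<in> borel_measurable (borel :: (complex \<times> complex) measure)"
    by (auto intro!: borel_measurable_continuous_onI continuous_intros)
  then have [measurable]: "(\<lambda>\<omega>. fst (f \<omega>)) \<in> borel_measurable M" "(\<lambda>\<omega>. snd (f \<omega>)) \<in> borel_measurable M"
    using measurable_compose[OF assms(1)] by auto
  have "(\<lambda>\<omega>. step d (f \<omega>) (g \<omega>)) \<in> measurable M (borel \<Otimes>\<^sub>M borel)"
    unfolding step_def curve_def by (intro measurable_Pair; measurable)
  then show ?thesis by (simp add: borel_prod)
qed

text \<open>The first-order term and the term in x^2 - 8 d have Gaussian mean 0, leaving f + d l.
  The remainder (|x| + sqrt d)^3, with x of size sqrt d, integrates to a multiple of d^(3/2). The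
  constant is uniform over \<open>K\<close> because \<open>e\<close>, \<open>h\<close> and
  \<open>M\<close> are.\<close>

lemma step_estimate:
  assumes f: "test_function U f l" and U: "open U" and N: "(\<Union>y\<in>K. cball y h) \<subseteq> N" "N \<subseteq> U" and h: "0 < h"
    and M: "\<And>y. y \<in> N \<Longrightarrow> cmod (f y) \<le> M" and e: "0 < e" "\<And>y. y \<in> K \<Longrightarrow> e \<le> cmod (fst y) \<and> e \<le> cmod (snd y)"
    and Nb: "N \<in> sets borel"
  shows "\<exists>C\<ge>0. \<forall>d>0. \<forall>y\<in>K. cmod ((\<integral>x. indicator N (step d y x) *\<^sub>R f (step d y x) \<partial>std_gauss) - f y - of_real d * l) \<le> C * (d * sqrt d)"
proof (cases "K = {}")
  case True then show ?thesis by (intro exI[of _ 0]) auto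
next
  case False
  define Q where "Q = 176 * M / (min (e/2) (h/4)) ^ 3"
  have M0: "0 \<le> M"
  proof -
    obtain y where "y \<in> K" using False by auto
    then have "y \<in> N" using N(1) h by force
    then show ?thesis using M[of y] norm_ge_zero order_trans by blast
  qed
  have Q: "0 \<le> Q" using M0 e h by (simp add: Q_def)
  have int3: "integrable std_gauss (\<lambda>x. 8 * ((sqrt 8) ^ 3 * \<bar>x\<bar> ^ 3 + 1))"
    using std_gauss_moments(5) by simp
  define C where "C = Q * (\<integral>x. 8 * ((sqrt 8) ^ 3 * \<bar>x\<bar> ^ 3 + 1) \<partial>std_gauss)"
  have "C \<ge> 0" unfolding C_def using Q by (intro mult_nonneg_nonneg integral_nonneg) auto
  moreover have "cmod ((\<integral>x. indicator N (step d y x) *\<^sub>R f (step d y x) \<partial>std_gauss) - f y - of_real d * l) \<le> C * (d * sqrt d)"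
    if d: "0 < d" and y: "y \<in> K" for d y
  proof -
    obtain z1 z2 where yz: "y = (z1, z2)" by (cases y)
    have cb: "cball (z1, z2) h \<subseteq> N" using N(1) y yz by blast
    obtain A B where AB: "\<And>x d. 0 < d \<Longrightarrow>
      cmod (indicator N (curve z1 d x 1, curve z2 d x 1) *\<^sub>R f (curve z1 d x 1, curve z2 d x 1)
      - (f (z1, z2) + of_real x * A + (of_real (x\<^sup>2 - 8 * d) * B + 2 * of_real d * l) / 2))
      \<le> Q * (\<bar>x\<bar> + sqrt d) ^ 3"
      unfolding Q_def using test_function_taylor[OF f U cb N(2) h M e(1), where ?thesis=thesis] e(2)[OF y] yz
      by (metis fst_conv snd_conv)
    define P where "P x = f y + of_real (sqrt (8 * d) * x) * A + (of_real ((sqrt (8 * d) * x)\<^sup>2 - 8 * d) * B + 2 * of_real d * l) / 2" for x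
    define F where "F x = indicator N (step d y x) *\<^sub>R f (step d y x)" for x
    have Feq: "F x = (\<lambda>y. indicator N y *\<^sub>R f y) (step d y x)" for x by (simp add: F_def)
    have cf: "continuous_on N f" using f N(2) by (auto simp: test_function_def intro: continuous_on_subset)
    have mf: "(\<lambda>y. indicator N y *\<^sub>R f y) \<in> borel_measurable borel"
      by (rule borel_measurable_continuous_on_indicator[OF Nb cf])
    have mF: "F \<in> borel_measurable std_gauss"
      unfolding Feq by (rule measurable_compose[OF _ mf]) measurable
    have Fb: "cmod (F x) \<le> M" for x unfolding F_def using M M0 by (auto simp: indicator_def)
    have iF: "integrable std_gauss F" by (rule std_gauss.integrable_const_bound[OF _ mF, of M]) (use Fb in auto)
    have iP: "integrable std_gauss P" and eP: "integral\<^sup>L std_gauss P = f y + of_real d * l"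
    proof -
      have P': "P = (\<lambda>x. (f y + of_real d * l) + (x *\<^sub>R (of_real (sqrt (8 * d)) * A) + (x\<^sup>2 - 1) *\<^sub>R (4 * of_real d * B)))"
        using d by (auto simp: P_def fun_eq_iff power_mult_distrib scaleR_conv_of_real field_simps)
      have i1: "integrable std_gauss (\<lambda>x. x *\<^sub>R (of_real (sqrt (8 * d)) * A))"
        by (intro integrable_scaleR_left) (use std_gauss_moments in auto)
      have i2: "integrable std_gauss (\<lambda>x. (x\<^sup>2 - 1) *\<^sub>R (4 * of_real d * B))"
        by (intro integrable_scaleR_left Bochner_Integration.integrable_diff) (use std_gauss_moments in auto)
      show "integrable std_gauss P" unfolding P' by (intro Bochner_Integration.integrable_add i1 i2) auto
      have "integral\<^sup>L std_gauss P = (f y + of_real d * l) + (integral\<^sup>L std_gauss (\<lambda>x. x *\<^sub>R (of_real (sqrt (8 * d)) * A))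
         + integral\<^sup>L std_gauss (\<lambda>x. (x\<^sup>2 - 1) *\<^sub>R (4 * of_real d * B)))"
        unfolding P' using i1 i2 by (subst Bochner_Integration.integral_add; simp add: std_gauss.prob_space[unfolded space_std_gauss])
      also have "integral\<^sup>L std_gauss (\<lambda>x. x *\<^sub>R (of_real (sqrt (8 * d)) * A)) = 0"
        using std_gauss_moments by (subst integral_scaleR_left) auto
      also have "integral\<^sup>L std_gauss (\<lambda>x. (x\<^sup>2 - 1) *\<^sub>R (4 * of_real d * B)) = (\<integral>x. x\<^sup>2 - 1 \<partial>std_gauss) *\<^sub>R (4 * of_real d * B)"
        using Bochner_Integration.integrable_diff[OF std_gauss_moments(3), of "\<lambda>_. 1"]
        by - (rule integral_scaleR_left, simp)
      also have "(\<integral>x. x\<^sup>2 - 1 \<partial>std_gauss) = 0"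
        using Bochner_Integration.integral_diff[OF std_gauss_moments(3), of "\<lambda>_. 1"]
        by (simp add: std_gauss_moments(4) std_gauss.prob_space[unfolded space_std_gauss])
      finally show "integral\<^sup>L std_gauss P = f y + of_real d * l" by simp
    qed
    have pw: "cmod (F x - P x) \<le> Q * (d * sqrt d) * (8 * ((sqrt 8) ^ 3 * \<bar>x\<bar> ^ 3 + 1))" for x
    proof -
      have cube: "(a + 1) ^ 3 \<le> 8 * (a ^ 3 + 1)" if "0 \<le> a" for a :: real
      proof -
        have "(a + 1) ^ 3 \<le> (2 * max a 1) ^ 3" using that by (intro power_mono) auto
        also have "\<dots> = 8 * (max a 1) ^ 3" by (simp add: power_mult_distrib)
        also have "(max a 1) ^ 3 \<le> a ^ 3 + 1" using that by (simp add: max_def)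
        finally show ?thesis by simp
      qed
      have "cmod (F x - P x) \<le> Q * (\<bar>sqrt (8 * d) * x\<bar> + sqrt d) ^ 3"
        using AB[OF d, of "sqrt (8 * d) * x"] by (simp add: F_def P_def step_def yz)
      also have "\<bar>sqrt (8 * d) * x\<bar> + sqrt d = sqrt d * (sqrt 8 * \<bar>x\<bar> + 1)"
        using d by (simp add: real_sqrt_mult abs_mult algebra_simps)
      also have "Q * (sqrt d * (sqrt 8 * \<bar>x\<bar> + 1)) ^ 3 = Q * (d * sqrt d) * (sqrt 8 * \<bar>x\<bar> + 1) ^ 3"
        using d by (simp add: power_mult_distrib power3_eq_cube)
      also have "\<dots> \<le> Q * (d * sqrt d) * (8 * ((sqrt 8 * \<bar>x\<bar>) ^ 3 + 1))"
        using Q d by (intro mult_left_mono cube) auto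
      finally show ?thesis by (simp add: power_mult_distrib)
    qed
    have "cmod (integral\<^sup>L std_gauss F - integral\<^sup>L std_gauss P) = cmod (\<integral>x. F x - P x \<partial>std_gauss)"
      using iF iP by simp
    also have "\<dots> \<le> (\<integral>x. Q * (d * sqrt d) * (8 * ((sqrt 8) ^ 3 * \<bar>x\<bar> ^ 3 + 1)) \<partial>std_gauss)"
      using int3 iF iP pw by (intro Bochner_Integration.integral_norm_bound_integral) auto
    also have "\<dots> = C * (d * sqrt d)" unfolding C_def by (subst integral_mult_right_zero) (simp add: mult_ac)
    finally show ?thesis unfolding eP by (simp add: F_def[abs_def] diff_diff_eq)
  qed
  ultimately show ?thesis by blast
qed

section \<open>The stopped Euler chain\<close>

text \<open>Conditioning on the past by Fubini: the joint law of independent variables is a product,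
  so the new increment is integrated out with the past frozen.\<close>

lemma (in prob_space) indep_expectation:
  fixes f :: "'b :: second_countable_topology \<times> real \<Rightarrow> complex"
  assumes ind: "indep_var MA A MB B" and S: "S \<in> borel_measurable MA" and Y: "Y \<in> borel_measurable MB"
    and \<nu>: "distr M borel (\<lambda>\<omega>. Y (B \<omega>)) = \<nu>"
    and f: "f \<in> borel_measurable (borel \<Otimes>\<^sub>M borel)" and C: "\<And>y. cmod (f y) \<le> C"
  shows "expectation (\<lambda>\<omega>. f (S (A \<omega>), Y (B \<omega>))) = expectation (\<lambda>\<omega>. \<integral>x. f (S (A \<omega>), x) \<partial>\<nu>)"
    and "(\<lambda>y. \<integral>x. f (y, x) \<partial>\<nu>) \<in> borel_measurable borel"
proof -
  note [measurable] = S Y f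
  have A [measurable]: "A \<in> measurable M MA" and B [measurable]: "B \<in> measurable M MB"
    using ind by (auto dest: indep_var_rv1 indep_var_rv2)
  have joint: "distr M MA A \<Otimes>\<^sub>M distr M MB B = distr M (MA \<Otimes>\<^sub>M MB) (\<lambda>\<omega>. (A \<omega>, B \<omega>))"
    using ind unfolding indep_var_distribution_eq by simp
  interpret D1: prob_space "distr M MA A" by (rule prob_space_distr) measurable
  interpret D2: prob_space "distr M MB B" by (rule prob_space_distr) measurable
  interpret D3: prob_space \<nu> unfolding \<nu>[symmetric] by (rule prob_space_distr) measurable
  interpret P: pair_prob_space "distr M MA A" "distr M MB B" ..
  have s\<nu>: "sets \<nu> = sets borel" unfolding \<nu>[symmetric] by simp
  define g where "g q = f (S (fst q), Y (snd q))" for q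
  have gm: "g \<in> borel_measurable (MA \<Otimes>\<^sub>M MB)" unfolding g_def by measurable
  then have gm': "g \<in> borel_measurable (distr M MA A \<Otimes>\<^sub>M distr M MB B)"
    by (simp cong: measurable_cong_sets sets_pair_measure_cong)
  have i: "integrable (distr M MA A \<Otimes>\<^sub>M distr M MB B) g"
    by (rule P.P.integrable_const_bound[of _ C]) (use C gm' in \<open>auto simp: g_def\<close>)
  have f2: "f \<in> borel_measurable (borel \<Otimes>\<^sub>M \<nu>)"
    using f by (simp add: s\<nu> cong: measurable_cong_sets sets_pair_measure_cong)
  show m: "(\<lambda>y. \<integral>x. f (y, x) \<partial>\<nu>) \<in> borel_measurable borel"
    by (rule D3.borel_measurable_lebesgue_integral) (use f2 in \<open>simp add: case_prod_beta'\<close>)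
  have inner: "(\<integral>b. g (a, b) \<partial>distr M MB B) = (\<integral>x. f (S a, x) \<partial>\<nu>)" for a
  proof -
    have "\<nu> = distr (distr M MB B) borel Y"
      by (subst distr_distr) (auto simp: \<nu>[symmetric] o_def)
    then have "(\<integral>x. f (S a, x) \<partial>\<nu>) = (\<integral>x. f (S a, x) \<partial>distr (distr M MB B) borel Y)" by simp
    also have "\<dots> = (\<integral>b. f (S a, Y b) \<partial>distr M MB B)" by (rule integral_distr) measurable
    finally show ?thesis by (simp add: g_def)
  qed
  have "expectation (\<lambda>\<omega>. f (S (A \<omega>), Y (B \<omega>))) = expectation (\<lambda>\<omega>. g (A \<omega>, B \<omega>))" by (simp add: g_def)
  also have "\<dots> = integral\<^sup>L (distr M (MA \<Otimes>\<^sub>M MB) (\<lambda>\<omega>. (A \<omega>, B \<omega>))) g"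
    by (rule integral_distr[symmetric]) (use gm in measurable)
  also have "\<dots> = integral\<^sup>L (distr M MA A \<Otimes>\<^sub>M distr M MB B) g" unfolding joint ..
  also have "\<dots> = (\<integral>a. (\<integral>b. g (a, b) \<partial>distr M MB B) \<partial>distr M MA A)" by (rule P.integral_fst'[OF i, symmetric])
  also have "\<dots> = (\<integral>a. (\<integral>x. f (S a, x) \<partial>\<nu>) \<partial>distr M MA A)" unfolding inner ..
  also have "\<dots> = expectation (\<lambda>\<omega>. \<integral>x. f (S (A \<omega>), x) \<partial>\<nu>)"
    by (rule integral_distr[OF A]) (rule measurable_compose[OF S m])
  finally show "expectation (\<lambda>\<omega>. f (S (A \<omega>), Y (B \<omega>))) = expectation (\<lambda>\<omega>. \<integral>x. f (S (A \<omega>), x) \<partial>\<nu>)" .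
qed

text \<open>Freezing outside \<open>K\<close> encodes the stopping time: the final value is the exit
  position, or the current one if no exit has occurred.\<close>

primrec chain :: "(complex \<times> complex) set \<Rightarrow> real \<Rightarrow> complex \<times> complex \<Rightarrow> (nat \<Rightarrow> real) \<Rightarrow> nat \<Rightarrow> complex \<times> complex" where
  "chain K d y x 0 = y"
| "chain K d y x (Suc k) = (if chain K d y x k \<in> K then step d (chain K d y x k) (x k) else chain K d y x k)"

lemma chain_restrict: "k \<le> n \<Longrightarrow> chain K d y (restrict x {..<n}) k = chain K d y x k"
  by (induction k) auto

lemma measurable_chain:
  assumes [measurable]: "K \<in> sets borel" and x: "\<And>i. i < k \<Longrightarrow> (\<lambda>\<omega>. x \<omega> i) \<in> borel_measurable M"
  shows "(\<lambda>\<omega>. chain K d y (x \<omega>) k) \<in> borel_measurable M"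
  using x
proof (induction k)
  case (Suc k)
  have [measurable]: "(\<lambda>\<omega>. chain K d y (x \<omega>) k) \<in> borel_measurable M" "(\<lambda>\<omega>. x \<omega> k) \<in> borel_measurable M"
    using Suc by auto
  show ?case unfolding chain.simps by measurable
qed simp

lemma (in prob_space) chain_indep_expectation:
  fixes f :: "(complex \<times> complex) \<times> real \<Rightarrow> complex" and X :: "nat \<Rightarrow> 'a \<Rightarrow> real"
  assumes K: "K \<in> sets borel" and ind: "indep_vars (\<lambda>_. borel) X {..<n}" and k: "k < n"
    and \<nu>: "distr M borel (X k) = \<nu>"
    and f: "f \<in> borel_measurable (borel \<Otimes>\<^sub>M borel)" and C: "\<And>y. cmod (f y) \<le> C"
  shows "expectation (\<lambda>\<omega>. f (chain K d y (\<lambda>i. X i \<omega>) k, X k \<omega>))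
      = expectation (\<lambda>\<omega>. \<integral>x. f (chain K d y (\<lambda>i. X i \<omega>) k, x) \<partial>\<nu>)"
    and "(\<lambda>y. \<integral>x. f (y, x) \<partial>\<nu>) \<in> borel_measurable borel"
proof -
  have i: "indep_var (PiM {..<k} (\<lambda>_. borel)) (\<lambda>\<omega>. restrict (\<lambda>i. X i \<omega>) {..<k}) (PiM {k} (\<lambda>_. borel)) (\<lambda>\<omega>. restrict (\<lambda>i. X i \<omega>) {k})"
    by (rule indep_var_restrict[OF ind]) (use k in auto)
  have 1: "(\<lambda>x. chain K d y x k) \<in> borel_measurable (PiM {..<k} (\<lambda>_. borel))"
    by (rule measurable_chain[OF K]) (simp add: measurable_component_singleton)
  have 2: "(\<lambda>x. x k) \<in> borel_measurable (PiM {k} (\<lambda>_. borel))"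
    by (rule measurable_component_singleton) simp
  have 3: "distr M borel (\<lambda>\<omega>. restrict (\<lambda>i. X i \<omega>) {k} k) = \<nu>" using \<nu> by simp
  note ie = indep_expectation[where S="\<lambda>x. chain K d y x k" and Y="\<lambda>x. x k" and f=f and C=C and \<nu>=\<nu>, OF i 1 2 3 f C]
  show "expectation (\<lambda>\<omega>. f (chain K d y (\<lambda>i. X i \<omega>) k, X k \<omega>))
      = expectation (\<lambda>\<omega>. \<integral>x. f (chain K d y (\<lambda>i. X i \<omega>) k, x) \<partial>\<nu>)"
    using ie(1) by (simp add: chain_restrict)
  show "(\<lambda>y. \<integral>x. f (y, x) \<partial>\<nu>) \<in> borel_measurable borel" by (rule ie(2))
qed

text \<open>A discrete Dynkin formula by telescoping. A frozen chain contributes no increment, so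
  the one-step estimate is needed on \<open>K\<close> only, and the compensator counts the expected
  number of steps taken from \<open>K\<close>.\<close>

lemma (in prob_space) chain_expectation:
  assumes K: "K \<in> sets borel" and ind: "indep_vars (\<lambda>_. borel) X {..<n}"
    and dist: "\<And>i. i < n \<Longrightarrow> distributed M lborel (X i) std_normal_density"
    and p: "p \<in> borel_measurable borel" "\<And>y. cmod (p y) \<le> C"
    and est: "\<And>y. y \<in> K \<Longrightarrow> cmod ((\<integral>x. p (step d y x) \<partial>std_gauss) - p y - a) \<le> c"
    and c0: "0 \<le> c"
  shows "cmod (expectation (\<lambda>\<omega>. p (chain K d y (\<lambda>i. X i \<omega>) n)) - p y
    - a * of_real (\<Sum>k<n. prob {\<omega>\<in>space M. chain K d y (\<lambda>i. X i \<omega>) k \<in> K})) \<le> real n * c"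
proof (cases "n = 0")
  case True then show ?thesis by (simp add: prob_space)
next
  case False
  let ?S = "\<lambda>k \<omega>. chain K d y (\<lambda>i. X i \<omega>) k"
  have Xm: "X i \<in> borel_measurable M" if "i < n" for i
    using ind that by (auto simp: indep_vars_def)
  have Sm [measurable]: "?S k \<in> borel_measurable M" if "k \<le> n" for k
    using that by (intro measurable_chain K Xm) auto
  have Km [measurable]: "{\<omega>\<in>space M. ?S k \<omega> \<in> K} \<in> sets M" if "k \<le> n" for k
    using measurable_sets[OF Sm[OF that] K] by (simp add: vimage_def Int_def conj_commute)
  note [measurable] = K p(1)
  have pS: "integrable M (\<lambda>\<omega>. p (?S k \<omega>))" if "k \<le> n" for k
    by (rule integrable_const_bound[of _ C]) (use p(2) measurable_compose[OF Sm[OF that] p(1)] in auto)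
  have C0: "0 \<le> C" using p(2) norm_ge_zero order_trans by blast
  have stepk: "cmod (expectation (\<lambda>\<omega>. p (?S (Suc k) \<omega>)) - expectation (\<lambda>\<omega>. p (?S k \<omega>))
     - a * of_real (prob {\<omega>\<in>space M. ?S k \<omega> \<in> K})) \<le> c" if k: "k < n" for k
  proof -
    define G where "G q = (if fst q \<in> K then p (step d (fst q) (snd q)) - p (fst q) else 0)" for q
    have Gm: "G \<in> borel_measurable (borel \<Otimes>\<^sub>M borel)" unfolding G_def by measurable
    have "cmod (G q) \<le> C + C" for q
      unfolding G_def using C0 order_trans[OF norm_triangle_ineq4 add_mono[OF p(2) p(2)]] by auto
    note GC = this
    have dX: "distr M borel (X k) = std_gauss"
    proof -
      have "distr M borel (X k) = distr M lborel (X k)" by (rule distr_cong) auto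
      also have "\<dots> = std_gauss" using distributed_distr_eq_density[OF dist[OF k]] by (simp add: std_gauss_def)
      finally show ?thesis .
    qed
    note ie1 = chain_indep_expectation(1)[where d=d and y=y, OF K ind k dX Gm GC]
    note ie2 = chain_indep_expectation(2)[OF K ind k dX Gm GC]
    define H where "H q = (\<integral>x. G (q, x) \<partial>std_gauss)" for q
    have Hm: "H \<in> borel_measurable borel" unfolding H_def by (rule ie2)
    have pm: "(\<lambda>x. p (step d q x)) \<in> borel_measurable std_gauss" for q by measurable
    have pi: "integrable std_gauss (\<lambda>x. p (step d q x))" for q
      by (rule std_gauss.integrable_const_bound[of _ C]) (use p(2) pm in auto)
    have HK: "H q = (\<integral>x. p (step d q x) \<partial>std_gauss) - p q" if "q \<in> K" for q
      using that pi[of q] by (simp add: H_def G_def std_gauss.prob_space[unfolded space_std_gauss])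
    have HnK: "H q = 0" if "q \<notin> K" for q using that by (simp add: H_def G_def)
    have Hb: "cmod (H q - a * indicator K q) \<le> c * indicator K q" for q
      using est[of q] by (auto simp: HK HnK indicator_def)
    have iI: "integrable M (\<lambda>\<omega>. indicator K (?S k \<omega>) :: real)"
      using k by (intro integrable_const_bound[of _ 1]) (auto simp: indicator_def intro!: Km)
    have Hint: "integrable M (\<lambda>\<omega>. H (?S k \<omega>))"
    proof (rule integrable_const_bound[of _ "cmod a + \<bar>c\<bar>"])
      have "cmod (H q) \<le> cmod a + \<bar>c\<bar>" for q
        using HK[of q] HnK[of q] Hb[of q] norm_triangle_ineq2[of "H q" "a * indicator K q"]
        by (cases "q \<in> K") auto
      then show "AE \<omega> in M. cmod (H (?S k \<omega>)) \<le> cmod a + \<bar>c\<bar>" by simp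
    qed (use measurable_compose[OF Sm Hm] k in auto)
    have eI: "expectation (\<lambda>\<omega>. indicator K (?S k \<omega>) :: real) = prob {\<omega>\<in>space M. ?S k \<omega> \<in> K}"
    proof -
      have "expectation (\<lambda>\<omega>. indicator K (?S k \<omega>) :: real) = expectation (indicator {\<omega>\<in>space M. ?S k \<omega> \<in> K})"
        by (rule Bochner_Integration.integral_cong) (auto simp: indicator_def)
      then show ?thesis using Km[of k] k by simp
    qed
    have iIc: "integrable M (\<lambda>\<omega>. a * indicator K (?S k \<omega>))"
    proof -
      have eq: "(\<lambda>\<omega>. a * of_real (indicator K (?S k \<omega>))) = (\<lambda>\<omega>. a * indicator K (?S k \<omega>))"
        by (auto simp: indicator_def fun_eq_iff)
      have "integrable M (\<lambda>\<omega>. a * of_real (indicator K (?S k \<omega>)))"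
        by (rule integrable_mult_right[OF integrable_of_real[OF iI]])
      then show ?thesis by (simp only: eq)
    qed
    have eIc: "expectation (\<lambda>\<omega>. a * indicator K (?S k \<omega>)) = a * of_real (prob {\<omega>\<in>space M. ?S k \<omega> \<in> K})"
    proof -
      have "expectation (\<lambda>\<omega>. a * indicator K (?S k \<omega>)) = expectation (\<lambda>\<omega>. a * of_real (indicator K (?S k \<omega>)))"
        by (rule Bochner_Integration.integral_cong) (auto simp: indicator_def)
      also have "\<dots> = a * of_real (expectation (\<lambda>\<omega>. indicator K (?S k \<omega>) :: real))"
        by (simp add: integral_mult_right_zero)
      finally show ?thesis unfolding eI .
    qed
    have "expectation (\<lambda>\<omega>. p (?S (Suc k) \<omega>)) - expectation (\<lambda>\<omega>. p (?S k \<omega>)) = expectation (\<lambda>\<omega>. p (?S (Suc k) \<omega>) - p (?S k \<omega>))"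
      using pS[of k] pS[of "Suc k"] k by (intro Bochner_Integration.integral_diff[symmetric]) auto
    also have "\<dots> = expectation (\<lambda>\<omega>. G (?S k \<omega>, X k \<omega>))"
      by (rule Bochner_Integration.integral_cong) (auto simp: G_def)
    also have "\<dots> = expectation (\<lambda>\<omega>. H (?S k \<omega>))" unfolding H_def by (rule ie1)
    finally have "expectation (\<lambda>\<omega>. p (?S (Suc k) \<omega>)) - expectation (\<lambda>\<omega>. p (?S k \<omega>)) - a * of_real (prob {\<omega>\<in>space M. ?S k \<omega> \<in> K})
        = expectation (\<lambda>\<omega>. H (?S k \<omega>) - a * indicator K (?S k \<omega>))"
      by (simp only: Bochner_Integration.integral_diff[OF Hint iIc] eIc)
    also have "cmod \<dots> \<le> expectation (\<lambda>\<omega>. c * indicator K (?S k \<omega>))"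
      by (rule order_trans[OF integral_norm_bound integral_mono[OF integrable_norm[OF Bochner_Integration.integrable_diff[OF Hint iIc]]
          integrable_mult_right[OF iI] Hb]])
    also have "\<dots> = c * prob {\<omega>\<in>space M. ?S k \<omega> \<in> K}" using eI by simp
    also have "\<dots> \<le> c" using mult_left_mono[OF prob_le_1 c0] by simp
    finally show ?thesis .
  qed
  have "m \<le> n \<Longrightarrow> cmod (expectation (\<lambda>\<omega>. p (?S m \<omega>)) - p y
    - a * of_real (\<Sum>k<m. prob {\<omega>\<in>space M. ?S k \<omega> \<in> K})) \<le> real m * c" for m
  proof (induction m)
    case 0 then show ?case by (simp add: prob_space)
  next
    case (Suc m)
    let ?E = "\<lambda>m. expectation (\<lambda>\<omega>. p (?S m \<omega>))" and ?P = "\<lambda>k. prob {\<omega>\<in>space M. ?S k \<omega> \<in> K}"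
    have "?E (Suc m) - p y - a * of_real (\<Sum>k<Suc m. ?P k)
      = (?E (Suc m) - ?E m - a * of_real (?P m)) + (?E m - p y - a * of_real (\<Sum>k<m. ?P k))"
      by (simp add: algebra_simps del: chain.simps)
    also have "cmod \<dots> \<le> c + real m * c"
      using stepk[of m] Suc by (intro order_trans[OF norm_triangle_ineq] add_mono) (auto simp del: chain.simps)
    finally show ?case by (simp add: algebra_simps del: chain.simps)
  qed
  then show ?thesis by blast
qed

text \<open>Reverse Fatou for events: the unions over n >= N decrease to the limsup, and each
  contains an event of probability at least \<open>c\<close>. This is what allows path-dependent
  thresholds for the step size.\<close>

lemma (in prob_space) prob_frequently_ge:
  assumes A: "\<And>n::nat. A n \<in> events" and c: "\<exists>\<^sub>F n in sequentially. c \<le> prob (A n)"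
  shows "{\<omega>\<in>space M. \<exists>\<^sub>F n in sequentially. \<omega> \<in> A n} \<in> events"
    and "c \<le> prob {\<omega>\<in>space M. \<exists>\<^sub>F n in sequentially. \<omega> \<in> A n}"
proof -
  have sub: "A n \<subseteq> space M" for n using sets.sets_into_space[OF A] .
  define D where "D N = (\<Union>n\<in>{N..}. A n)" for N
  have DM: "D N \<in> events" for N unfolding D_def using A by auto
  have eq: "{\<omega>\<in>space M. \<exists>\<^sub>F n in sequentially. \<omega> \<in> A n} = (\<Inter>N. D N)"
    using sub by (fastforce simp: D_def frequently_sequentially)
  show "{\<omega>\<in>space M. \<exists>\<^sub>F n in sequentially. \<omega> \<in> A n} \<in> events" unfolding eq using DM by auto
  have dec: "decseq D" unfolding decseq_def D_def by (auto intro: order_trans)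
  have "(\<lambda>N. prob (D N)) \<longlonglongrightarrow> prob (\<Inter>N. D N)"
    by (rule finite_Lim_measure_decseq) (use DM dec in auto)
  moreover have "c \<le> prob (D N)" for N
  proof -
    obtain n where n: "n \<ge> N" "c \<le> prob (A n)" using c unfolding frequently_sequentially by auto
    have "prob (A n) \<le> prob (D N)" using n(1) by (intro finite_measure_mono DM) (auto simp: D_def)
    then show ?thesis using n by simp
  qed
  ultimately show "c \<le> prob {\<omega>\<in>space M. \<exists>\<^sub>F n in sequentially. \<omega> \<in> A n}"
    unfolding eq by (intro LIMSEQ_le_const) auto
qed

section \<open>The chain driven by Brownian increments\<close>

definition scaled_increment :: "(real \<Rightarrow> 'a \<Rightarrow> real) \<Rightarrow> real \<Rightarrow> nat \<Rightarrow> 'a \<Rightarrow> real" where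
  "scaled_increment B d i \<omega> = (B (real (Suc i) * d) \<omega> - B (real i * d) \<omega>) / sqrt d"

context standard_brownian_motion
begin

lemma distributed_scaled_increment:
  assumes "0 < d"
  shows "distributed M lborel (scaled_increment B d i) std_normal_density"
proof -
  have "distributed M lborel (\<lambda>\<omega>. B (real (Suc i) * d) \<omega> - B (real i * d) \<omega>) (normal_density 0 (sqrt (real (Suc i) * d - real i * d)))"
    using assms by (intro normal_increments) (auto simp: mult_strict_right_mono)
  also have "real (Suc i) * d - real i * d = d" by (simp add: algebra_simps)
  finally have "distributed M lborel (\<lambda>\<omega>. ((B (real (Suc i) * d) \<omega> - B (real i * d) \<omega>) - 0) / sqrt d) std_normal_density"
    using assms by (subst normal_standard_normal_convert[symmetric]) auto
  then show ?thesis by (simp add: scaled_increment_def[abs_def])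
qed

lemma indep_scaled_increments:
  assumes "0 < d"
  shows "indep_vars (\<lambda>_. borel) (scaled_increment B d) {..<n}"
proof -
  have "indep_vars (\<lambda>_. borel) (\<lambda>i \<omega>. B (real (Suc i) * d) \<omega> - B (real i * d) \<omega>) {..<n}"
    using assms by (intro independent_increments[of "\<lambda>i. real i * d"]) (auto simp: mult_right_mono)
  then have "indep_vars (\<lambda>_. borel) (\<lambda>i \<omega>. (\<lambda>x. x / sqrt d) (B (real (Suc i) * d) \<omega> - B (real i * d) \<omega>)) {..<n}"
    by (rule indep_vars_compose2) auto
  then show ?thesis by (simp add: scaled_increment_def[abs_def])
qed

lemma borel_measurable_scaled_increment:
  "0 < d \<Longrightarrow> scaled_increment B d i \<in> borel_measurable M"
  using distributed_scaled_increment[of d i] by (auto simp: distributed_def)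

definition stopped_chain :: "(complex \<times> complex) set \<Rightarrow> complex \<times> complex \<Rightarrow> real \<Rightarrow> nat \<Rightarrow> 'a \<Rightarrow> complex \<times> complex" where
  "stopped_chain K y T n \<omega> = chain K (T / real n) y (\<lambda>i. scaled_increment B (T / real n) i \<omega>) n"

text \<open>Multiplied by T / n this is the expected time spent in \<open>K\<close> up to
  \<open>T\<close>, the counterpart of the stopped time in Dynkin's formula.\<close>

definition occupation :: "(complex \<times> complex) set \<Rightarrow> complex \<times> complex \<Rightarrow> real \<Rightarrow> nat \<Rightarrow> real" where
  "occupation K y T n = (\<Sum>k<n. prob {\<omega>\<in>space M. chain K (T / real n) y (\<lambda>i. scaled_increment B (T / real n) i \<omega>) k \<in> K})"

lemma borel_measurable_stopped_chain:
  assumes "K \<in> sets borel" "0 < T" "0 < n"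
  shows "stopped_chain K y T n \<in> borel_measurable M"
  unfolding stopped_chain_def[abs_def] using assms
  by (intro measurable_chain borel_measurable_scaled_increment) auto

text \<open>The n local errors of order (T / n)^(3/2) sum to C T sqrt (T / n), which vanishes. The
  indicator is for overshoots: the exit step may jump out of \<open>N\<close>, where
  \<open>f\<close> is not controlled.\<close>

lemma stopped_chain_tendsto:
  assumes f: "test_function U f l" and U: "open U" and N: "(\<Union>y\<in>K. cball y h) \<subseteq> N" "N \<subseteq> U" "compact N" and h: "0 < h"
    and e: "0 < e" "\<And>y. y \<in> K \<Longrightarrow> e \<le> cmod (fst y) \<and> e \<le> cmod (snd y)"
    and K: "K \<in> sets borel" "y \<in> K" and T: "0 < T"
  shows "(\<lambda>n. expectation (\<lambda>\<omega>. indicator N (stopped_chain K y T n \<omega>) *\<^sub>R f (stopped_chain K y T n \<omega>))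
     - l * of_real (T / real n * occupation K y T n)) \<longlonglongrightarrow> f y"
proof -
  have cf: "continuous_on N f" using f N(2) by (auto simp: test_function_def intro: continuous_on_subset)
  obtain C0 where C0: "\<And>y. y \<in> N \<Longrightarrow> cmod (f y) \<le> C0"
    using compact_imp_bounded[OF compact_continuous_image[OF cf N(3)]] unfolding bounded_iff by auto
  have Nb: "N \<in> sets borel" using N(3) by (intro borel_compact)
  obtain C where C: "0 \<le> C" "\<And>d y. 0 < d \<Longrightarrow> y \<in> K \<Longrightarrow>
      cmod ((\<integral>x. indicator N (step d y x) *\<^sub>R f (step d y x) \<partial>std_gauss) - f y - of_real d * l) \<le> C * (d * sqrt d)"
    using step_estimate[OF f U N(1,2) h C0 e Nb] by blast
  define p where "p y = indicator N y *\<^sub>R f y" for y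
  have p: "p \<in> borel_measurable borel" unfolding p_def by (rule borel_measurable_continuous_on_indicator[OF Nb cf])
  have KN: "K \<subseteq> N" using N(1) h by force
  have pb: "cmod (p y) \<le> \<bar>C0\<bar>" for y using C0[of y] by (auto simp: p_def indicator_def)
  have pK: "p y = f y" if "y \<in> K" for y using that KN by (auto simp: p_def)
  let ?a = "\<lambda>n. expectation (\<lambda>\<omega>. p (stopped_chain K y T n \<omega>)) - l * of_real (T / real n * occupation K y T n)"
  have bd: "cmod (?a n - f y) \<le> C * T * sqrt (T / real n)" if n: "0 < n" for n
  proof -
    let ?d = "T / real n"
    have d: "0 < ?d" using n T by simp
    have "cmod (expectation (\<lambda>\<omega>. p (chain K ?d y (\<lambda>i. scaled_increment B ?d i \<omega>) n)) - p y
       - (of_real ?d * l) * of_real (\<Sum>k<n. prob {\<omega>\<in>space M. chain K ?d y (\<lambda>i. scaled_increment B ?d i \<omega>) k \<in> K}))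
       \<le> real n * (C * (?d * sqrt ?d))"
    proof (rule chain_expectation[OF K(1) indep_scaled_increments[OF d] distributed_scaled_increment[OF d] p pb])
      fix y assume y: "y \<in> K"
      show "cmod ((\<integral>x. p (step ?d y x) \<partial>std_gauss) - p y - of_real ?d * l) \<le> C * (?d * sqrt ?d)"
        using C(2)[OF d y] pK[OF y] by (simp add: p_def)
    qed (use C(1) T in auto)
    also have "real n * (C * (?d * sqrt ?d)) = C * T * sqrt ?d" using n by simp
    finally show ?thesis
      using pK[OF K(2)] by (simp add: stopped_chain_def occupation_def algebra_simps)
  qed
  have "(\<lambda>n. T / real n) \<longlonglongrightarrow> 0" by (rule lim_const_over_n)
  then have "(\<lambda>n. C * T * sqrt (T / real n)) \<longlonglongrightarrow> C * T * sqrt 0" by (intro tendsto_intros)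
  then have lim0: "(\<lambda>n. C * T * sqrt (T / real n)) \<longlonglongrightarrow> 0" by simp
  have "(\<lambda>n. ?a n - f y) \<longlonglongrightarrow> 0"
    by (rule Lim_null_comparison[OF eventually_mono[OF eventually_gt_at_top[of "0::nat"] bd] lim0])
  then have "?a \<longlonglongrightarrow> f y" by (rule LIM_zero_cancel)
  then show ?thesis by (simp add: p_def)
qed

lemma stopped_chain_tendsto_Re:
  assumes f: "test_function U f l" and U: "open U" and N: "(\<Union>y\<in>K. cball y h) \<subseteq> N" "N \<subseteq> U" "compact N" and h: "0 < h"
    and e: "0 < e" "\<And>y. y \<in> K \<Longrightarrow> e \<le> cmod (fst y) \<and> e \<le> cmod (snd y)"
    and K: "K \<in> sets borel" "y \<in> K" and T: "0 < T"
  shows "(\<lambda>n. expectation (\<lambda>\<omega>. indicator N (stopped_chain K y T n \<omega>) * Re (f (stopped_chain K y T n \<omega>)))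
     - Re l * (T / real n * occupation K y T n)) \<longlonglongrightarrow> Re (f y)"
    and "0 < n \<Longrightarrow> integrable M (\<lambda>\<omega>. indicator N (stopped_chain K y T n \<omega>) * Re (f (stopped_chain K y T n \<omega>)))"
proof -
  let ?S = "stopped_chain K y T"
  have cf: "continuous_on N f" using f N(2) by (auto simp: test_function_def intro: continuous_on_subset)
  obtain C0 where C0: "\<And>y. y \<in> N \<Longrightarrow> cmod (f y) \<le> C0"
    using compact_imp_bounded[OF compact_continuous_image[OF cf N(3)]] unfolding bounded_iff by auto
  have Nb: "N \<in> sets borel" using N(3) by (intro borel_compact)
  define p where "p y = indicator N y *\<^sub>R f y" for y
  have p: "p \<in> borel_measurable borel" unfolding p_def by (rule borel_measurable_continuous_on_indicator[OF Nb cf])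
  have pb: "cmod (p y) \<le> \<bar>C0\<bar>" for y using C0[of y] by (auto simp: p_def indicator_def)
  have ip: "integrable M (\<lambda>\<omega>. p (?S n \<omega>))" if "0 < n" for n
  proof (rule integrable_const_bound[of _ "\<bar>C0\<bar>"])
    show "(\<lambda>\<omega>. p (?S n \<omega>)) \<in> borel_measurable M"
      by (rule measurable_compose[OF borel_measurable_stopped_chain[OF K(1) T that] p])
  qed (use pb in auto)
  have Re_p: "Re (p q) = indicator N q * Re (f q)" for q by (simp add: p_def)
  show "0 < n \<Longrightarrow> integrable M (\<lambda>\<omega>. indicator N (?S n \<omega>) * Re (f (?S n \<omega>)))"
    using integrable_Re[OF ip[of n]] by (simp add: Re_p)
  have eR: "Re (expectation (\<lambda>\<omega>. p (?S n \<omega>))) = expectation (\<lambda>\<omega>. indicator N (?S n \<omega>) * Re (f (?S n \<omega>)))" if "0 < n" for n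
    using integral_Re[OF ip[OF that]] by (simp add: Re_p)
  have "(\<lambda>n. Re (expectation (\<lambda>\<omega>. p (?S n \<omega>)) - l * of_real (T / real n * occupation K y T n))) \<longlonglongrightarrow> Re (f y)"
    unfolding p_def by (rule tendsto_Re[OF stopped_chain_tendsto[OF assms]])
  moreover have "eventually (\<lambda>n. Re (expectation (\<lambda>\<omega>. p (?S n \<omega>)) - l * of_real (T / real n * occupation K y T n))
    = expectation (\<lambda>\<omega>. indicator N (?S n \<omega>) * Re (f (?S n \<omega>))) - Re l * (T / real n * occupation K y T n)) sequentially"
    using eventually_gt_at_top[of "0::nat"]
  proof eventually_elim
    case (elim n)
    have "Re (l * of_real c) = Re l * c" for c by simp
    then show ?case using eR[OF elim] by (simp only: minus_complex.simps)
  qed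
  ultimately show "(\<lambda>n. expectation (\<lambda>\<omega>. indicator N (?S n \<omega>) * Re (f (?S n \<omega>)))
     - Re l * (T / real n * occupation K y T n)) \<longlonglongrightarrow> Re (f y)"
    by (rule Lim_transform_eventually)
qed

end

lemma chain_in_region_mono: "chain K d y x n \<in> K \<Longrightarrow> k \<le> n \<Longrightarrow> chain K d y x k \<in> K"
proof (induction n)
  case (Suc n)
  have "chain K d y x n \<in> K" using Suc.prems(1) by (auto split: if_splits)
  then show ?case using Suc by (cases "k = Suc n") auto
qed simp

text \<open>A chain that ends in \<open>K\<close> was in \<open>K\<close> at every earlier step, so
  each summand is at least the final probability.\<close>

lemma (in standard_brownian_motion) occupation_ge:
  assumes "K \<in> sets borel" "0 < T" "0 < n"
  shows "T * prob {\<omega>\<in>space M. stopped_chain K y T n \<omega> \<in> K} \<le> T / real n * occupation K y T n"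
proof -
  let ?c = "\<lambda>k \<omega>. chain K (T / real n) y (\<lambda>i. scaled_increment B (T / real n) i \<omega>) k"
  have m: "{\<omega>\<in>space M. ?c k \<omega> \<in> K} \<in> events" for k
  proof -
    have "?c k \<in> borel_measurable M"
      using assms by (intro measurable_chain borel_measurable_scaled_increment) auto
    from measurable_sets[OF this assms(1)] show ?thesis by (simp add: vimage_def Int_def conj_commute)
  qed
  have "prob {\<omega>\<in>space M. ?c n \<omega> \<in> K} \<le> prob {\<omega>\<in>space M. ?c k \<omega> \<in> K}" if "k < n" for k
    using that chain_in_region_mono[of K _ y _ n k] by (intro finite_measure_mono m) auto
  then have "(\<Sum>k<n. prob {\<omega>\<in>space M. ?c n \<omega> \<in> K}) \<le> occupation K y T n"
    unfolding occupation_def by (intro sum_mono) auto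
  then have "real n * prob {\<omega>\<in>space M. stopped_chain K y T n \<omega> \<in> K} \<le> occupation K y T n"
    by (simp add: stopped_chain_def)
  then have "T / real n * (real n * prob {\<omega>\<in>space M. stopped_chain K y T n \<omega> \<in> K}) \<le> T / real n * occupation K y T n"
    using assms by (intro mult_left_mono) auto
  then show ?thesis using assms by simp
qed

section \<open>Exit from a compact region\<close>

text \<open>\<open>m\<close> and \<open>e\<close> stay clear of the singularities, \<open>R\<close>
  bounds the region, \<open>r\<close> prevents the two points from merging and \<open>k\<close>
  bounds Im F. The second point is real here, while \<open>exit_domain\<close> is open in two
  complex variables and leaves slack 1 in \<open>R\<close> and \<open>k\<close> for
  overshoots.\<close>

definition exit_region :: "real \<Rightarrow> real \<Rightarrow> real \<Rightarrow> real \<Rightarrow> real \<Rightarrow> (complex \<times> complex) set" where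
  "exit_region m e R k r = {y. m \<le> Im (fst y) \<and> Im (snd y) = 0 \<and> e \<le> Re (snd y) \<and> e \<le> cmod (fst y) \<and>
     cmod (fst y) \<le> R \<and> cmod (snd y) \<le> R \<and> r \<le> cmod (fst y - snd y) \<and> Im (strip_map (fst y / snd y)) \<le> k}"

definition exit_domain :: "real \<Rightarrow> real \<Rightarrow> (complex \<times> complex) set" where
  "exit_domain R k = {y \<in> pair_domain. cmod (snd y) < R + 1 \<and> Im (strip_map (fst y / snd y)) < k + 1}"

lemma real_pair_domain:
  assumes "0 < Im z" "Im x = 0" "0 < Re x"
  shows "(z, x) \<in> pair_domain"
proof -
  have "x = of_real (Re x)" using assms by (simp add: complex_eq_iff)
  then have "Im (z / x) = Im z / Re x" by (metis Im_divide_of_real)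
  then show ?thesis using assms by (simp add: pair_domain_def)
qed

lemma exit_region_subset_pair_domain: "0 < m \<Longrightarrow> 0 < e \<Longrightarrow> exit_region m e R k r \<subseteq> pair_domain"
  using real_pair_domain by (force simp: exit_region_def)

lemma exit_region_subset: "0 < m \<Longrightarrow> 0 < e \<Longrightarrow> exit_region m e R k r \<subseteq> exit_domain R k"
  using exit_region_subset_pair_domain[of m e R k r] by (auto simp: exit_region_def exit_domain_def)

text \<open>\<open>strip_map\<close> is known to be continuous only on the half-plane, so the other
  closed conditions come first: they already confine \<open>A\<close> to
  \<open>pair_domain\<close>.\<close>

lemma compact_exit_region:
  assumes "0 < m" "0 < e" shows "compact (exit_region m e R k r)"
proof -
  define A where "A = {y :: complex \<times> complex. m \<le> Im (fst y) \<and> Im (snd y) = 0 \<and> e \<le> Re (snd y) \<and> e \<le> cmod (fst y) \<and>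
     cmod (fst y) \<le> R \<and> cmod (snd y) \<le> R \<and> r \<le> cmod (fst y - snd y)}"
  have cA: "closed A" unfolding A_def by (intro closed_Collect_conj closed_Collect_le closed_Collect_eq continuous_intros)
  have "A \<subseteq> cball 0 R \<times> cball 0 R" by (auto simp: A_def)
  then have bA: "bounded A" by (rule bounded_subset[rotated]) (intro bounded_Times bounded_cball)
  have "A \<subseteq> pair_domain" using real_pair_domain assms by (force simp: A_def)
  then have c: "continuous_on A (\<lambda>y. Im (strip_map (fst y / snd y)))"
    by (intro continuous_on_Im continuous_on_subset[OF continuous_on_strip_map])
  have "closed (A \<inter> (\<lambda>y. Im (strip_map (fst y / snd y))) -` {..k})"
    by (rule continuous_closed_preimage[OF c cA]) simp
  moreover have "A \<inter> (\<lambda>y. Im (strip_map (fst y / snd y))) -` {..k} = exit_region m e R k r"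
    by (auto simp: A_def exit_region_def)
  moreover have "bounded (exit_region m e R k r)"
    by (rule bounded_subset[OF bA]) (auto simp: A_def exit_region_def)
  ultimately show ?thesis by (simp add: compact_eq_bounded_closed)
qed

lemma open_exit_domain: "open (exit_domain R k)"
proof -
  have "open (pair_domain \<inter> (\<lambda>y. Im (strip_map (fst y / snd y))) -` {..<k + 1})"
    by (rule continuous_open_preimage[OF continuous_on_Im[OF continuous_on_strip_map] open_pair_domain]) simp
  moreover have "open {y :: complex \<times> complex. cmod (snd y) < R + 1}" by (intro open_Collect_less continuous_intros)
  ultimately have "open ((pair_domain \<inter> (\<lambda>y. Im (strip_map (fst y / snd y))) -` {..<k + 1}) \<inter> {y. cmod (snd y) < R + 1})"
    by (rule open_Int)
  also have "\<dots> = exit_domain R k" by (auto simp: exit_domain_def)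
  finally show ?thesis .
qed

text \<open>A positive martingale while \<open>Im F < k + 1\<close>; it is large when \<open>\<bar>Z\<bar>\<close> or \<open>X\<close> is large and when
  \<open>\<bar>Z - X\<bar>\<close> is small.\<close>

definition lyapunov :: "real \<Rightarrow> complex \<times> complex \<Rightarrow> complex" where
  "lyapunov k y = 3 * ((1 - \<i>) * csqrt (fst y) + 2 * csqrt (snd y)) + of_real (pi\<^sup>2 / 4) * log_part y
     + of_real (pi\<^sup>2 / 4 * (k + 1)\<^sup>2)"

lemma test_function_lyapunov: "test_function pair_domain (lyapunov k) 0"
proof -
  have "test_function pair_domain (\<lambda>y. (3 * ((1 - \<i>) * csqrt (fst y) + 2 * csqrt (snd y)) + of_real (pi\<^sup>2 / 4) * log_part y)
     + of_real (pi\<^sup>2 / 4 * (k + 1)\<^sup>2)) ((3 * ((1 - \<i>) * 0 + 2 * 0) + of_real (pi\<^sup>2 / 4) * 0) + 0)"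
    by (rule test_function_add[OF test_function_add[OF test_function_cmult[OF test_function_add[OF
        test_function_cmult[OF test_function_csqrt_fst] test_function_cmult[OF test_function_csqrt_snd]]]
        test_function_cmult[OF test_function_log_part]] test_function_const])
  then show ?thesis by (simp add: lyapunov_def[abs_def])
qed

text \<open>In the quadrant Re ((1 - i) p) = Re p + Im p >= |p|; for Re x > 0 the root q has |Im q|
  <= Re q, so |q| <= 2 Re q. The constant with (k + 1)^2 dominates the negative term from (Im F)^2.
  With v the sum of the root moduli, two thirds of 3 v absorb ln |Z - X| <= 2 ln v <= 2 v, and v
  remains.\<close>

lemma lyapunov_ge:
  assumes y: "y \<in> exit_domain R k"
  shows "sqrt (cmod (fst y)) + sqrt (cmod (snd y)) \<le> Re (lyapunov k y)"
    and "- ln (cmod (fst y - snd y)) \<le> Re (lyapunov k y)"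
proof -
  obtain z x where yz: "y = (z, x)" by (cases y)
  have d: "0 < Im z" "0 < Re x" "0 < Im (z / x)" "0 < Im (z - x)" "Im (strip_map (z / x)) < k + 1"
    using y by (auto simp: yz exit_domain_def pair_domain_def)
  define p where "p = csqrt z"
  define q where "q = csqrt x"
  define f where "f = strip_map (z / x)"
  define v where "v = sqrt (cmod z) + sqrt (cmod x)"
  have p: "0 < Re p" "0 < Im p" using csqrt_upper_half_plane[OF d(1)] by (auto simp: p_def)
  have np: "cmod p = sqrt (cmod z)" "cmod q = sqrt (cmod x)" by (simp_all add: p_def q_def)
  have f: "0 < Im f" "Im f < k + 1" using strip_map_half_plane(1)[OF d(3)] d(5) by (auto simp: f_def half_strip_def)
  have zx: "z - x \<noteq> 0" using d(4) by auto
  have 1: "sqrt (cmod z) \<le> Re ((1 - \<i>) * p)"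
    using cmod_le[of p] p np by simp
  have 2: "sqrt (cmod x) \<le> 2 * Re q"
  proof -
    have "(Im q)\<^sup>2 < (Re q)\<^sup>2"
      using arg_cong[OF power2_csqrt[of x], of Re] d(2) by (simp only: q_def[symmetric]) (simp add: power2_eq_square)
    then have "\<bar>Im q\<bar> \<le> \<bar>Re q\<bar>" by (simp add: abs_le_square_iff less_imp_le)
    moreover have "0 \<le> Re q" unfolding q_def by (rule Re_csqrt)
    ultimately show ?thesis using cmod_le[of q] np by linarith
  qed
  have "Re (lyapunov k y) = 3 * (Re ((1 - \<i>) * p) + 2 * Re q) + pi\<^sup>2 / 4 * ((Re f)\<^sup>2 - (Im f)\<^sup>2 - 4 / pi\<^sup>2 * ln (cmod (z - x))) + pi\<^sup>2 / 4 * (k + 1)\<^sup>2"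
    using zx by (simp add: lyapunov_def yz log_part_def p_def[symmetric] q_def[symmetric] f_def[symmetric] Re_power2)
  also have "\<dots> = 3 * (Re ((1 - \<i>) * p) + 2 * Re q) + pi\<^sup>2 / 4 * (Re f)\<^sup>2 + pi\<^sup>2 / 4 * ((k + 1)\<^sup>2 - (Im f)\<^sup>2) - ln (cmod (z - x))"
    by (simp add: field_simps)
  finally have eq: "Re (lyapunov k y) = \<dots>" .
  have "(Im f)\<^sup>2 \<le> (k + 1)\<^sup>2" using f by (intro power_mono) auto
  then have nn: "0 \<le> pi\<^sup>2 / 4 * (Re f)\<^sup>2" "0 \<le> pi\<^sup>2 / 4 * ((k + 1)\<^sup>2 - (Im f)\<^sup>2)" by auto
  have main: "3 * v - ln (cmod (z - x)) \<le> Re (lyapunov k y)"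
  proof -
    have gen: "3 * (a + b) - c \<le> 3 * (a' + b') + s + t - c" if "a \<le> a'" "b \<le> b'" "0 \<le> s" "0 \<le> t" for a b c a' b' s t :: real
    proof -
      have "3 * (a + b) \<le> 3 * (a' + b')" using that(1,2) by simp
      then show ?thesis using that(3,4) by simp
    qed
    show ?thesis unfolding eq v_def by (rule gen[OF 1 2 nn])
  qed
  have v0: "0 < v" using d(1) by (auto simp: v_def intro!: add_pos_nonneg)
  have "ln (cmod (z - x)) \<le> 2 * v"
  proof -
    have "cmod (z - x) \<le> cmod z + cmod x" by (rule norm_triangle_ineq4)
    also have "\<dots> \<le> v\<^sup>2" by (simp add: v_def power2_sum)
    finally have "ln (cmod (z - x)) \<le> ln (v\<^sup>2)" using zx v0 by (subst ln_le_cancel_iff) auto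
    also have "\<dots> = 2 * ln v" using v0 by (simp add: ln_realpow)
    also have "\<dots> \<le> 2 * v" using ln_le_minus_one[OF v0] by simp
    finally show ?thesis .
  qed
  then show "sqrt (cmod (fst y)) + sqrt (cmod (snd y)) \<le> Re (lyapunov k y)" using main by (simp add: yz v_def)
  show "- ln (cmod (fst y - snd y)) \<le> Re (lyapunov k y)" using main v0 by (simp add: yz)
qed

text \<open>Markov's inequality, applied to \<open>lyapunov\<close> at level \<open>L\<close>, to Im
  F at level \<open>k\<close> and to the time spent in the region. Outside these rare events Re
  lyapunov < L gives the bounds R = L^2 and r = exp (- L), so the chain can have left only by |Z| <
  e or X < e, where either \<open>E\<close> occurs or Re G <= q.\<close>

lemma (in standard_brownian_motion) exit_probability:
  assumes par: "0 < m" "0 < e" "0 < L" "0 < k" "0 < T" "0 < g" "0 \<le> q"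
    and R: "R = L\<^sup>2" and r: "r = exp (- L)" and y: "y \<in> exit_region m e R k r" "snd y = 1"
    and G: "test_function (exit_domain R k) G 0" "\<And>y. y \<in> exit_domain R k \<Longrightarrow> 0 \<le> Re (G y) \<and> Re (G y) \<le> 1"
    and E: "E \<in> sets borel"
      "\<And>y. y \<in> exit_domain R k \<Longrightarrow> cmod (fst y) < e \<or> cmod (snd y) < e \<Longrightarrow> r \<le> cmod (fst y - snd y) \<Longrightarrow> y \<in> E \<or> Re (G y) \<le> q"
    and low: "\<forall>\<^sub>F n in sequentially. \<forall>\<omega>\<in>space M. m \<le> Im (fst (stopped_chain (exit_region m e R k r) y T n \<omega>)) \<and>
        Im (snd (stopped_chain (exit_region m e R k r) y T n \<omega>)) = 0"
  shows "\<forall>\<^sub>F n in sequentially. Re (G y) - q - Re (lyapunov k y) / L - Im (strip_map (fst y / snd y)) / k - (R + 1)\<^sup>2 / (12 * T) - g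
     \<le> prob {\<omega>\<in>space M. stopped_chain (exit_region m e R k r) y T n \<omega> \<in> E - exit_region m e R k r}"
proof -
  let ?K = "exit_region m e R k r" and ?U = "exit_domain R k"
  let ?S = "stopped_chain ?K y T"
  have Kc: "compact ?K" by (rule compact_exit_region[OF par(1,2)])
  have KU: "?K \<subseteq> ?U" by (rule exit_region_subset[OF par(1,2)])
  obtain h where h: "0 < h" "(\<Union>y\<in>?K. cball y h) \<subseteq> ?U"
    by (rule compact_subset_open_imp_cball_epsilon_subset[OF Kc open_exit_domain KU])
  define N where "N = (\<Union>y\<in>?K. cball y h)"
  have Nc: "compact N"
  proof -
    have "N = {x + y | x y. x \<in> ?K \<and> y \<in> cball 0 h}"
    proof (intro set_eqI iffI)
      fix u assume "u \<in> N"
      then obtain x where x: "x \<in> ?K" "u \<in> cball x h" unfolding N_def by (rule UN_E)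
      have "u = x + (u - x)" "u - x \<in> cball 0 h" using x(2) by (auto simp: dist_norm norm_minus_commute)
      then show "u \<in> {x + y | x y. x \<in> ?K \<and> y \<in> cball 0 h}" unfolding mem_Collect_eq using x(1)
        by (intro exI[of _ x] exI[of _ "u - x"] conjI)
    next
      fix u assume "u \<in> {x + y | x y. x \<in> ?K \<and> y \<in> cball 0 h}"
      then obtain x v where x: "u = x + v" "x \<in> ?K" "v \<in> cball 0 h" unfolding mem_Collect_eq by (elim exE conjE) (rule that)
      then have "u \<in> cball x h" by (simp add: dist_norm)
      then show "u \<in> N" using x(2) unfolding N_def by (rule UN_I[rotated])
    qed
    then show ?thesis using compact_sums[OF Kc compact_cball[of 0 h]] by simp
  qed
  have N: "(\<Union>y\<in>?K. cball y h) \<subseteq> N" "N \<subseteq> ?U" using h(2) by (auto simp: N_def)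
  have KN: "?K \<subseteq> N" using N(1) h(1) by force
  have Ke: "e \<le> cmod (fst y) \<and> e \<le> cmod (snd y)" if "y \<in> ?K" for y
    using that complex_Re_le_cmod[of "snd y"] by (auto simp: exit_region_def)
  have Kb: "?K \<in> sets borel" using Kc by (rule borel_compact)
  have Nb: "N \<in> sets borel" using Nc by (rule borel_compact)
  have sub: "?U \<subseteq> pair_domain" by (auto simp: exit_domain_def)
  note lim = stopped_chain_tendsto_Re(1)[OF _ open_exit_domain N Nc h(1) par(2) Ke Kb y(1) par(5)]
  have int: "integrable M (\<lambda>\<omega>. indicator N (?S n \<omega>) * Re (f (?S n \<omega>)))" if "test_function ?U f l" "0 < n" for f l n
    by (rule stopped_chain_tendsto_Re(2)[OF that(1) open_exit_domain N Nc h(1) par(2) Ke Kb y(1) par(5) that(2)])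
  let ?e = "\<lambda>f n. expectation (\<lambda>\<omega>. indicator N (?S n \<omega>) * Re (f (?S n \<omega>)))"
  let ?F = "\<lambda>y. - \<i> * strip_map (fst y / snd y)"
  have tF: "test_function ?U ?F 0" using test_function_cmult[OF test_function_subset[OF test_function_strip_map sub], of "- \<i>"] by simp
  have tL: "test_function ?U (lyapunov k) 0" by (rule test_function_subset[OF test_function_lyapunov sub])
  have tX: "test_function ?U (\<lambda>y. (snd y)\<^sup>2) 12" by (rule test_function_subset[OF test_function_square_snd sub])
  have lG: "?e G \<longlonglongrightarrow> Re (G y)" using lim[OF G(1)] by simp
  have lF: "?e ?F \<longlonglongrightarrow> Re (?F y)" using lim[OF tF] by simp
  have lL: "?e (lyapunov k) \<longlonglongrightarrow> Re (lyapunov k y)" using lim[OF tL] by simp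
  have lX: "(\<lambda>n. ?e (\<lambda>y. (snd y)\<^sup>2) n - 12 * (T / real n * occupation ?K y T n)) \<longlonglongrightarrow> 1" using lim[OF tX] y(2) by simp
  have "(\<lambda>n. ?e G n - ?e (lyapunov k) n / L - ?e ?F n / k) \<longlonglongrightarrow> Re (G y) - Re (lyapunov k y) / L - Re (?F y) / k"
    using par by (intro tendsto_intros lG lF lL) auto
  then have ev1: "\<forall>\<^sub>F n in sequentially. Re (G y) - Re (lyapunov k y) / L - Re (?F y) / k - g < ?e G n - ?e (lyapunov k) n / L - ?e ?F n / k"
    using par(6) by (intro order_tendstoD) auto
  \<comment> \<open>The limit is (snd y)^2 = 1, so eventually the second moment dominates 12 times
    the expected time in the region.\<close>
  have ev2: "\<forall>\<^sub>F n in sequentially. 0 < ?e (\<lambda>y. (snd y)\<^sup>2) n - 12 * (T / real n * occupation ?K y T n)"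
    using lX by (rule order_tendstoD) simp
  show ?thesis
    using ev1 ev2 low eventually_gt_at_top[of "0::nat"]
  proof eventually_elim
    case (elim n)
    have Sm: "?S n \<in> borel_measurable M" by (rule borel_measurable_stopped_chain[OF Kb par(5) elim(4)])
    have ev: "{\<omega>\<in>space M. ?S n \<omega> \<in> A} \<in> events" if "A \<in> sets borel" for A
      using measurable_sets[OF Sm that] by (simp add: vimage_def Int_def conj_commute)
    have ind: "integrable M (\<lambda>\<omega>. indicator A (?S n \<omega>) :: real)" "expectation (\<lambda>\<omega>. indicator A (?S n \<omega>) :: real) = prob {\<omega>\<in>space M. ?S n \<omega> \<in> A}"
      if "A \<in> sets borel" for A
    proof -
      have "(indicator {\<omega>\<in>space M. ?S n \<omega> \<in> A} \<omega> :: real) = indicator A (?S n \<omega>)" if "\<omega> \<in> space M" for \<omega>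
        using that by (auto simp: indicator_def)
      then show "integrable M (\<lambda>\<omega>. indicator A (?S n \<omega>) :: real)" "expectation (\<lambda>\<omega>. indicator A (?S n \<omega>) :: real) = prob {\<omega>\<in>space M. ?S n \<omega> \<in> A}"
        using integrable_real_indicator[OF ev[OF that]] Bochner_Integration.integral_indicator[of M "{\<omega>\<in>space M. ?S n \<omega> \<in> A}"]
          emeasure_finite[of "{\<omega>\<in>space M. ?S n \<omega> \<in> A}"] ev[OF that]
        by (auto simp: less_top[symmetric] Int_absorb2 cong: Bochner_Integration.integrable_cong Bochner_Integration.integral_cong)
    qed
    have EK: "E - ?K \<in> sets borel" using E(1) Kb by auto
    have pK: "12 * T * prob {\<omega>\<in>space M. ?S n \<omega> \<in> ?K} \<le> (R + 1)\<^sup>2"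
    proof -
      have "12 * (T * prob {\<omega>\<in>space M. ?S n \<omega> \<in> ?K}) \<le> 12 * (T / real n * occupation ?K y T n)"
        using occupation_ge[OF Kb par(5) elim(4), of y] by simp
      also have "\<dots> \<le> ?e (\<lambda>y. (snd y)\<^sup>2) n" using elim(2) by simp
      also have "\<dots> \<le> expectation (\<lambda>\<omega>. (R + 1)\<^sup>2)"
      proof (rule integral_mono[OF int[OF tX elim(4)]])
        fix \<omega>
        show "indicator N (?S n \<omega>) * Re ((snd (?S n \<omega>))\<^sup>2) \<le> (R + 1)\<^sup>2"
        proof (cases "?S n \<omega> \<in> N")
          case True
          then have "cmod (snd (?S n \<omega>)) < R + 1" using N(2) by (auto simp: exit_domain_def)
          then have "(cmod (snd (?S n \<omega>)))\<^sup>2 \<le> (R + 1)\<^sup>2" by (intro power_mono) auto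
          moreover have "Re ((snd (?S n \<omega>))\<^sup>2) \<le> (cmod (snd (?S n \<omega>)))\<^sup>2"
            using complex_Re_le_cmod[of "(snd (?S n \<omega>))\<^sup>2"] by (simp add: norm_power)
          ultimately show ?thesis using True by simp
        qed simp
      qed simp
      finally show ?thesis by (simp add: prob_space)
    qed
    have pw: "indicator N (?S n \<omega>) * Re (G (?S n \<omega>)) \<le> indicator (E - ?K) (?S n \<omega>) + q
      + indicator N (?S n \<omega>) * Re (lyapunov k (?S n \<omega>)) / L + indicator N (?S n \<omega>) * Re (?F (?S n \<omega>)) / k + indicator ?K (?S n \<omega>)"
      if w: "\<omega> \<in> space M" for \<omega>
    proof (cases "?S n \<omega> \<in> N")
      case False
      then show ?thesis using par(7) by (simp add: indicator_def)
    next
      case True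
      define u where "u = ?S n \<omega>"
      have uU: "u \<in> ?U" using True N(2) by (auto simp: u_def)
      have uD: "u \<in> pair_domain" using uU sub by auto
      have G01: "0 \<le> Re (G u)" "Re (G u) \<le> 1" using G(2)[OF uU] by auto
      have L1: "sqrt (cmod (fst u)) + sqrt (cmod (snd u)) \<le> Re (lyapunov k u)" "- ln (cmod (fst u - snd u)) \<le> Re (lyapunov k u)"
        using lyapunov_ge[OF uU] by auto
      have L0: "0 \<le> Re (lyapunov k u)" using L1(1) by (intro order_trans[OF _ L1(1)]) simp
      have LL: "0 \<le> Re (lyapunov k u) / L" using L0 par by simp
      have F0: "0 \<le> Re (?F u)" using strip_map_half_plane(1)[of "fst u / snd u"] uD by (auto simp: pair_domain_def half_strip_def case_prod_beta)
      have FF: "0 \<le> Re (?F u) / k" using F0 par by (intro divide_nonneg_pos)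
      have "Re (G u) \<le> indicator (E - ?K) u + q + Re (lyapunov k u) / L + Re (?F u) / k + indicator ?K u"
      proof (cases "u \<in> ?K \<or> L \<le> Re (lyapunov k u) \<or> k \<le> Re (?F u)")
        case True
        then have "1 \<le> (indicator ?K u :: real) \<or> 1 \<le> Re (lyapunov k u) / L \<or> 1 \<le> Re (?F u) / k"
          using par by (auto simp: le_divide_eq)
        moreover have "(0::real) \<le> indicator (E - ?K) u" "(0::real) \<le> indicator ?K u" by auto
        ultimately show ?thesis using G01 LL FF par(7) by linarith
      next
        case False
        have uK: "u \<notin> ?K" and uL: "Re (lyapunov k u) < L" and uF: "Re (?F u) < k" using False by auto
        have rD: "r \<le> cmod (fst u - snd u)"
        proof (rule ccontr)
          assume "\<not> r \<le> cmod (fst u - snd u)"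
          moreover have "0 < cmod (fst u - snd u)" using uD by (auto simp: pair_domain_def case_prod_beta)
          ultimately have "ln (cmod (fst u - snd u)) < ln r" by (subst ln_less_cancel_iff) (auto simp: r)
          then show False using L1(2) uL by (simp add: r)
        qed
        have big: "cmod (fst u) \<le> R" "cmod (snd u) \<le> R"
        proof -
          have s: "0 \<le> sqrt (cmod (fst u))" "0 \<le> sqrt (cmod (snd u))" by auto
          have "sqrt (cmod (fst u)) \<le> L" "sqrt (cmod (snd u)) \<le> L" using s L1(1) uL by linarith+
          then show "cmod (fst u) \<le> R" "cmod (snd u) \<le> R" unfolding R by (auto intro: sqrt_le_D)
        qed
        have lu: "m \<le> Im (fst u)" "Im (snd u) = 0" using elim(3) w by (auto simp: u_def)
        \<comment> \<open>Every other condition of the region holds at \<open>u\<close>; the one on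
          \<open>m\<close> is supplied by \<open>low\<close>.\<close>
        have "cmod (fst u) < e \<or> Re (snd u) < e"
        proof (rule ccontr)
          assume "\<not> ?thesis"
          then have "u \<in> ?K" using lu big rD uF by (auto simp: exit_region_def)
          then show False using uK by simp
        qed
        moreover have "cmod (snd u) = Re (snd u)"
        proof -
          have "0 < Re (snd u)" using uD by (auto simp: pair_domain_def case_prod_beta)
          moreover have "snd u = of_real (Re (snd u))" using lu(2) by (simp add: complex_eq_iff)
          ultimately show ?thesis by (metis norm_of_real abs_of_pos)
        qed
        ultimately have "u \<in> E \<or> Re (G u) \<le> q" using E(2)[OF uU _ rD] by auto
        then show ?thesis
        proof
          assume "u \<in> E"
          then have "indicator (E - ?K) u = (1 :: real)" using uK by simp
          then show ?thesis using G01 LL FF par(7) by (simp add: uK)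
        next
          assume "Re (G u) \<le> q"
          moreover have "(0::real) \<le> indicator (E - ?K) u" "(0::real) \<le> indicator ?K u" by auto
          ultimately show ?thesis using LL FF by linarith
        qed
      qed
      then show ?thesis using True by (simp add: u_def)
    qed
    have "?e G n \<le> expectation (\<lambda>\<omega>. indicator (E - ?K) (?S n \<omega>) + q
      + indicator N (?S n \<omega>) * Re (lyapunov k (?S n \<omega>)) / L + indicator N (?S n \<omega>) * Re (?F (?S n \<omega>)) / k + indicator ?K (?S n \<omega>))"
      by (rule integral_mono[OF int[OF G(1) elim(4)] _ pw])
        (intro Bochner_Integration.integrable_add integrable_divide_zero ind(1) EK Kb int[OF tL elim(4)] int[OF tF elim(4)] impI integrable_const)
    also have "\<dots> = prob {\<omega>\<in>space M. ?S n \<omega> \<in> E - ?K} + q + ?e (lyapunov k) n / L + ?e ?F n / k + prob {\<omega>\<in>space M. ?S n \<omega> \<in> ?K}"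
    proof -
      note i1 = ind(1)[OF EK] and i2 = ind(1)[OF Kb] and i3 = int[OF tL elim(4)] and i4 = int[OF tF elim(4)]
      have i3': "integrable M (\<lambda>\<omega>. indicator N (?S n \<omega>) * Re (lyapunov k (?S n \<omega>)) / L)" using i3 by (rule integrable_divide)
      have i4': "integrable M (\<lambda>\<omega>. indicator N (?S n \<omega>) * Re (?F (?S n \<omega>)) / k)" using i4 by (rule integrable_divide)
      have j1: "integrable M (\<lambda>\<omega>. indicator (E - ?K) (?S n \<omega>) + q)" by (rule Bochner_Integration.integrable_add[OF i1 integrable_const])
      note j2 = Bochner_Integration.integrable_add[OF j1 i3'] note j3 = Bochner_Integration.integrable_add[OF j2 i4']
      show ?thesis
        unfolding Bochner_Integration.integral_add[OF j3 i2] Bochner_Integration.integral_add[OF j2 i4'] Bochner_Integration.integral_add[OF j1 i3']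
          Bochner_Integration.integral_add[OF i1 integrable_const] ind(2)[OF EK] ind(2)[OF Kb] integral_divide_zero
        by (simp add: prob_space)
    qed
    finally have "?e G n \<le> \<dots>" .
    moreover have "prob {\<omega>\<in>space M. ?S n \<omega> \<in> ?K} \<le> (R + 1)\<^sup>2 / (12 * T)" using pK par by (simp add: field_simps)
    ultimately show ?case using elim(1) by simp
  qed
qed

section \<open>Following the chain along a driving path\<close>

lemma sle_driving_continuous:
  assumes "continuous_on {0..} (\<lambda>t. B t \<omega>)"
  shows "continuous_on {0..} (sle_driving k B \<omega>)"
  unfolding sle_driving_def[abs_def] using assms by (intro continuous_intros)

lemma step_scaled_increment:
  assumes "0 < d"
  shows "step d y (scaled_increment B d i \<omega>) =
    (let D = of_real (sle_driving 8 B \<omega> (real (Suc i) * d) - sle_driving 8 B \<omega> (real i * d)) in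
     (fst y + 2 * of_real d / fst y - D, snd y + 2 * of_real d / snd y - D))"
proof -
  have "sqrt (8 * d) * scaled_increment B d i \<omega> = sle_driving 8 B \<omega> (real (Suc i) * d) - sle_driving 8 B \<omega> (real i * d)"
  proof -
    have *: "sqrt 8 * s * ((a - b) / s) = sqrt 8 * a - sqrt 8 * b" if "s \<noteq> 0" for s a b :: real
    proof -
      have "sqrt 8 * s * ((a - b) / s) = sqrt 8 * (a - b)" using that by simp
      then show ?thesis by (simp add: right_diff_distrib)
    qed
    show ?thesis unfolding scaled_increment_def sle_driving_def real_sqrt_mult by (rule *) (use assms in simp)
  qed
  then show ?thesis by (simp add: step_def curve_def Let_def)
qed

text \<open>The chain follows g - W, \<open>euler\<close> follows g itself. Inside \<open>K\<close>
  the truncation at \<open>c\<close> is inactive, so the two steps agree. Only indices below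
  \<open>i\<close> must lie in \<open>K\<close>, so the exit position is included.\<close>

lemma chain_eq_euler:
  assumes d: "0 < d" and B0: "B 0 \<omega> = 0" and c: "0 < c"
    and K: "\<And>y. y \<in> K \<Longrightarrow> c \<le> cmod (fst y) \<and> c \<le> cmod (snd y)"
    and i: "\<And>j. j < i \<Longrightarrow> chain K d (a, b) (\<lambda>i. scaled_increment B d i \<omega>) j \<in> K"
  shows "chain K d (a, b) (\<lambda>i. scaled_increment B d i \<omega>) i =
    (euler c (sle_driving 8 B \<omega>) a d i - of_real (sle_driving 8 B \<omega> (real i * d)),
     euler c (sle_driving 8 B \<omega>) b d i - of_real (sle_driving 8 B \<omega> (real i * d)))"
  using i
proof (induction i)
  case 0
  then show ?case by (simp add: sle_driving_def B0)
next
  case (Suc i)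
  let ?W = "sle_driving 8 B \<omega>" and ?C = "chain K d (a, b) (\<lambda>i. scaled_increment B d i \<omega>)"
  have IH: "?C i = (euler c ?W a d i - of_real (?W (real i * d)), euler c ?W b d i - of_real (?W (real i * d)))"
    using Suc by auto
  have "?C i \<in> K" using Suc.prems by auto
  then have r: "reg_field c (euler c ?W a d i - of_real (?W (real i * d))) = 2 / (euler c ?W a d i - of_real (?W (real i * d)))"
    "reg_field c (euler c ?W b d i - of_real (?W (real i * d))) = 2 / (euler c ?W b d i - of_real (?W (real i * d)))"
    using K[of "?C i"] c by (auto simp: IH reg_field_eq)
  have "?C (Suc i) = step d (?C i) (scaled_increment B d i \<omega>)" using \<open>?C i \<in> K\<close> by simp
  also have "\<dots> = (euler c ?W a d (Suc i) - of_real (?W (real (Suc i) * d)), euler c ?W b d (Suc i) - of_real (?W (real (Suc i) * d)))"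
    unfolding step_scaled_increment[OF d] Let_def IH fst_conv snd_conv euler.simps r
    by (simp add: scaleR_conv_of_real algebra_simps)
  finally show ?case .
qed

text \<open>Driving increments are real, so Im Z changes only through 2 d / Z, which multiplies it
  by 1 - 2 d / |Z|^2; on \<open>K\<close> this factor is at least 1 - 2 d / e^2. A real second
  coordinate remains real.\<close>

lemma chain_bounds:
  assumes d: "0 < d" "2 * d \<le> e\<^sup>2" and e: "0 < e" and K: "\<And>y. y \<in> K \<Longrightarrow> e \<le> cmod (fst y)"
    and y: "0 < Im (fst y)" "Im (snd y) = 0"
  shows "Im (fst y) * (1 - 2 * d / e\<^sup>2) ^ i \<le> Im (fst (chain K d y x i)) \<and> Im (snd (chain K d y x i)) = 0"
proof (induction i)
  case 0 then show ?case using y by simp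
next
  case (Suc i)
  define q where "q = 1 - 2 * d / e\<^sup>2"
  have q: "0 \<le> q" "q \<le> 1" using d e by (auto simp: q_def)
  define u where "u = chain K d y x i"
  have u: "Im (fst y) * q ^ i \<le> Im (fst u)" "Im (snd u) = 0" using Suc by (auto simp: u_def q_def)
  have yq: "0 \<le> Im (fst y) * q ^ i" using y q by simp
  show ?case unfolding q_def[symmetric]
  proof (cases "u \<in> K")
    case False
    have "Im (fst y) * q ^ Suc i \<le> Im (fst y) * q ^ i" using y q by (intro mult_left_mono) (auto simp: mult_left_le_one_le)
    then show "Im (fst y) * q ^ Suc i \<le> Im (fst (chain K d y x (Suc i))) \<and> Im (snd (chain K d y x (Suc i))) = 0"
      using False u by (simp add: u_def[symmetric])
  next
    case True
    have eu: "e\<^sup>2 \<le> (cmod (fst u))\<^sup>2" using K[OF True] e by (intro power_mono) auto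
    have "Im (2 * of_real d / fst u) = - (2 * d * Im (fst u) / (cmod (fst u))\<^sup>2)"
      by (simp add: Im_divide cmod_power2)
    then have "Im (fst (step d u (x i))) = Im (fst u) * (1 - 2 * d / (cmod (fst u))\<^sup>2)"
      by (simp add: step_def curve_def algebra_simps)
    also have "\<dots> \<ge> Im (fst u) * q"
    proof -
      have "0 < e\<^sup>2" "0 < (cmod (fst u))\<^sup>2" using e less_le_trans[OF _ eu, of 0] by auto
      then have "2 * d / (cmod (fst u))\<^sup>2 \<le> 2 * d / e\<^sup>2" using eu d by (intro divide_left_mono mult_pos_pos) auto
      then show ?thesis unfolding q_def using yq u(1) by (intro mult_left_mono diff_left_mono) auto
    qed
    finally have "Im (fst u) * q \<le> Im (fst (step d u (x i)))" .
    moreover have "Im (fst y) * q ^ i * q \<le> Im (fst u) * q" using u(1) q by (intro mult_right_mono)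
    moreover have "Im (snd (step d u (x i))) = 0" using u(2) by (simp add: step_def curve_def Im_divide)
    ultimately show "Im (fst y) * q ^ Suc i \<le> Im (fst (chain K d y x (Suc i))) \<and> Im (snd (chain K d y x (Suc i))) = 0"
      using True by (simp add: u_def[symmetric] mult_ac)
  qed
qed

text \<open>From (1 + 2 x) (1 - x) >= 1 for x <= 1/2. With x = 2 (T / n) / e^2 the lower bound
  becomes exp (- 4 T / e^2), independent of \<open>n\<close>.\<close>

lemma exp_le_power_one_minus:
  assumes "0 \<le> x" "x \<le> 1 / 2" shows "exp (- (2 * real n * x)) \<le> (1 - x) ^ n"
proof -
  have "x * x \<le> x * (1/2)" using assms by (intro mult_left_mono) auto
  then have "1 \<le> (1 + 2 * x) * (1 - x)" by (simp add: algebra_simps)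
  also have "\<dots> \<le> exp (2 * x) * (1 - x)" using assms exp_ge_add_one_self[of "2 * x"] by (intro mult_right_mono) auto
  finally have "exp (- (2 * x)) \<le> 1 - x" by (simp add: exp_minus field_simps)
  then have "exp (- (2 * x)) ^ n \<le> (1 - x) ^ n" by (intro power_mono) auto
  moreover have "exp (- (2 * x)) ^ n = exp (- (2 * real n * x))" by (simp add: exp_of_nat_mult[symmetric] algebra_simps)
  ultimately show ?thesis by simp
qed

text \<open>Compares an endpoint \<open>u\<close> of the chain with the true pair (Z, X) at a time
  when both points are alive. That time is left existential because it varies with the step
  size.\<close>

definition shadows :: "(real \<Rightarrow> real) \<Rightarrow> complex \<Rightarrow> complex \<Rightarrow> real \<Rightarrow> real \<Rightarrow> complex \<times> complex \<Rightarrow> bool" where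
  "shadows W a b T h u \<longleftrightarrow> (\<exists>t\<in>{0..T}. \<exists>c>0. alive c W a t \<and> alive c W b t \<and>
      cmod (reg_flow c W a t - of_real (W t) - fst u) \<le> h \<and> cmod (reg_flow c W b t - of_real (W t) - snd u) \<le> h)"

lemma shadows_swap: "shadows W a b T h u \<Longrightarrow> shadows W b a T h (snd u, fst u)"
  unfolding shadows_def fst_conv snd_conv by blast

text \<open>Up to the first exit index \<open>i\<close> the chain consists of Euler points, and
  afterwards it is frozen, so its endpoint is the exit position, attained at time i * T / n. The
  threshold for \<open>n\<close> comes from the modulus of continuity of this one path.\<close>

lemma exit_path:
  assumes W: "continuous_on {0..} (\<lambda>t. B t \<omega>)" and B0: "B 0 \<omega> = 0" and e: "0 < e" and T: "0 < T"
    and K: "\<And>y. y \<in> K \<Longrightarrow> e \<le> cmod (fst y) \<and> e \<le> cmod (snd y)" and ab: "(a, b) \<in> K"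
  shows "\<forall>\<^sub>F n in sequentially. \<forall>u. u = chain K (T / real n) (a, b) (\<lambda>i. scaled_increment B (T / real n) i \<omega>) n \<longrightarrow> u \<notin> K \<longrightarrow>
    shadows (sle_driving 8 B \<omega>) a b T (e / 8) u"
proof -
  let ?W = "sle_driving 8 B \<omega>"
  show ?thesis
  proof (rule euler_alive[OF sle_driving_continuous[of B \<omega> 8, OF W] e, where T=T])
    fix d0 assume d0: "0 < d0" "\<And>z d i. 0 < d \<Longrightarrow> d \<le> d0 \<Longrightarrow> real i * d \<le> T \<Longrightarrow> 0 < i \<Longrightarrow>
      (\<And>j. j < i \<Longrightarrow> e \<le> cmod (euler (e/4) ?W z d j - of_real (?W (real j * d)))) \<Longrightarrow>
      alive (e/4) ?W z (real i * d) \<and> cmod (reg_flow (e/4) ?W z (real i * d) - euler (e/4) ?W z d i) \<le> e / 8"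
  have "\<forall>\<^sub>F n in sequentially. T / real n < d0"
    using order_tendstoD(2)[OF lim_const_over_n[of T] d0(1)] .
  then show ?thesis
    using eventually_gt_at_top[of "0::nat"]
  proof eventually_elim
    case (elim n)
    define d where "d = T / real n"
    have d: "0 < d" "d \<le> d0" "real n * d = T" using elim T by (auto simp: d_def)
    define C where "C = chain K d (a, b) (\<lambda>i. scaled_increment B d i \<omega>)"
    show ?case unfolding d_def[symmetric] C_def[symmetric]
    proof (intro allI impI)
      fix u assume u: "u = C n" "u \<notin> K"
      define i where "i = (LEAST i. C i \<notin> K)"
      have ex: "C n \<notin> K" using u by simp
      have i1: "C i \<notin> K" unfolding i_def by (rule LeastI[of "\<lambda>i. C i \<notin> K", OF ex])
      have i2: "i \<le> n" unfolding i_def by (rule Least_le[of "\<lambda>i. C i \<notin> K", OF ex])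
      have i3: "C j \<in> K" if "j < i" for j
        using not_less_Least[of j "\<lambda>i. C i \<notin> K"] that unfolding i_def by simp
      note i = i1 i2 i3
      have i0: "0 < i" using i(1) ab by (cases i) (auto simp: C_def)
      have stay: "C (i + m) = C i" for m by (induction m) (use i(1) in \<open>auto simp: C_def\<close>)
      have Ci: "C i = u" using stay[of "n - i"] i(2) u by simp
      have eu: "C j = (euler (e/4) ?W a d j - of_real (?W (real j * d)), euler (e/4) ?W b d j - of_real (?W (real j * d)))" if "j \<le> i" for j
        unfolding C_def
      proof (rule chain_eq_euler[where B=B and \<omega>=\<omega>, OF d(1) B0])
        show "e/4 \<le> cmod (fst y) \<and> e/4 \<le> cmod (snd y)" if "y \<in> K" for y using K[OF that] e by auto
        show "chain K d (a, b) (\<lambda>i. scaled_increment B d i \<omega>) k \<in> K" if "k < j" for k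
          using i(3)[of k] that \<open>j \<le> i\<close> by (simp add: C_def)
      qed (use e in simp)
      have iT: "real i * d \<le> T" using i(2) d by (metis mult_right_mono of_nat_le_iff less_imp_le)
      have A: "alive (e/4) ?W a (real i * d) \<and> cmod (reg_flow (e/4) ?W a (real i * d) - euler (e/4) ?W a d i) \<le> e / 8"
      proof (rule d0(2)[OF d(1,2) iT i0])
        show "e \<le> cmod (euler (e/4) ?W a d j - of_real (?W (real j * d)))" if "j < i" for j
          using K[OF i(3)[OF that]] eu[of j] that by auto
      qed
      have A': "alive (e/4) ?W b (real i * d) \<and> cmod (reg_flow (e/4) ?W b (real i * d) - euler (e/4) ?W b d i) \<le> e / 8"
      proof (rule d0(2)[OF d(1,2) iT i0])
        show "e \<le> cmod (euler (e/4) ?W b d j - of_real (?W (real j * d)))" if "j < i" for j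
          using K[OF i(3)[OF that]] eu[of j] that by auto
      qed
      have fu: "fst u = euler (e/4) ?W a d i - of_real (?W (real i * d))" "snd u = euler (e/4) ?W b d i - of_real (?W (real i * d))"
        using eu[of i] Ci by auto
      show "shadows ?W a b T (e / 8) u"
        unfolding shadows_def using A A' iT d e by (intro bexI[of _ "real i * d"] exI[of _ "e/4"]) (auto simp: fu)
    qed
  qed
  qed
qed

context standard_brownian_motion
begin

lemma stopped_chain_low:
  assumes e: "0 < e" and T: "0 < T" and z: "0 < Im z" and K: "\<And>y. y \<in> K \<Longrightarrow> e \<le> cmod (fst y)"
  shows "\<forall>\<^sub>F n in sequentially. \<forall>\<omega>\<in>space M. Im z * exp (- (4 * T / e\<^sup>2)) \<le> Im (fst (stopped_chain K (z, 1) T n \<omega>)) \<and>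
        Im (snd (stopped_chain K (z, 1) T n \<omega>)) = 0"
proof -
  have "\<forall>\<^sub>F n in sequentially. T / real n < e\<^sup>2 / 4"
    by (rule order_tendstoD(2)[OF lim_const_over_n[of T]]) (use e in simp)
  then show ?thesis
    using eventually_gt_at_top[of "0::nat"]
  proof eventually_elim
    case (elim n)
    let ?d = "T / real n"
    have d1: "0 < ?d" using elim T by simp
    have d2: "2 * ?d \<le> e\<^sup>2" using elim(1) d1 by linarith
    note d = d1 d2
    have x: "0 \<le> 2 * ?d / e\<^sup>2" "2 * ?d / e\<^sup>2 \<le> 1 / 2" using elim T e by (auto simp: field_simps)
    have "exp (- (4 * T / e\<^sup>2)) \<le> (1 - 2 * ?d / e\<^sup>2) ^ n"
      using exp_le_power_one_minus[OF x, of n] elim by simp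
    then have low: "Im z * exp (- (4 * T / e\<^sup>2)) \<le> Im z * (1 - 2 * ?d / e\<^sup>2) ^ n" using z by (intro mult_left_mono) auto
    show ?case
    proof
      fix \<omega> assume "\<omega> \<in> space M"
      have "Im (fst (z, 1 :: complex)) * (1 - 2 * ?d / e\<^sup>2) ^ n \<le> Im (fst (stopped_chain K (z, 1) T n \<omega>)) \<and>
          Im (snd (stopped_chain K (z, 1) T n \<omega>)) = 0"
        unfolding stopped_chain_def by (rule chain_bounds[OF d e K]) (use z in auto)
      then show "Im z * exp (- (4 * T / e\<^sup>2)) \<le> Im (fst (stopped_chain K (z, 1) T n \<omega>)) \<and>
          Im (snd (stopped_chain K (z, 1) T n \<omega>)) = 0"
        using low by auto
    qed
  qed
qed

text \<open>The first parameter of \<open>exit_region\<close> is the lower bound for Im Z that the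
  chain keeps up to time \<open>T\<close> once the steps are small, so it makes the region compact
  without causing exits. The condition 0 < n rules out the degenerate step length T / 0.\<close>

definition exit_event :: "complex \<Rightarrow> real \<Rightarrow> real \<Rightarrow> real \<Rightarrow> (complex \<times> complex) set \<Rightarrow> real \<Rightarrow> nat \<Rightarrow> 'a set" where
  "exit_event z L k T E e n = (let K = exit_region (Im z * exp (- (4 * T / e\<^sup>2))) e (L\<^sup>2) k (exp (- L)) in
     {\<omega>\<in>space M. 0 < n \<and> stopped_chain K (z, 1) T n \<omega> \<in> E - K})"

lemma exit_event_estimate:
  assumes z: "0 < Im z" and par: "0 < L" "0 < k" "0 < T" "0 < g" "0 \<le> q"
    and e: "0 < e" "e \<le> 1" "e \<le> cmod z"
    and zL: "cmod z \<le> L\<^sup>2" "1 \<le> L" "exp (- L) \<le> cmod (z - 1)" "Im (strip_map z) \<le> k"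
    and G: "test_function (exit_domain (L\<^sup>2) k) G 0" "\<And>y. y \<in> exit_domain (L\<^sup>2) k \<Longrightarrow> 0 \<le> Re (G y) \<and> Re (G y) \<le> 1"
    and E: "E \<in> sets borel"
      "\<And>y. y \<in> exit_domain (L\<^sup>2) k \<Longrightarrow> cmod (fst y) < e \<or> cmod (snd y) < e \<Longrightarrow> exp (- L) \<le> cmod (fst y - snd y) \<Longrightarrow> y \<in> E \<or> Re (G y) \<le> q"
  shows "exit_event z L k T E e n \<in> events"
    and "\<forall>\<^sub>F n in sequentially. Re (G (z, 1)) - q - Re (lyapunov k (z, 1)) / L - Im (strip_map z) / k - (L\<^sup>2 + 1)\<^sup>2 / (12 * T) - g
     \<le> prob (exit_event z L k T E e n)"
proof -
  define m where "m = Im z * exp (- (4 * T / e\<^sup>2))"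
  define K where "K = exit_region m e (L\<^sup>2) k (exp (- L))"
  have m: "0 < m" using z by (simp add: m_def)
  have mz: "m \<le> Im z" using z par e by (simp add: m_def mult_le_cancel_left1)
  have "1 * 1 \<le> L * L" using zL(2) by (intro mult_mono) auto
  then have L2: "1 \<le> L\<^sup>2" by (simp add: power2_eq_square)
  have y: "(z, 1) \<in> K" using zL e L2 mz by (auto simp: K_def exit_region_def)
  have Kb: "K \<in> sets borel" unfolding K_def by (intro borel_compact compact_exit_region m e)
  have ev: "exit_event z L k T E e n = {\<omega>\<in>space M. 0 < n \<and> stopped_chain K (z, 1) T n \<omega> \<in> E - K}" for n
    by (simp add: exit_event_def Let_def K_def m_def)
  show "exit_event z L k T E e n \<in> events"
  proof (cases "0 < n")
    case True
    have EK: "E - K \<in> sets borel" using E(1) Kb by auto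
    have "exit_event z L k T E e n = stopped_chain K (z, 1) T n -` (E - K) \<inter> space M" unfolding ev using True by auto
    then show ?thesis using measurable_sets[OF borel_measurable_stopped_chain[OF Kb par(3) True] EK] by simp
  qed (simp add: ev)
  have low: "\<forall>\<^sub>F n in sequentially. \<forall>\<omega>\<in>space M. m \<le> Im (fst (stopped_chain K (z, 1) T n \<omega>)) \<and> Im (snd (stopped_chain K (z, 1) T n \<omega>)) = 0"
    unfolding m_def by (rule stopped_chain_low[OF e(1) par(3) z]) (auto simp: K_def exit_region_def)
  have "\<forall>\<^sub>F n in sequentially. Re (G (z, 1)) - q - Re (lyapunov k (z, 1)) / L - Im (strip_map (fst (z, 1 :: complex) / snd (z, 1 :: complex))) / k - (L\<^sup>2 + 1)\<^sup>2 / (12 * T) - g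
     \<le> prob {\<omega>\<in>space M. stopped_chain K (z, 1) T n \<omega> \<in> E - K}"
  proof -
    have y1: "(z, 1) \<in> exit_region m e (L\<^sup>2) k (exp (- L))" using y by (simp add: K_def)
    have low1: "\<forall>\<^sub>F n in sequentially. \<forall>\<omega>\<in>space M. m \<le> Im (fst (stopped_chain (exit_region m e (L\<^sup>2) k (exp (- L))) (z, 1) T n \<omega>)) \<and>
       Im (snd (stopped_chain (exit_region m e (L\<^sup>2) k (exp (- L))) (z, 1) T n \<omega>)) = 0"
      using low by (simp only: K_def)
    note X = exit_probability[where G=G and E=E and y="(z, 1)" and m=m and e=e and L=L and k=k and T=T and g=g and q=q and R="L\<^sup>2" and r="exp (- L)"]
    show ?thesis unfolding K_def
    proof (rule X[OF m e(1) par refl refl y1])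
      show "snd (z, 1 :: complex) = 1" by simp
    qed (use G E low1 in auto)
  qed
  then show "\<forall>\<^sub>F n in sequentially. Re (G (z, 1)) - q - Re (lyapunov k (z, 1)) / L - Im (strip_map z) / k - (L\<^sup>2 + 1)\<^sup>2 / (12 * T) - g
     \<le> prob (exit_event z L k T E e n)"
    using eventually_gt_at_top[of "0::nat"] by eventually_elim (simp add: ev)
qed

text \<open>Infinitely many \<open>n\<close> meet the cofinitely many of \<open>exit_path\<close>,
  so for some \<open>n\<close> the chain exits into \<open>E\<close> and also follows the
  flow.\<close>

lemma exit_event_path:
  assumes w: "\<omega> \<in> space M" and z: "0 < Im z" and par: "0 < L" "0 < k" "0 < T" and e: "0 < e" "e \<le> 1" "e \<le> cmod z"
    and zL: "cmod z \<le> L\<^sup>2" "1 \<le> L" "exp (- L) \<le> cmod (z - 1)" "Im (strip_map z) \<le> k"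
    and fr: "\<exists>\<^sub>F n in sequentially. \<omega> \<in> exit_event z L k T E e n"
  shows "\<exists>u\<in>E. shadows (sle_driving 8 B \<omega>) z 1 T (e / 8) u"
proof -
  define m where "m = Im z * exp (- (4 * T / e\<^sup>2))"
  define K where "K = exit_region m e (L\<^sup>2) k (exp (- L))"
  have mz: "m \<le> Im z" using z par e by (simp add: m_def mult_le_cancel_left1)
  have "1 * 1 \<le> L * L" using zL(2) by (intro mult_mono) auto
  then have L2: "1 \<le> L\<^sup>2" by (simp add: power2_eq_square)
  have y: "(z, 1) \<in> K" using zL e L2 mz by (auto simp: K_def exit_region_def)
  have Ke: "e \<le> cmod (fst y) \<and> e \<le> cmod (snd y)" if "y \<in> K" for y
    using that complex_Re_le_cmod[of "snd y"] by (auto simp: K_def exit_region_def)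
  have "\<exists>\<^sub>F n in sequentially. \<omega> \<in> exit_event z L k T E e n \<and> (\<forall>u. u = chain K (T / real n) (z, 1) (\<lambda>i. scaled_increment B (T / real n) i \<omega>) n \<longrightarrow> u \<notin> K \<longrightarrow>
    shadows (sle_driving 8 B \<omega>) z 1 T (e / 8) u)"
    by (subst conj_commute) (rule frequently_eventually_conj[OF fr exit_path[where K=K and B=B and \<omega>=\<omega> and a=z and b=1, OF continuous_paths[OF w] start[OF w] e(1) par(3) Ke y]])
  then obtain n where n: "\<omega> \<in> exit_event z L k T E e n" "\<forall>u. u = chain K (T / real n) (z, 1) (\<lambda>i. scaled_increment B (T / real n) i \<omega>) n \<longrightarrow> u \<notin> K \<longrightarrow>
    shadows (sle_driving 8 B \<omega>) z 1 T (e / 8) u"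
    using frequently_ex by blast
  have u: "stopped_chain K (z, 1) T n \<omega> \<in> E" "stopped_chain K (z, 1) T n \<omega> \<notin> K"
    using n(1) by (auto simp: exit_event_def Let_def K_def m_def)
  show ?thesis using n(2)[rule_format, OF _ u(2)] u(1) unfolding stopped_chain_def by blast
qed

end

section \<open>The swallowing probability\<close>

lemma strip_ratio_half_strip:
  "y \<in> pair_domain \<Longrightarrow> 0 < Re (strip_map (fst y / snd y)) \<and> Re (strip_map (fst y / snd y)) < 1"
  using strip_map_half_plane(1)[of "fst y / snd y"] by (auto simp: pair_domain_def half_strip_def)

context standard_brownian_motion
begin

text \<open>General in \<open>G\<close> to serve for both F and 1 - F. By \<open>near\<close>, an
  exit at small |Z| or small X either is of the wanted kind, recorded by \<open>E\<close>, or
  happens where Re G is small; by \<open>path\<close>, wanted exits for arbitrarily small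
  \<open>e\<close> imply the event \<open>A\<close>. The probability passes through two limsups,
  over the number of steps and over \<open>e\<close>.\<close>

lemma harmonic_le_prob:
  assumes z: "0 < Im z" and A: "A \<in> events"
    and G: "test_function pair_domain G 0" "\<And>y. y \<in> pair_domain \<Longrightarrow> 0 \<le> Re (G y) \<and> Re (G y) \<le> 1"
    and E: "\<And>L e. E L e \<in> sets borel"
    and near: "\<And>L g. 0 < g \<Longrightarrow> \<exists>e0>0. \<forall>e. 0 < e \<longrightarrow> e < e0 \<longrightarrow> (\<forall>y\<in>pair_domain. cmod (fst y) < e \<or> cmod (snd y) < e \<longrightarrow>
       exp (- L) \<le> cmod (fst y - snd y) \<longrightarrow> y \<in> E L e \<or> Re (G y) \<le> g)"
    and path: "\<And>\<omega> L T. \<omega> \<in> space M \<Longrightarrow> (\<And>e. 0 < e \<Longrightarrow> \<exists>e'>0. e' \<le> e \<and> (\<exists>u\<in>E L e'. shadows (sle_driving 8 B \<omega>) z 1 T (e' / 8) u)) \<Longrightarrow> \<omega> \<in> A"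
  shows "Re (G (z, 1)) \<le> prob A"
proof (rule field_le_epsilon)
  fix g :: real assume g: "0 < g"
  \<comment> \<open>The parameters are fixed in the order \<open>k\<close>, \<open>L\<close>, \<open>T\<close>; none of them depends on \<open>e\<close>, which tends to \<open>0\<close> last.\<close>
  define d where "d = g / 5"
  have d: "0 < d" using g by (simp add: d_def)
  have zd: "(z, 1) \<in> pair_domain" using real_pair_domain[of z 1] z by simp
  define a where "a = Im (strip_map z)"
  have a: "0 < a" using strip_map_half_plane(1)[OF z] by (simp add: a_def half_strip_def)
  define k where "k = a + a / d"
  have k: "0 < k" "a \<le> k" "a / k \<le> d"
  proof -
    show "0 < k" "a \<le> k" using a d by (auto simp: k_def add_pos_pos)
    have "a / k \<le> a / (a / d)" using a d by (intro divide_left_mono) (auto simp: k_def add_pos_pos intro!: mult_pos_pos)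
    then show "a / k \<le> d" using a by simp
  qed
  define l where "l = Re (lyapunov k (z, 1))"
  define L where "L = 1 + cmod z + \<bar>ln (cmod (z - 1))\<bar> + \<bar>l\<bar> / d"
  have ld: "0 \<le> \<bar>l\<bar> / d" using d by simp
  have L: "1 \<le> L" "cmod z \<le> L" "- ln (cmod (z - 1)) \<le> L" "\<bar>l\<bar> / d \<le> L"
    using ld norm_ge_zero[of z] abs_ge_minus_self[of "ln (cmod (z - 1))"] unfolding L_def by linarith+
  have L0: "0 < L" using L by simp
  have zL: "cmod z \<le> L\<^sup>2"
  proof -
    have "L * 1 \<le> L * L" using L by (intro mult_left_mono) auto
    then show ?thesis using L(2) unfolding power2_eq_square by linarith
  qed
  have z1: "exp (- L) \<le> cmod (z - 1)"
  proof -
    have "0 < cmod (z - 1)" using z by auto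
    moreover have "exp (- L) \<le> exp (ln (cmod (z - 1)))" using L(3) by simp
    ultimately show ?thesis by simp
  qed
  have lL: "l / L \<le> d"
  proof -
    have "l \<le> \<bar>l\<bar>" by simp
    also have "\<bar>l\<bar> \<le> d * L" using L(4) d by (simp add: divide_le_eq mult.commute)
    finally show ?thesis using L0 by (simp add: divide_le_eq)
  qed
  define T where "T = (L\<^sup>2 + 1)\<^sup>2 / (12 * d)"
  have L21: "0 < (L\<^sup>2 + 1)\<^sup>2" by (rule zero_less_power) (simp add: add_nonneg_pos)
  have T: "0 < T" "(L\<^sup>2 + 1)\<^sup>2 / (12 * T) = d" using d L21 by (auto simp: T_def)
  obtain e0 where e0: "0 < e0" "\<And>e y. 0 < e \<Longrightarrow> e < e0 \<Longrightarrow> y \<in> pair_domain \<Longrightarrow> cmod (fst y) < e \<or> cmod (snd y) < e \<Longrightarrow>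
       exp (- L) \<le> cmod (fst y - snd y) \<Longrightarrow> y \<in> E L e \<or> Re (G y) \<le> d"
    using near[OF d, of L] by blast
  define e1 where "e1 = min e0 (min 1 (cmod z))"
  have "z \<noteq> 0" using z by auto
  then have e1: "0 < e1" "e1 \<le> e0" "e1 \<le> 1" "e1 \<le> cmod z" using e0 by (auto simp: e1_def)
  \<comment> \<open>The shift by 2 makes e j < e1 strict already for j = 0.\<close>
  define e where "e j = e1 / real (j + 2)" for j
  have e: "0 < e j" "e j < e1" for j using e1(1) by (auto simp: e_def divide_less_eq)
  have sub: "exit_domain (L\<^sup>2) k \<subseteq> pair_domain" by (auto simp: exit_domain_def)
  let ?X = "\<lambda>j n. exit_event z L k T (E L (e j)) (e j) n"
  have est: "?X j n \<in> events" "\<forall>\<^sub>F n in sequentially. Re (G (z, 1)) - g \<le> prob (?X j n)" for j n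
  proof -
    have ej: "e j \<le> 1" "e j \<le> cmod z" "e j < e0" using e(2)[of j] e1 by linarith+
    have aux: "Im (strip_map z) \<le> k" using k(2) by (simp add: a_def)
    have E2: "y \<in> E L (e j) \<or> Re (G y) \<le> d" if "y \<in> exit_domain (L\<^sup>2) k" "cmod (fst y) < e j \<or> cmod (snd y) < e j"
      "exp (- L) \<le> cmod (fst y - snd y)" for y
      using e0(2)[OF e(1)[of j] ej(3) _ that(2,3)] that(1) sub by blast
    have G2: "0 \<le> Re (G y) \<and> Re (G y) \<le> 1" if "y \<in> exit_domain (L\<^sup>2) k" for y using G(2) that sub by blast
    note est = exit_event_estimate[where G=G and E="E L (e j)" and q=d and g=d,
      OF z L0 k(1) T(1) d less_imp_le[OF d] e(1) ej(1,2) zL L(1) z1 aux test_function_subset[OF G(1) sub]]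
    show "?X j n \<in> events" by (rule est(1)) (use G2 E E2 in auto)
    \<comment> \<open>Five losses of d = g / 5 each: \<open>q\<close>, the Lyapunov term, the term
      with Im F, the time term and the slack from the limit in \<open>n\<close>.\<close>
    have "\<forall>\<^sub>F n in sequentially. Re (G (z, 1)) - d - Re (lyapunov k (z, 1)) / L - Im (strip_map z) / k - (L\<^sup>2 + 1)\<^sup>2 / (12 * T) - d \<le> prob (?X j n)"
      by (rule est(2)) (use G2 E E2 in auto)
    then show "\<forall>\<^sub>F n in sequentially. Re (G (z, 1)) - g \<le> prob (?X j n)"
    proof (rule eventually_mono)
      fix n assume "Re (G (z, 1)) - d - Re (lyapunov k (z, 1)) / L - Im (strip_map z) / k - (L\<^sup>2 + 1)\<^sup>2 / (12 * T) - d \<le> prob (?X j n)"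
      then show "Re (G (z, 1)) - g \<le> prob (?X j n)"
        unfolding T(2) l_def[symmetric] a_def[symmetric] using lL k(3) by (simp add: d_def)
    qed
  qed
  define C where "C j = {\<omega>\<in>space M. \<exists>\<^sub>F n in sequentially. \<omega> \<in> ?X j n}" for j
  have C: "C j \<in> events" "Re (G (z, 1)) - g \<le> prob (C j)" for j
    unfolding C_def
    by (rule prob_frequently_ge[OF est(1) eventually_frequently[OF sequentially_bot est(2)]],
        rule prob_frequently_ge[OF est(1) eventually_frequently[OF sequentially_bot est(2)]])
  define D where "D = {\<omega>\<in>space M. \<exists>\<^sub>F j in sequentially. \<omega> \<in> C j}"
  have fr: "\<exists>\<^sub>F j in sequentially. Re (G (z, 1)) - g \<le> prob (C j)"
    using C(2) by (intro eventually_frequently[OF sequentially_bot] always_eventually allI)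
  have D: "Re (G (z, 1)) - g \<le> prob D" unfolding D_def by (rule prob_frequently_ge(2)[OF C(1) fr])
  have "D \<subseteq> A"
  proof
    fix \<omega> assume w: "\<omega> \<in> D"
    then have ws: "\<omega> \<in> space M" by (simp add: D_def)
    show "\<omega> \<in> A"
    proof (rule path[OF ws, of L T])
      fix b :: real assume b: "0 < b"
      have "(\<lambda>j. e j) \<longlonglongrightarrow> 0"
        unfolding e_def using LIMSEQ_ignore_initial_segment[OF lim_const_over_n[of e1], of 2] by simp
      then have "\<forall>\<^sub>F j in sequentially. e j < b" using b by (rule order_tendstoD)
      moreover have "\<exists>\<^sub>F j in sequentially. \<omega> \<in> C j" using w by (simp add: D_def)
      ultimately have "\<exists>\<^sub>F j in sequentially. e j < b \<and> \<omega> \<in> C j" by (intro frequently_eventually_conj)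
      then obtain j where j: "e j < b" "\<omega> \<in> C j" using frequently_ex by blast
      have ej: "e j \<le> 1" "e j \<le> cmod z" using e(2)[of j] e1 by linarith+
      have frj: "\<exists>\<^sub>F n in sequentially. \<omega> \<in> ?X j n" using j(2) by (simp add: C_def)
      have aux: "Im (strip_map z) \<le> k" using k(2) by (simp add: a_def)
      note p = exit_event_path[OF ws z L0 k(1) T(1) e(1) ej zL L(1) z1 aux frj]
      show "\<exists>e'>0. e' \<le> b \<and> (\<exists>u\<in>E L e'. shadows (sle_driving 8 B \<omega>) z 1 T (e' / 8) u)"
        by (rule exI[of _ "e j"]) (intro conjI e(1) less_imp_le[OF j(1)] p)
    qed
  qed
  then have "prob D \<le> prob A" by (rule finite_measure_mono[OF _ A])
  then show "Re (G (z, 1)) \<le> prob A + g" using D by simp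
qed

lemma sets_swallowed_before: "{\<omega>\<in>space M. swallowing_time (sle_driving 8 B \<omega>) a < swallowing_time (sle_driving 8 B \<omega>) b} \<in> events"
proof -
  have "{\<omega>\<in>space M. swallowing_time (\<lambda>t. sle_driving 8 B \<omega> t) a < swallowing_time (\<lambda>t. sle_driving 8 B \<omega> t) b} \<in> events"
  proof (rule sets_swallowing_time_less)
    show "(\<lambda>\<omega>. sle_driving 8 B \<omega> t) \<in> borel_measurable M" if "0 \<le> t" for t
      unfolding sle_driving_def using random_variable_B[OF that] by measurable
    show "continuous_on {0..} (\<lambda>t. sle_driving 8 B \<omega> t)" if "\<omega> \<in> space M" for \<omega>
      by (rule sle_driving_continuous[of B \<omega>, OF continuous_paths[OF that]])
  qed
  then show ?thesis by simp
qed

text \<open>Errors of e' / 8 in both coordinates cost at most e' / 4 of the separation exp (- L), so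
  e' <= exp (- L) leaves at least half of it, and e' <= e / 2 keeps the first point within
  \<open>e\<close> of the driving function.\<close>

lemma swallowed_before_limit:
  assumes w: "\<omega> \<in> space M"
    and H: "\<And>e. 0 < e \<Longrightarrow> \<exists>e'>0. e' \<le> e \<and> (\<exists>u. cmod (fst u) < e' \<and> exp (- L) \<le> cmod (fst u - snd u) \<and>
      shadows (sle_driving 8 B \<omega>) a b T (e' / 8) u)"
  shows "swallowing_time (sle_driving 8 B \<omega>) a < swallowing_time (sle_driving 8 B \<omega>) b"
proof (rule swallowed_before[where r="exp (- L) / 2" and T=T])
  let ?W = "sle_driving 8 B \<omega>"
  show "continuous_on {0..} ?W" by (rule sle_driving_continuous[of B \<omega>, OF continuous_paths[OF w]])
  fix e :: real assume e: "0 < e"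
  obtain e' u where u: "0 < e'" "e' \<le> min (e / 2) (exp (- L))" "cmod (fst u) < e'" "exp (- L) \<le> cmod (fst u - snd u)"
    "shadows ?W a b T (e' / 8) u"
    using H[of "min (e / 2) (exp (- L))"] e by auto
  then obtain t c where tc: "t \<in> {0..T}" "0 < c" "alive c ?W a t" "alive c ?W b t"
    "cmod (reg_flow c ?W a t - of_real (?W t) - fst u) \<le> e' / 8" "cmod (reg_flow c ?W b t - of_real (?W t) - snd u) \<le> e' / 8"
    unfolding shadows_def by blast
  have "reg_flow c ?W a t - of_real (?W t) = (reg_flow c ?W a t - of_real (?W t) - fst u) + fst u" by simp
  then have "cmod (reg_flow c ?W a t - of_real (?W t)) \<le> cmod (reg_flow c ?W a t - of_real (?W t) - fst u) + cmod (fst u)"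
    using norm_triangle_ineq by metis
  moreover have "e' \<le> e / 2" "e' \<le> exp (- L)" using u(2) by auto
  ultimately have 1: "cmod (reg_flow c ?W a t - of_real (?W t)) \<le> e" using u(3) tc(5) e by linarith
  have tri: "cmod (p - q) \<le> cmod (x - y) + (cmod (x - w - p) + cmod (y - w - q))" for p q x y w :: complex
  proof -
    have "p - q = (x - y) - ((x - w - p) - (y - w - q))" by simp
    then show ?thesis using order_trans[OF norm_triangle_ineq4 add_left_mono[OF norm_triangle_ineq4]] by metis
  qed
  have 2: "exp (- L) / 2 \<le> cmod (reg_flow c ?W a t - reg_flow c ?W b t)"
    using u(1,4) tc(5,6) \<open>e' \<le> exp (- L)\<close>
      tri[of "fst u" "snd u" "reg_flow c ?W a t" "reg_flow c ?W b t" "of_real (?W t)"] by linarith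
  show "\<exists>t\<in>{0..T}. \<exists>c>0. alive c ?W a t \<and> alive c ?W b t \<and> cmod (reg_flow c ?W a t - of_real (?W t)) \<le> e \<and>
     exp (- L) / 2 \<le> cmod (reg_flow c ?W a t - reg_flow c ?W b t)"
    using tc(1-4) 1 2 by blast
qed simp

text \<open>Since |Z - X| >= exp (- L), a small X makes Z / X large, where F is near 0, and a small
  Z makes Z / X small, where F is near 1. The two events are disjoint and their lower bounds Re F
  and 1 - Re F add up to 1, so both are equalities.\<close>

lemma prob_swallowed_before:
  assumes z: "0 < Im z"
    and l0: "(strip_map \<longlongrightarrow> 1) (at 0 within upper_half_plane)"
    and linf: "(strip_map \<longlongrightarrow> 0) (inf at_infinity (principal upper_half_plane))"
  shows "prob {\<omega>\<in>space M. swallowing_time (sle_driving 8 B \<omega>) z < swallowing_time (sle_driving 8 B \<omega>) 1} = Re (strip_map z)"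
proof -
  let ?t = "\<lambda>a \<omega>. swallowing_time (sle_driving 8 B \<omega>) a"
  let ?A = "{\<omega>\<in>space M. ?t z \<omega> < ?t 1 \<omega>}" and ?B = "{\<omega>\<in>space M. ?t 1 \<omega> < ?t z \<omega>}"
  let ?F = "\<lambda>y. strip_map (fst y / snd y)"
  have ratio: "fst y / snd y \<in> upper_half_plane" "0 < cmod (snd y)" "0 < cmod (fst y)" if "y \<in> pair_domain" for y
    using that by (auto simp: pair_domain_def upper_half_plane_def)
  have bor: "{y. cmod (fst y) < e \<and> exp (- L) \<le> cmod (fst y - snd y)} \<in> sets (borel :: (complex \<times> complex) measure)"
    "{y. cmod (snd y) < e \<and> exp (- L) \<le> cmod (fst y - snd y)} \<in> sets (borel :: (complex \<times> complex) measure)" for e L :: real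
  proof -
    have "open {y :: complex \<times> complex. cmod (fst y) < e}" "open {y :: complex \<times> complex. cmod (snd y) < e}"
      by (intro open_Collect_less continuous_intros)+
    moreover have "closed {y :: complex \<times> complex. exp (- L) \<le> cmod (fst y - snd y)}"
      by (intro closed_Collect_le continuous_intros)
    ultimately show "{y. cmod (fst y) < e \<and> exp (- L) \<le> cmod (fst y - snd y)} \<in> sets (borel :: (complex \<times> complex) measure)"
      "{y. cmod (snd y) < e \<and> exp (- L) \<le> cmod (fst y - snd y)} \<in> sets (borel :: (complex \<times> complex) measure)"
      unfolding Collect_conj_eq by (auto intro!: sets.Int)
  qed
  have "Re (?F (z, 1)) \<le> prob ?A"
  proof (rule harmonic_le_prob[where E="\<lambda>L e. {y. cmod (fst y) < e \<and> exp (- L) \<le> cmod (fst y - snd y)}", OF z sets_swallowed_before test_function_strip_map])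
    show "0 \<le> Re (?F y) \<and> Re (?F y) \<le> 1" if "y \<in> pair_domain" for y using strip_ratio_half_strip[OF that] by simp
    show "{y. cmod (fst y) < e \<and> exp (- L) \<le> cmod (fst y - snd y)} \<in> sets borel" for L e :: real by (rule bor)
    fix L g :: real assume g: "0 < g"
    have "\<forall>\<^sub>F w in inf at_infinity (principal upper_half_plane). dist (strip_map w) 0 < g" using linf g by (rule tendstoD)
    then obtain b where b: "\<And>w. b \<le> cmod w \<Longrightarrow> w \<in> upper_half_plane \<Longrightarrow> cmod (strip_map w) < g"
      unfolding eventually_inf_principal eventually_at_infinity by auto
    \<comment> \<open>If |X| < e0, then (|b| + 1) |X| <= exp (- L) <= |Z| + |X|, hence |Z| >= |b|
      |X|.\<close>
    define e0 where "e0 = exp (- L) / (\<bar>b\<bar> + 1)"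
    show "\<exists>e0>0. \<forall>e. 0 < e \<longrightarrow> e < e0 \<longrightarrow> (\<forall>y\<in>pair_domain. cmod (fst y) < e \<or> cmod (snd y) < e \<longrightarrow>
       exp (- L) \<le> cmod (fst y - snd y) \<longrightarrow> y \<in> {y. cmod (fst y) < e \<and> exp (- L) \<le> cmod (fst y - snd y)} \<or> Re (?F y) \<le> g)"
    proof (rule exI[of _ e0], intro conjI allI impI ballI)
      show "0 < e0" by (simp add: e0_def add_nonneg_pos)
      fix e y assume e: "0 < e" "e < e0" and y: "y \<in> pair_domain" "cmod (fst y) < e \<or> cmod (snd y) < e" "exp (- L) \<le> cmod (fst y - snd y)"
      show "y \<in> {y. cmod (fst y) < e \<and> exp (- L) \<le> cmod (fst y - snd y)} \<or> Re (?F y) \<le> g"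
      proof (cases "cmod (fst y) < e")
        case True then show ?thesis using y by simp
      next
        case False
        then have s: "cmod (snd y) < e" using y by simp
        have "cmod (fst y - snd y) \<le> cmod (fst y) + cmod (snd y)" by (rule norm_triangle_ineq4)
        then have 1: "exp (- L) \<le> cmod (fst y) + cmod (snd y)" using y by linarith
        have "cmod (snd y) * (\<bar>b\<bar> + 1) \<le> e0 * (\<bar>b\<bar> + 1)" using s e by (intro mult_right_mono) auto
        also have "\<dots> = exp (- L)" by (simp add: e0_def add_nonneg_pos less_imp_neq[symmetric])
        finally have "cmod (snd y) * \<bar>b\<bar> \<le> cmod (fst y)" using 1 by (simp add: algebra_simps)
        then have "\<bar>b\<bar> \<le> cmod (fst y / snd y)" using ratio[OF y(1)] by (simp add: norm_divide le_divide_eq mult.commute)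
        then have "cmod (?F y) < g" using ratio[OF y(1)] by (intro b) auto
        then show ?thesis using complex_Re_le_cmod[of "?F y"] by simp
      qed
    qed
  next
    fix \<omega> L T
    assume w: "\<omega> \<in> space M" and H: "\<And>e. 0 < e \<Longrightarrow> \<exists>e'>0. e' \<le> e \<and> (\<exists>u\<in>{y. cmod (fst y) < e' \<and> exp (- L) \<le> cmod (fst y - snd y)}. shadows (sle_driving 8 B \<omega>) z 1 T (e' / 8) u)"
    have "?t z \<omega> < ?t 1 \<omega>"
    proof (rule swallowed_before_limit[OF w, where T=T and L=L])
      fix e :: real assume "0 < e"
      from H[OF this] show "\<exists>e'>0. e' \<le> e \<and> (\<exists>u. cmod (fst u) < e' \<and> exp (- L) \<le> cmod (fst u - snd u) \<and>
      shadows (sle_driving 8 B \<omega>) z 1 T (e' / 8) u)"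
        by blast
    qed
    then show "\<omega> \<in> ?A" using w by simp
  qed
  moreover have "Re (1 + (- 1) * ?F (z, 1)) \<le> prob ?B"
  proof (rule harmonic_le_prob[where G="\<lambda>y. 1 + (- 1) * ?F y" and E="\<lambda>L e. {y. cmod (snd y) < e \<and> exp (- L) \<le> cmod (fst y - snd y)}", OF z sets_swallowed_before])
    show "test_function pair_domain (\<lambda>y. 1 + (- 1) * ?F y) 0"
      using test_function_add[OF test_function_const test_function_cmult[OF test_function_strip_map, of "- 1"], of 1] by simp
    show "0 \<le> Re (1 + (- 1) * ?F y) \<and> Re (1 + (- 1) * ?F y) \<le> 1" if "y \<in> pair_domain" for y using strip_ratio_half_strip[OF that] by simp
    show "{y. cmod (snd y) < e \<and> exp (- L) \<le> cmod (fst y - snd y)} \<in> sets borel" for L e :: real by (rule bor)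
    fix L g :: real assume g: "0 < g"
    have "\<forall>\<^sub>F w in at 0 within upper_half_plane. dist (strip_map w) 1 < g" using l0 g by (rule tendstoD)
    then obtain b where b: "0 < b" "\<And>w. w \<in> upper_half_plane \<Longrightarrow> w \<noteq> 0 \<Longrightarrow> cmod w < b \<Longrightarrow> cmod (strip_map w - 1) < g"
      unfolding eventually_at by (auto simp: dist_norm)
    \<comment> \<open>If |Z| < e0, then (b + 1) |Z| < b exp (- L) <= b (|Z| + |X|), hence |Z| < b
      |X|.\<close>
    define e0 where "e0 = b * exp (- L) / (b + 1)"
    show "\<exists>e0>0. \<forall>e. 0 < e \<longrightarrow> e < e0 \<longrightarrow> (\<forall>y\<in>pair_domain. cmod (fst y) < e \<or> cmod (snd y) < e \<longrightarrow>
       exp (- L) \<le> cmod (fst y - snd y) \<longrightarrow> y \<in> {y. cmod (snd y) < e \<and> exp (- L) \<le> cmod (fst y - snd y)} \<or> Re (1 + (- 1) * ?F y) \<le> g)"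
    proof (rule exI[of _ e0], intro conjI allI impI ballI)
      show "0 < e0" using b by (simp add: e0_def)
      fix e y assume e: "0 < e" "e < e0" and y: "y \<in> pair_domain" "cmod (fst y) < e \<or> cmod (snd y) < e" "exp (- L) \<le> cmod (fst y - snd y)"
      show "y \<in> {y. cmod (snd y) < e \<and> exp (- L) \<le> cmod (fst y - snd y)} \<or> Re (1 + (- 1) * ?F y) \<le> g"
      proof (cases "cmod (snd y) < e")
        case True then show ?thesis using y by simp
      next
        case False
        then have s: "cmod (fst y) < e" using y by simp
        have "cmod (fst y - snd y) \<le> cmod (fst y) + cmod (snd y)" by (rule norm_triangle_ineq4)
        then have 1: "exp (- L) \<le> cmod (fst y) + cmod (snd y)" using y by linarith
        have "cmod (fst y) * (b + 1) < e0 * (b + 1)" using s e b by (intro mult_strict_right_mono) auto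
        also have "\<dots> = b * exp (- L)" using b by (simp add: e0_def)
        also have "\<dots> \<le> b * (cmod (fst y) + cmod (snd y))" using 1 b by (intro mult_left_mono) auto
        finally have "cmod (fst y) < b * cmod (snd y)" by (simp add: algebra_simps)
        then have "cmod (fst y / snd y) < b" using ratio[OF y(1)] by (simp add: norm_divide divide_less_eq)
        then have "cmod (?F y - 1) < g" using ratio[OF y(1)] by (intro b) (auto simp: upper_half_plane_def)
        then show ?thesis using complex_Re_le_cmod[of "1 - ?F y"] by (simp add: norm_minus_commute)
      qed
    qed
  next
    fix \<omega> L T
    assume w: "\<omega> \<in> space M" and H: "\<And>e. 0 < e \<Longrightarrow> \<exists>e'>0. e' \<le> e \<and> (\<exists>u\<in>{y. cmod (snd y) < e' \<and> exp (- L) \<le> cmod (fst y - snd y)}. shadows (sle_driving 8 B \<omega>) z 1 T (e' / 8) u)"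
    have "?t 1 \<omega> < ?t z \<omega>"
    proof (rule swallowed_before_limit[OF w, where T=T and L=L])
      fix e :: real assume "0 < e"
      from H[OF this] show "\<exists>e'>0. e' \<le> e \<and> (\<exists>u. cmod (fst u) < e' \<and> exp (- L) \<le> cmod (fst u - snd u) \<and>
      shadows (sle_driving 8 B \<omega>) 1 z T (e' / 8) u)"
        using shadows_swap[of "sle_driving 8 B \<omega>" z 1 T] by (metis (no_types, lifting) mem_Collect_eq fst_conv snd_conv norm_minus_commute)
    qed
    then show "\<omega> \<in> ?B" using w by simp
  qed
  moreover have "prob ?A + prob ?B \<le> 1"
  proof -
    have "prob ?A + prob ?B = prob (?A \<union> ?B)"
      by (rule finite_measure_Union[symmetric, OF sets_swallowed_before sets_swallowed_before]) auto
    then show ?thesis using prob_le_1 by simp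
  qed
  ultimately show ?thesis by simp
qed

end

theorem mainTheorem3:
  fixes M :: "'a measure" and B :: "real \<Rightarrow> 'a \<Rightarrow> real" and F :: "complex \<Rightarrow> complex"
    and z :: complex
  assumes "standard_brownian_motion M B"
    and "conformal_equivalence F upper_half_plane half_strip"
    and "(F \<longlongrightarrow> 1) (at 0 within upper_half_plane)"
    and "filterlim F at_infinity (at 1 within upper_half_plane)"
    and "(F \<longlongrightarrow> 0) (inf at_infinity (principal upper_half_plane))"
    and "z \<in> upper_half_plane"
  shows "{\<omega> \<in> space M. sle_swallowing_time 8 B z \<omega> < sle_swallowing_time 8 B 1 \<omega>} \<in> sets M \<and>
    measure M {\<omega> \<in> space M. sle_swallowing_time 8 B z \<omega> < sle_swallowing_time 8 B 1 \<omega>} = Re (F z)"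
proof -
  interpret standard_brownian_motion M B by (rule assms(1))
  have F: "F w = strip_map w" if "w \<in> upper_half_plane" for w
    by (rule conformal_equivalence_eq_strip_map[OF assms(2-5) that])
  \<comment> \<open>The boundary limits of \<open>strip_map\<close> are inherited from
    \<open>F\<close>, with which it agrees on the half-plane.\<close>
  have l0: "(strip_map \<longlongrightarrow> 1) (at 0 within upper_half_plane)"
    by (rule Lim_transform_eventually[OF assms(3)]) (auto simp: eventually_at_filter F)
  have linf: "(strip_map \<longlongrightarrow> 0) (inf at_infinity (principal upper_half_plane))"
    by (rule Lim_transform_eventually[OF assms(5)]) (auto simp: eventually_inf_principal F)
  have z: "0 < Im z" using assms(6) by (simp add: upper_half_plane_def)
  show ?thesis
    unfolding sle_swallowing_time_def
    using sets_swallowed_before[of z 1] prob_swallowed_before[OF z l0 linf] F[OF assms(6)] by simp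
qed

end
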